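(* There are absolute constants $c>0$ and $\rho_0>0$ such that for any $k\geq3$ and $r$ with $2^k\rho_0/k\leq r\leq 2^k\ln2$ there is $\xi=\xi(k,r)>0$ so that, for $n$ large enough, the following holds for any function $\omega=\omega(n)\geq1$. Fix any permutation $\pi$ of $[n]$ and any assignment $\sigma\in\{0,1\}^V$. Then for any integer $0\leq t\leq T$, $$\Pr\left[(\Phi,\pi,\sigma)\text{ is }(\delta_t,t)\text{-balanced}\right]\geq 1-\exp\Big[-2\xi n-10\sum_{s=1}^t\delta_s\Big],$$ where $\Phi=\Phi_k(n,m)$ with $m=\lceil rn\rceil$.
   Context: $V=\{x_1,\dots,x_n\}$; a clause of length $k$ is a disjunction of $k$ literals over $V$ (there are $(2n)^k$ of them); a $k$-CNF is a set of clauses; $\Phi_k(n,m)$ is a uniformly random set of $m$ clauses of length $k$. Substituting a value for a variable means deleting every clause that becomes satisfied and deleting the literals on that variable from the remaining clauses. BP: for a CNF $\Psi$, its factor graph is the bipartite graph on the unassigned variables and the clauses of $\Psi$, a clause being adjacent to the variables occurring in it; $N(v)$ is the neighbourhood of $v$; $\mathrm{sign}(x,a)=1$ if $x$ occurs positively in $a$, else $-1$. A message vector is $(\mu_{x\to a}(\zeta))$ with values in $[0,1]$ and $\mu_{x\to a}(0)+\mu_{x\to a}(1)=1$. Define $\mu_{a\to x}(\zeta)=1$ if $\zeta=(1+\mathrm{sign}(x,a))/2$, and $1-\prod_{y\in N(a)\setminus\{x\}}\mu_{y\to a}((1-\mathrm{sign}(y,a))/2)$ otherwise. Define $(\mathrm{BP}(\mu))_{x\to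 a}(\zeta)=\prod_{b\in N(x)\setminus\{a\}}\mu_{b\to x}(\zeta)/\big(\prod_{b\in N(x)\setminus\{a\}}\mu_{b\to x}(0)+\prod_{b\in N(x)\setminus\{a\}}\mu_{b\to x}(1)\big)$, and $\tfrac12$ if the denominator is $0$. Set $\mu[0]\equiv\tfrac12$, $\mu[\ell]=\mathrm{BP}(\mu[\ell-1])$, and $\mu_x(\Psi,\omega)=\prod_{b\in N(x)}\mu_{b\to x}(1)[\omega]/\big(\prod_{b\in N(x)}\mu_{b\to x}(0)[\omega]+\prod_{b\in N(x)}\mu_{b\to x}(1)[\omega]\big)$, and $\tfrac12$ if the denominator is $0$. Notation: $\delta_t=\exp(-c(1-t/n)k)$ and $T=(1-r/2^k)n$. For a permutation $\pi$ and $\sigma\in\{0,1\}^V$, $\Phi_{t,\pi,\sigma}$ is obtained from $\Phi$ by substituting $\sigma(x_{\pi(s)})$ for $x_{\pi(s)}$, $1\leq s\leq t$. For $l>t$, $x_{\pi(l)}$ is $(\delta,t)$-biased if $|\mu_{x_{\pi(l)}}(\Phi_{t,\pi,\sigma},\omega)-\tfrac12|>\delta$. $(\Phi,\pi,\sigma)$ is $(\delta,t)$-balanced if at most $\delta(n-t)$ variables are $(\delta,t)$-biased. *)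

theory Defs
  imports "HOL-Probability.Probability"
begin

text \<open>
  The variable \<open>x\<^sub>i\<close> is represented by its index \<open>i\<close>, and the truth values 0 and 1 by
  \<open>False\<close> and \<open>True\<close>.  The literal \<open>(x, b)\<close> is the one that is true iff \<open>x\<close> has value \<open>b\<close>.
  A clause is an ordered list of literals with repetitions allowed, so that there are
  \<open>(2 * n) ^ k\<close> clauses of length \<open>k\<close> over \<open>n\<close> variables.
\<close>

type_synonym literal = "nat \<times> bool"
type_synonym clause = "literal list"
type_synonym cnf = "clause set"

definition clauses :: "nat \<Rightarrow> nat \<Rightarrow> clause set" where
  "clauses k n = {C. length C = k \<and> set C \<subseteq> {1..n} \<times> UNIV}"

definition random_cnf :: "nat \<Rightarrow> nat \<Rightarrow> nat \<Rightarrow> cnf pmf" where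
  "random_cnf k n m = pmf_of_set {\<Phi>. \<Phi> \<subseteq> clauses k n \<and> card \<Phi> = m}"

text \<open>
  A CNF is a set, so residual clauses that become equal (as lists) are one clause of the
  resulting formula.
\<close>

definition substitute :: "nat \<Rightarrow> bool \<Rightarrow> cnf \<Rightarrow> cnf" where
  "substitute x b \<Psi> = filter (\<lambda>l. fst l \<noteq> x) ` {C \<in> \<Psi>. (x, b) \<notin> set C}"

primrec residual :: "cnf \<Rightarrow> (nat \<Rightarrow> nat) \<Rightarrow> (nat \<Rightarrow> bool) \<Rightarrow> nat \<Rightarrow> cnf" where
  "residual \<Phi> \<pi> \<sigma> 0 = \<Phi>"
| "residual \<Phi> \<pi> \<sigma> (Suc t) = substitute (\<pi> (Suc t)) (\<sigma> (\<pi> (Suc t))) (residual \<Phi> \<pi> \<sigma> t)"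

definition clause_vars :: "clause \<Rightarrow> nat set" where
  "clause_vars a = fst ` set a"

definition var_clauses :: "cnf \<Rightarrow> nat \<Rightarrow> clause set" where
  "var_clauses \<Psi> x = {a \<in> \<Psi>. x \<in> clause_vars a}"

definition occ_sign :: "nat \<Rightarrow> clause \<Rightarrow> int" where
  "occ_sign x a = (if (x, True) \<in> set a then 1 else -1)"

text \<open>
  Messages are total functions; only their values on the edges of the factor graph enter
  the marginals.  Since \<open>occ_sign x a\<close> is 1 or -1, the truth value \<open>(1 + occ_sign x a) / 2\<close> is
  \<open>occ_sign x a = 1\<close>, and \<open>(1 - occ_sign x a) / 2\<close> is \<open>occ_sign x a = -1\<close>.
\<close>

type_synonym messages = "nat \<Rightarrow> clause \<Rightarrow> bool \<Rightarrow> real"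

definition clause_message :: "messages \<Rightarrow> clause \<Rightarrow> nat \<Rightarrow> bool \<Rightarrow> real" where
  "clause_message \<mu> a x \<zeta> =
     (if \<zeta> = (occ_sign x a = 1) then 1
      else 1 - (\<Prod>y \<in> clause_vars a - {x}. \<mu> y a (occ_sign y a = -1)))"

definition normalized_product :: "messages \<Rightarrow> clause set \<Rightarrow> nat \<Rightarrow> bool \<Rightarrow> real" where
  "normalized_product \<mu> B x \<zeta> =
     (let p = (\<lambda>\<zeta>. \<Prod>b \<in> B. clause_message \<mu> b x \<zeta>)
      in if p False + p True = 0 then 1/2 else p \<zeta> / (p False + p True))"

definition BP :: "cnf \<Rightarrow> messages \<Rightarrow> messages" where
  "BP \<Psi> \<mu> = (\<lambda>x a \<zeta>. normalized_product \<mu> (var_clauses \<Psi> x - {a}) x \<zeta>)"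

definition BP_iterate :: "cnf \<Rightarrow> nat \<Rightarrow> messages" where
  "BP_iterate \<Psi> l = (BP \<Psi> ^^ l) (\<lambda>x a \<zeta>. 1/2)"

definition BP_marginal :: "cnf \<Rightarrow> nat \<Rightarrow> nat \<Rightarrow> real" where
  "BP_marginal \<Psi> w x = normalized_product (BP_iterate \<Psi> w) (var_clauses \<Psi> x) x True"

definition biased ::
  "nat \<Rightarrow> cnf \<Rightarrow> (nat \<Rightarrow> nat) \<Rightarrow> (nat \<Rightarrow> bool) \<Rightarrow> real \<Rightarrow> nat \<Rightarrow> nat \<Rightarrow> bool" where
  "biased w \<Phi> \<pi> \<sigma> \<delta> t x \<longleftrightarrow> \<bar>BP_marginal (residual \<Phi> \<pi> \<sigma> t) w x - 1/2\<bar> > \<delta>"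

definition balanced ::
  "nat \<Rightarrow> nat \<Rightarrow> cnf \<Rightarrow> (nat \<Rightarrow> nat) \<Rightarrow> (nat \<Rightarrow> bool) \<Rightarrow> real \<Rightarrow> nat \<Rightarrow> bool" where
  "balanced n w \<Phi> \<pi> \<sigma> \<delta> t \<longleftrightarrow>
     real (card {l \<in> {t<..n}. biased w \<Phi> \<pi> \<sigma> \<delta> t (\<pi> l)}) \<le> \<delta> * (real n - real t)"

definition bias_bound :: "real \<Rightarrow> nat \<Rightarrow> nat \<Rightarrow> nat \<Rightarrow> real" where
  "bias_bound c k n t = exp (- c * (1 - real t / real n) * real k)"

end

theory Submission
  imports Defs
begin

text \<open>
  Let \<open>\<theta> = 1 - t / n\<close>, \<open>\<kappa> = \<theta> k\<close> and \<open>\<delta> = exp (- \<kappa> / 500)\<close>.  Choosing \<open>\<rho>\<^sub>0\<close> huge forces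
  \<open>\<kappa>\<close> to be huge, and then a failure probability of order \<open>exp (- \<delta> \<theta> n / 2000)\<close> suffices.

  Deterministically, along the BP iteration one maintains a small set \<open>E\<close> of exceptional variables and a
  small set \<open>P\<close> of driving clauses (at least half of whose variables are possibly biased), such that a
  message from \<open>y\<close> to \<open>b\<close> is unbiased unless \<open>y\<close> lies in \<open>E\<close> or in a driving clause other than
  \<open>b\<close>.  A clause that drives in the next round has half of its variables in \<open>E\<close> or in previous driving
  clauses, so many such clauses would contradict the expansion of the factor graph.  For the other variables,
  the log-likelihood ratio is expanded to first order: the constant and the linear part are signed sums, small
  outside a small set because the signs of the literals are random, and the remainder is quadratically small.

  The signed sums and the remainder are controlled uniformly in the messages by exponential moments: every clause
  of length at least \<open>\<kappa> / 10\<close> has influence at most \<open>\<delta>\<^sup>8\<close>, so the deviation probabilities are so small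
  that a union bound over all pairs of sets of variables costs nothing.
\<close>

section \<open>Uniformly random subsets of fixed size\<close>

text \<open>Messages live on edges, which in general far outnumber the variables, so a union bound
  over all messages would fail. The way out: removing one clause of influence at most \<delta>^8
  hardly moves a normalized product, so outside the driving clauses the message from
  \<open>y\<close> to \<open>b\<close> is a function \<Gamma> of \<open>y\<close> alone up to
  \<delta>^8. A form linear in \<Gamma> is controlled by its values on indicators of subsets of
  \<open>U\<close>, and there are at most exp N of these. \<open>E\<close> and \<open>P\<close> are
  recomputed in every round instead of being enlarged, and the bounds \<delta> N / 20 and \<delta> N
  / 2 on their sizes reproduce themselves; hence the uniformity in \<omega>. The condition t \<le> T
  is used twice: it makes \<kappa> large, and it gives m \<le> 2 N 2^k, so that sums of residual
  weights over the formula have means governed by N. Constants: a clause of length L \<ge> \<kappa>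
  / 10 has influence at most exp (- 4 L / 25), and 4/25 * 1/10 = 8/500 yields \<delta>^8 for c =
  1/500. The sum of the \<delta>_s is at most \<delta> (1 + 500 n / k), and n / k \<le> N / 10^8, so
  ten times this sum is a small part of \<delta> N / 2000.\<close>

lemma sum_subsets_card_le:
  fixes F :: "'a set \<Rightarrow> real"
  assumes fin: "finite M" and s: "s \<ge> 0"
    and step: "\<And>D. D \<subseteq> M \<Longrightarrow> (\<Sum>C\<in>M - D. F (insert C D)) \<le> s * F D"
  shows "(\<Sum>D | D \<subseteq> M \<and> card D = d. F D) \<le> s ^ d / fact d * F {}"
proof (induction d)
  case 0
  have "{D. D \<subseteq> M \<and> card D = 0} = {{}}"
    using fin finite_subset by fastforce
  then show ?case by simp
next
  case (Suc d)
  let ?P = "\<lambda>d. {D. D \<subseteq> M \<and> card D = d}"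
  have finP: "finite (?P d)" for d using fin by simp
  have finD: "finite D" if "D \<subseteq> M" for D using that fin finite_subset by blast
  \<comment> \<open>Double counting: a set of size \<open>Suc d\<close> arises as
    \<open>insert C D\<close> from exactly \<open>Suc d\<close> pairs.\<close>
  have "real (Suc d) * (\<Sum>D\<in>?P (Suc d). F D) = (\<Sum>D\<in>?P (Suc d). \<Sum>C\<in>D. F D)"
    by (simp add: sum_distrib_left)
  also have "\<dots> = (\<Sum>(D, C)\<in>Sigma (?P (Suc d)) (\<lambda>D. D). F D)"
    using finP finD by (subst sum.Sigma) auto
  also have "\<dots> = (\<Sum>(D, C)\<in>Sigma (?P d) (\<lambda>D. M - D). F (insert C D))"
    by (rule sum.reindex_bij_witness[where i = "\<lambda>(D, C). (insert C D, C)"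
          and j = "\<lambda>(D, C). (D - {C}, C)"])
      (auto simp: insert_absorb finD card_insert_if)
  also have "\<dots> = (\<Sum>D\<in>?P d. \<Sum>C\<in>M - D. F (insert C D))"
    using finP fin by (subst sum.Sigma) auto
  also have "\<dots> \<le> (\<Sum>D\<in>?P d. s * F D)"
    by (intro sum_mono step) auto
  also have "\<dots> = s * (\<Sum>D\<in>?P d. F D)"
    by (simp add: sum_distrib_left)
  also have "\<dots> \<le> s * (s ^ d / fact d * F {})"
    using Suc s by (intro mult_left_mono) auto
  finally have "real (Suc d) * (\<Sum>D\<in>?P (Suc d). F D) \<le> s ^ Suc d / fact d * F {}"
    by simp
  then have "(\<Sum>D\<in>?P (Suc d). F D) \<le> (s ^ Suc d / fact d * F {}) / real (Suc d)"
    by (simp only: pos_le_divide_eq of_nat_0_less_iff zero_less_Suc mult.commute)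
  also have "\<dots> = s ^ Suc d / fact (Suc d) * F {}"
    by (simp only: fact_Suc of_nat_mult) (simp add: divide_inverse mult_ac)
  finally show ?case .
qed

text \<open>A bound for the elementary symmetric polynomial of degree \<open>d\<close>: adding an
  element to \<open>D\<close> multiplies the product by some \<open>f C\<close>, and these factors
  sum to at most the full sum.\<close>

lemma sum_prod_subsets_card_le:
  fixes f :: "'a \<Rightarrow> real"
  assumes fin: "finite M" and f: "\<And>C. C \<in> M \<Longrightarrow> f C \<ge> 0"
  shows "(\<Sum>D | D \<subseteq> M \<and> card D = d. \<Prod>C\<in>D. f C) \<le> (\<Sum>C\<in>M. f C) ^ d / fact d"
proof -
  have "(\<Sum>C\<in>M - D. \<Prod>C\<in>insert C D. f C) \<le> (\<Sum>C\<in>M. f C) * (\<Prod>C\<in>D. f C)" if D: "D \<subseteq> M" for D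
  proof -
    have "finite D" using D fin finite_subset by blast
    then have "(\<Sum>C\<in>M - D. \<Prod>C\<in>insert C D. f C) = (\<Sum>C\<in>M - D. f C) * (\<Prod>C\<in>D. f C)"
      by (simp add: sum_distrib_right)
    also have "\<dots> \<le> (\<Sum>C\<in>M. f C) * (\<Prod>C\<in>D. f C)"
      using D f fin by (intro mult_right_mono sum_mono2 prod_nonneg) auto
    finally show ?thesis .
  qed
  from sum_subsets_card_le[OF fin _ this, of d] show ?thesis
    using f by (simp add: sum_nonneg)
qed

text \<open>Compares the falling factorial with the power. Once 2 m^2 \<le> M, drawing without
  replacement costs only a factor 2 against independent draws.\<close>

lemma binomial_fact_lower:
  "real M ^ m * (1 - real m ^ 2 / real M) \<le> real (M choose m) * fact m" if "M > 0" "m \<le> M"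
  using that(2)
proof (induction m)
  case (Suc m)
  have M: "real M > 0" using that by simp
  have "Suc m * (M choose Suc m) = (M - m) * (M choose m)"
    by (simp only: binomial_absorb_comp binomial_absorption)
  then have "real (Suc m) * real (M choose Suc m) = (real M - real m) * real (M choose m)"
    using Suc.prems by (metis Suc_leD of_nat_diff of_nat_mult)
  then have eq: "real (M choose Suc m) * fact (Suc m) = (real (M choose m) * fact m) * (real M - real m)"
    by (simp only: fact_Suc of_nat_mult mult_ac)
  have "real M ^ Suc m * (1 - real (Suc m) ^ 2 / real M)
      \<le> real M ^ Suc m * ((1 - real m ^ 2 / real M) * (1 - real m / real M))"
  proof (intro mult_left_mono)
    have "(1 - real m ^ 2 / real M) * (1 - real m / real M)
      = 1 - (real m ^ 2 + real m) / real M + real m ^ 3 / real M ^ 2"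
      using M by (simp add: field_simps power2_eq_square power3_eq_cube)
    moreover have "real (Suc m) ^ 2 \<ge> real m ^ 2 + real m"
      by (simp add: power2_eq_square algebra_simps)
    then have "real (Suc m) ^ 2 / real M \<ge> (real m ^ 2 + real m) / real M"
      using M by (intro divide_right_mono) auto
    moreover have "real m ^ 3 / real M ^ 2 \<ge> 0" by simp
    ultimately show "1 - real (Suc m) ^ 2 / real M \<le> (1 - real m ^ 2 / real M) * (1 - real m / real M)"
      by linarith
  qed simp
  also have "\<dots> = (real M ^ m * (1 - real m ^ 2 / real M)) * (real M - real m)"
    using M by (simp add: field_simps)
  also have "\<dots> \<le> (real (M choose m) * fact m) * (real M - real m)"
    using Suc by (intro mult_right_mono) auto
  finally show ?case by (simp only: eq)
qed simp

definition random_subset :: "'a set \<Rightarrow> nat \<Rightarrow> 'a set pmf" where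
  "random_subset M m = pmf_of_set {D. D \<subseteq> M \<and> card D = m}"

text \<open>Markov's inequality, with \<open>f\<close> a majorant of the indicator of
  \<open>B\<close>.\<close>

lemma prob_random_subset_le:
  assumes fin: "finite M" and m: "m \<le> card M"
    and f0: "\<And>D. D \<subseteq> M \<Longrightarrow> card D = m \<Longrightarrow> f D \<ge> (0::real)"
    and f1: "\<And>D. D \<subseteq> M \<Longrightarrow> card D = m \<Longrightarrow> D \<in> B \<Longrightarrow> f D \<ge> 1"
  shows "measure_pmf.prob (random_subset M m) B
    \<le> (\<Sum>D | D \<subseteq> M \<and> card D = m. f D) / real (card M choose m)"
proof -
  let ?S = "{D. D \<subseteq> M \<and> card D = m}"
  have finS: "finite ?S" using fin by simp
  have cardS: "card ?S = card M choose m" using n_subsets[OF fin] by simp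
  then have ne: "?S \<noteq> {}" using m by (metis card.empty binomial_eq_0_iff not_le)
  have "measure_pmf.prob (random_subset M m) B = real (card (?S \<inter> B)) / real (card ?S)"
    unfolding random_subset_def by (simp add: measure_pmf_of_set[OF ne finS])
  also have "real (card (?S \<inter> B)) = (\<Sum>D\<in>?S \<inter> B. 1)" by simp
  also have "\<dots> \<le> (\<Sum>D\<in>?S \<inter> B. f D)" using f1 by (intro sum_mono) auto
  also have "\<dots> \<le> (\<Sum>D\<in>?S. f D)" using f0 finS by (intro sum_mono2) auto
  finally show ?thesis using cardS by (simp add: divide_right_mono)
qed

text \<open>A Chernoff bound for draws without replacement: the exponential moment of the sum is at
  most twice that of \<open>m\<close> independent draws, whose single factor is
  \<open>1 + X\<close>.\<close>

lemma prob_sum_ge_le: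
  fixes w :: "'a \<Rightarrow> real"
  assumes fin: "finite M" and M: "card M > 0" and m: "2 * m ^ 2 \<le> card M" and lam: "l \<ge> 0"
    and avg: "(\<Sum>C\<in>M. exp (l * w C)) \<le> real (card M) * (1 + X)" and X: "real m * X \<le> Y"
  shows "measure_pmf.prob (random_subset M m) {D. (\<Sum>C\<in>D. w C) \<ge> h} \<le> 2 * exp (Y - l * h)"
proof -
  let ?f = "\<lambda>D. exp (l * ((\<Sum>C\<in>D. w C) - h))"
  let ?S = "{D. D \<subseteq> M \<and> card D = m}"
  have "m \<le> 2 * m ^ 2" by (cases m) (auto simp: power2_eq_square)
  then have mM: "m \<le> card M" using m by linarith
  have Mr: "real (card M) > 0" using M by simp
  have X1: "1 + X \<ge> 0"
  proof -
    have "0 \<le> (\<Sum>C\<in>M. exp (l * w C))" by (intro sum_nonneg) simp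
    then have "0 \<le> real (card M) * (1 + X)" using avg by linarith
    then show ?thesis using Mr by (simp add: zero_le_mult_iff)
  qed
  have "measure_pmf.prob (random_subset M m) {D. (\<Sum>C\<in>D. w C) \<ge> h}
      \<le> (\<Sum>D\<in>?S. ?f D) / real (card M choose m)"
    using lam by (intro prob_random_subset_le[OF fin mM]) auto
  also have "(\<Sum>D\<in>?S. ?f D) = exp (- l * h) * (\<Sum>D\<in>?S. \<Prod>C\<in>D. exp (l * w C))"
    using finite_subset[OF _ fin]
    by (auto simp: sum_distrib_left exp_sum[symmetric] exp_add[symmetric] right_diff_distrib
        intro!: sum.cong)
  also have "(\<Sum>D\<in>?S. \<Prod>C\<in>D. exp (l * w C)) \<le> (\<Sum>C\<in>M. exp (l * w C)) ^ m / fact m"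
    by (rule sum_prod_subsets_card_le[OF fin]) simp
  also have "(\<Sum>C\<in>M. exp (l * w C)) ^ m \<le> (real (card M) * (1 + X)) ^ m"
    by (rule power_mono[OF avg]) (simp add: sum_nonneg)
  also have "\<dots> = real (card M) ^ m * (1 + X) ^ m" by (simp add: power_mult_distrib)
  also have "(1 + X) ^ m \<le> exp X ^ m" using X1 exp_ge_add_one_self by (intro power_mono) auto
  also have "exp X ^ m = exp (real m * X)" by (simp add: exp_of_nat_mult)
  also have "\<dots> \<le> exp Y" using X by simp
  finally have 1: "measure_pmf.prob (random_subset M m) {D. (\<Sum>C\<in>D. w C) \<ge> h}
      \<le> exp (- l * h) * (real (card M) ^ m * exp Y / fact m) / real (card M choose m)"
    by (simp add: divide_right_mono mult_left_mono)
  have "real m ^ 2 / real (card M) \<le> 1 / 2"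
  proof -
    have "real (2 * m ^ 2) \<le> real (card M)" using m by (rule of_nat_mono)
    then show ?thesis using Mr by (simp add: field_simps)
  qed
  then have "real (card M) ^ m * (1 / 2) \<le> real (card M) ^ m * (1 - real m ^ 2 / real (card M))"
    by (intro mult_left_mono) auto
  also have "\<dots> \<le> real (card M choose m) * fact m" by (rule binomial_fact_lower[OF M mM])
  finally have 2: "real (card M) ^ m \<le> 2 * (real (card M choose m) * fact m)" by simp
  have pos: "real (card M choose m) > 0" using mM by simp
  have "exp (- l * h) * (real (card M) ^ m * exp Y / fact m) / real (card M choose m)
     = exp (Y - l * h) * (real (card M) ^ m / (real (card M choose m) * fact m))"
    by (simp add: exp_diff exp_minus field_simps)
  also have "\<dots> \<le> exp (Y - l * h) * 2"
    using 2 pos by (intro mult_left_mono) (auto simp: field_simps)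
  finally show ?thesis using 1 by simp
qed

text \<open>A superset is determined by its other elements, and the resulting quotient of binomials
  is a product of factors (m - i) / (K - i) \<le> m / K.\<close>

lemma card_supersets_le:
  assumes fin: "finite M" and D: "D \<subseteq> M" and m: "m \<le> card M"
  shows "real (card {E. E \<subseteq> M \<and> card E = m \<and> D \<subseteq> E})
    \<le> (real m / real (card M)) ^ card D * real (card M choose m)"
proof (cases "card D \<le> m")
  case False
  have "{E. E \<subseteq> M \<and> card E = m \<and> D \<subseteq> E} = {}"
    using False card_mono[OF finite_subset[OF _ fin], of _ D] by fastforce
  then show ?thesis by (simp only: card.empty) simp
next
  case True
  have finD: "finite D" using D fin finite_subset by blast
  have "bij_betw (\<lambda>E. E - D) {E. E \<subseteq> M \<and> card E = m \<and> D \<subseteq> E} {E. E \<subseteq> M - D \<and> card E = m - card D}"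
  proof (rule bij_betwI[where g = "\<lambda>E. E \<union> D"])
    show "(\<lambda>E. E - D) \<in> {E. E \<subseteq> M \<and> card E = m \<and> D \<subseteq> E} \<rightarrow> {E. E \<subseteq> M - D \<and> card E = m - card D}"
      using finD by (auto simp: card_Diff_subset)
    show "(\<lambda>E. E \<union> D) \<in> {E. E \<subseteq> M - D \<and> card E = m - card D} \<rightarrow> {E. E \<subseteq> M \<and> card E = m \<and> D \<subseteq> E}"
    proof
      fix E assume E: "E \<in> {E. E \<subseteq> M - D \<and> card E = m - card D}"
      then have "finite E" using fin finite_subset by auto
      then have "card (E \<union> D) = m" using E finD True by (subst card_Un_disjoint) auto
      then show "E \<union> D \<in> {E. E \<subseteq> M \<and> card E = m \<and> D \<subseteq> E}" using E D by auto
    qed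
  qed auto
  then have "card {E. E \<subseteq> M \<and> card E = m \<and> D \<subseteq> E} = card {E. E \<subseteq> M - D \<and> card E = m - card D}"
    by (rule bij_betw_same_card)
  also have "\<dots> = (card M - card D) choose (m - card D)"
    using n_subsets[of "M - D" "m - card D"] fin finD D by (simp add: card_Diff_subset)
  finally have eq: "card {E. E \<subseteq> M \<and> card E = m \<and> D \<subseteq> E} = (card M - card D) choose (m - card D)" .
  have "real ((K - d) choose (m - d)) \<le> (real m / real K) ^ d * real (K choose m)"
    if "d \<le> m" "m \<le> K" for d K m
    using that
  proof (induction d arbitrary: K m)
    case (Suc d)
    then obtain m' K' where mk: "m = Suc m'" "K = Suc K'" by (metis Suc_le_D le_trans)
    have "real ((K - Suc d) choose (m - Suc d)) \<le> (real m' / real K') ^ d * real (K' choose m')"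
      using Suc mk by simp
    also have "real (K' choose m') = real m / real K * real (K choose m)"
      using Suc_times_binomial[of m' K'] mk
      by (simp add: field_simps del: of_nat_Suc binomial_Suc_Suc flip: of_nat_mult)
    also have "(real m' / real K') ^ d * (real m / real K * real (K choose m))
        \<le> (real m / real K) ^ d * (real m / real K * real (K choose m))"
    proof (intro mult_right_mono power_mono)
      show "real m' / real K' \<le> real m / real K"
        using Suc.prems mk by (cases "K' = 0") (auto simp: field_simps)
    qed simp_all
    finally show ?case by (simp add: mult_ac)
  qed simp
  from this[OF True m] show ?thesis using eq by simp
qed

text \<open>A first-moment bound over bad subfamilies of all sizes at once. The expectation of the
  sum of \<open>F\<close> over the subsets of a random set is bounded by an exponential series,
  because each further element costs a factor \<open>s * card M\<close> in the sum and a factor m /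
  card M in the probability.\<close>

lemma prob_subset_in_le:
  fixes F :: "'a set \<Rightarrow> real"
  assumes fin: "finite M" and M: "card M > 0" and m: "m \<le> card M"
    and F: "\<And>D. F D \<ge> 0" and s: "s \<ge> 0"
    and step: "\<And>D. D \<subseteq> M \<Longrightarrow> (\<Sum>C\<in>M - D. F (insert C D)) \<le> s * real (card M) * F D"
    and bad: "\<And>D. D \<subseteq> M \<Longrightarrow> D \<in> B \<Longrightarrow> F D \<ge> L" and L: "L > 0"
  shows "measure_pmf.prob (random_subset M m) {E. \<exists>D \<in> B. D \<subseteq> E} \<le> exp (real m * s) * F {} / L"
proof -
  let ?S = "{D. D \<subseteq> M \<and> card D = m}"
  let ?K = "card M"
  let ?f = "\<lambda>E. (\<Sum>D | D \<subseteq> E. F D) / L"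
  have Mr: "real ?K > 0" using M by simp
  have Sne: "real (?K choose m) > 0" using m by simp
  have finS: "finite ?S" using fin by simp
  have finsub: "finite {D. D \<subseteq> E}" if "E \<subseteq> M" for E
    using that fin by (metis finite_Collect_subsets finite_subset)
  have "measure_pmf.prob (random_subset M m) {E. \<exists>D \<in> B. D \<subseteq> E} \<le> (\<Sum>E\<in>?S. ?f E) / real (?K choose m)"
  proof (rule prob_random_subset_le[OF fin m])
    fix E assume E: "E \<subseteq> M" "card E = m"
    show "0 \<le> ?f E" using F L by (intro divide_nonneg_pos sum_nonneg) auto
    assume "E \<in> {E. \<exists>D \<in> B. D \<subseteq> E}"
    then obtain D where D: "D \<in> B" "D \<subseteq> E" by auto
    then have "L \<le> F D" using bad E by blast
    also have "\<dots> \<le> (\<Sum>D | D \<subseteq> E. F D)"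
      using F D finsub[OF E(1)] by (intro member_le_sum) auto
    finally show "1 \<le> ?f E" using L by simp
  qed
  also have "(\<Sum>E\<in>?S. ?f E) = (\<Sum>E\<in>?S. \<Sum>D | D \<subseteq> M \<and> D \<subseteq> E. F D) / L"
    by (simp add: sum_divide_distrib) (intro sum.cong, auto intro: arg_cong[where f = "\<lambda>A. sum F A / L"])
  also have "(\<Sum>E\<in>?S. \<Sum>D | D \<subseteq> M \<and> D \<subseteq> E. F D) = (\<Sum>D | D \<subseteq> M. \<Sum>E | E \<in> ?S \<and> D \<subseteq> E. F D)"
    using sum.swap_restrict[OF finS, of "{D. D \<subseteq> M}" "\<lambda>E D. F D" "\<lambda>E D. D \<subseteq> E"] fin by simp
  also have "\<dots> = (\<Sum>D | D \<subseteq> M. real (card {E. E \<subseteq> M \<and> card E = m \<and> D \<subseteq> E}) * F D)"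
    by (simp add: conj_ac)
  also have "\<dots> \<le> (\<Sum>D | D \<subseteq> M. ((real m / real ?K) ^ card D * real (?K choose m)) * F D)"
    using F by (intro sum_mono mult_right_mono card_supersets_le[OF fin _ m]) auto
  also have "\<dots> = real (?K choose m) * (\<Sum>D | D \<subseteq> M. (real m / real ?K) ^ card D * F D)"
    by (simp add: sum_distrib_left mult_ac)
  also have "(\<Sum>D | D \<subseteq> M. (real m / real ?K) ^ card D * F D)
     = (\<Sum>d\<le>?K. \<Sum>D | D \<subseteq> M \<and> card D = d. (real m / real ?K) ^ card D * F D)"
    using fin by (subst sum.group[of "{D. D \<subseteq> M}" "{..?K}" card, symmetric])
      (auto simp: card_mono conj_ac)
  also have "\<dots> = (\<Sum>d\<le>?K. (real m / real ?K) ^ d * (\<Sum>D | D \<subseteq> M \<and> card D = d. F D))"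
    by (simp add: sum_distrib_left)
  also have "\<dots> \<le> (\<Sum>d\<le>?K. (real m / real ?K) ^ d * ((s * real ?K) ^ d / fact d * F {}))"
    using s step by (intro sum_mono mult_left_mono sum_subsets_card_le[OF fin]) auto
  also have "\<dots> = (\<Sum>d\<le>?K. (real m * s) ^ d / fact d) * F {}"
    using Mr by (simp add: sum_distrib_right power_mult_distrib power_divide mult_ac sum_distrib_left)
  also have "(\<Sum>d\<le>?K. (real m * s) ^ d / fact d) \<le> exp (real m * s)"
  proof -
    have "summable (\<lambda>d. (real m * s) ^ d /\<^sub>R fact d)" by (rule summable_exp_generic)
    then have "(\<Sum>d\<le>?K. (real m * s) ^ d /\<^sub>R fact d) \<le> (\<Sum>d. (real m * s) ^ d /\<^sub>R fact d)"
      using s by (intro sum_le_suminf) auto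
    then show ?thesis by (simp add: exp_def scaleR_conv_of_real divide_inverse mult.commute)
  qed
  finally have "measure_pmf.prob (random_subset M m) {E. \<exists>D \<in> B. D \<subseteq> E}
     \<le> real (?K choose m) * (exp (real m * s) * F {}) / L / real (?K choose m)"
    using F L Sne by (simp add: divide_right_mono mult_left_mono mult_right_mono)
  then show ?thesis using Sne by simp
qed

section \<open>The deterministic analysis of belief propagation\<close>

lemma ln_one_minus_approx:
  assumes "0 \<le> q" "q \<le> (1/2::real)"
  shows "\<bar>- ln (1 - q) - q\<bar> \<le> 2 * q\<^sup>2"
  using ln_one_minus_pos_lower_bound[of q] ln_one_minus_pos_upper_bound[of q] assms by auto

text \<open>The left side is a logistic function of the log ratio, which is Lipschitz; the constant
  1 instead of 1/4 suffices.\<close>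

lemma ratio_minus_half_le:
  assumes "x > 0" "y > (0::real)"
  shows "\<bar>x / (y + x) - 1/2\<bar> \<le> \<bar>ln x - ln y\<bar>"
proof -
  have *: "\<bar>x / (y + x) - 1/2\<bar> \<le> ln x - ln y" if "x \<ge> y" "y > 0" for x y :: real
  proof -
    have "ln (y / x) \<le> y / x - 1" using that by (intro ln_le_minus_one) simp
    then have 1: "1 - y / x \<le> ln x - ln y" using that by (simp add: ln_div)
    have "x / (y + x) - 1/2 = (x - y) / (2 * (y + x))" using that by (simp add: field_simps)
    also have "\<dots> \<le> (x - y) / x" using that by (intro divide_left_mono) auto
    also have "\<dots> = 1 - y / x" using that by (simp add: field_simps)
    finally have 2: "x / (y + x) - 1/2 \<le> ln x - ln y" using 1 by simp
    have "x / (y + x) - 1/2 \<ge> 0" using that by (simp add: field_simps)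
    then show ?thesis using 2 by simp
  qed
  show ?thesis
  proof (cases "x \<ge> y")
    case False
    have "x / (y + x) - 1/2 = - (y / (x + y) - 1/2)" using assms by (simp add: field_simps)
    then show ?thesis using *[of x y] False assms by simp
  qed (use * assms in auto)
qed

text \<open>Each clause multiplies only one of the two products by \<open>1 - q b\<close>, so the
  log ratio is a signed sum of \<open>- ln (1 - q b)\<close>. The linear part keeps its signs, since
  cancellation will be needed there; only the rest is bounded in absolute value.\<close>

lemma normalized_product_bias_le:
  assumes fin: "finite B" and q: "\<And>b. b \<in> B \<Longrightarrow> 0 \<le> q b \<and> q b \<le> 1/2"
    and msg: "\<And>b \<zeta>. b \<in> B \<Longrightarrow> clause_message \<mu> b x \<zeta> = (if \<zeta> = (occ_sign x b = 1) then 1 else 1 - q b)"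
  shows "\<bar>normalized_product \<mu> B x True - 1/2\<bar>
    \<le> \<bar>\<Sum>b\<in>B. of_int (occ_sign x b) * q b\<bar> + 2 * (\<Sum>b\<in>B. (q b)\<^sup>2)"
proof -
  let ?p = "\<lambda>\<zeta>. \<Prod>b\<in>B. clause_message \<mu> b x \<zeta>"
  have pos: "clause_message \<mu> b x \<zeta> > 0" if "b \<in> B" for b \<zeta>
    using msg[OF that] q[OF that] by auto
  then have ppos: "?p \<zeta> > 0" for \<zeta> by (intro prod_pos) auto
  have "normalized_product \<mu> B x True = ?p True / (?p False + ?p True)"
    using ppos[of True] ppos[of False] by (simp add: normalized_product_def Let_def)
  then have "\<bar>normalized_product \<mu> B x True - 1/2\<bar> \<le> \<bar>ln (?p True) - ln (?p False)\<bar>"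
    using ratio_minus_half_le[OF ppos ppos, of True False] by simp
  also have "ln (?p True) - ln (?p False)
      = (\<Sum>b\<in>B. ln (clause_message \<mu> b x True) - ln (clause_message \<mu> b x False))"
    using fin pos by (subst (1 2) ln_prod) (auto simp: sum_subtractf dest: less_imp_neq[OF pos])
  also have "\<dots> = (\<Sum>b\<in>B. of_int (occ_sign x b) * (- ln (1 - q b)))"
    by (intro sum.cong) (auto simp: msg occ_sign_def)
  also have "\<dots> = (\<Sum>b\<in>B. of_int (occ_sign x b) * q b)
      + (\<Sum>b\<in>B. of_int (occ_sign x b) * (- ln (1 - q b) - q b))"
    by (simp add: sum.distrib[symmetric] right_diff_distrib algebra_simps)
  also have "\<bar>\<dots>\<bar> \<le> \<bar>\<Sum>b\<in>B. of_int (occ_sign x b) * q b\<bar>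
      + \<bar>\<Sum>b\<in>B. of_int (occ_sign x b) * (- ln (1 - q b) - q b)\<bar>"
    by (rule abs_triangle_ineq)
  also have "\<bar>\<Sum>b\<in>B. of_int (occ_sign x b) * (- ln (1 - q b) - q b)\<bar>
      \<le> (\<Sum>b\<in>B. \<bar>of_int (occ_sign x b) * (- ln (1 - q b) - q b)\<bar>)"
    by (rule sum_abs)
  also have "\<dots> \<le> (\<Sum>b\<in>B. 2 * (q b)\<^sup>2)"
    using q ln_one_minus_approx by (intro sum_mono) (auto simp: abs_mult occ_sign_def)
  finally show ?thesis by (simp add: sum_distrib_left)
qed

lemma normalized_product_range:
  assumes "\<And>b \<zeta>. b \<in> B \<Longrightarrow> 0 \<le> clause_message \<mu> b x \<zeta>"
  shows "0 \<le> normalized_product \<mu> B x \<zeta>"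
    "normalized_product \<mu> B x True + normalized_product \<mu> B x False = 1"
proof -
  have p: "0 \<le> (\<Prod>b\<in>B. clause_message \<mu> b x \<zeta>)" for \<zeta> using assms by (intro prod_nonneg) auto
  show "0 \<le> normalized_product \<mu> B x \<zeta>"
    using p[of True] p[of False] p[of \<zeta>] by (auto simp: normalized_product_def Let_def)
  show "normalized_product \<mu> B x True + normalized_product \<mu> B x False = 1"
    by (auto simp: normalized_product_def Let_def add_divide_distrib[symmetric] add.commute)
qed

text \<open>Since q \<le> 1/2, damping one of the two competing weights keeps the normalizer at
  least half of what it was.\<close>

lemma removed_factor_le:
  assumes "P \<ge> 0" "R \<ge> 0" "P + R > 0" "0 \<le> q" "q \<le> (1/2::real)"
  shows "\<bar>P * (1 - q) / (P * (1 - q) + R) - P / (P + R)\<bar> \<le> q"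
proof -
  have "P * (1 - q) \<le> P" using assms by (simp add: mult_left_le)
  have "(1 - q) * (P + R) \<le> P * (1 - q) + R"
    using assms by (simp add: algebra_simps mult_left_le)
  moreover have "(1 - q) * (P + R) \<ge> 1/2 * (P + R)" using assms by (intro mult_right_mono) auto
  ultimately have D: "P * (1 - q) + R \<ge> 1/2 * (P + R)" by linarith
  then have D0: "P * (1 - q) + R > 0" using assms by auto
  have "P / (P + R) - P * (1 - q) / (P * (1 - q) + R) = q * (P * R) / ((P * (1 - q) + R) * (P + R))"
    using D0 assms by (simp add: field_simps)
  moreover have "q * (P * R) / ((P * (1 - q) + R) * (P + R)) \<le> q"
  proof -
    have "P * R \<le> 1/2 * (P + R) * (P + R)" using assms
      by (simp add: algebra_simps)
    also have "\<dots> \<le> (P * (1 - q) + R) * (P + R)" using D assms by (intro mult_right_mono) auto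
    finally have "q * (P * R) \<le> q * ((P * (1 - q) + R) * (P + R))"
      using assms by (intro mult_left_mono)
    then show ?thesis using D0 assms by (simp add: divide_le_eq)
  qed
  moreover have "0 \<le> q * (P * R) / ((P * (1 - q) + R) * (P + R))" using D0 assms by simp
  moreover have "x - y = z \<Longrightarrow> z \<le> q \<Longrightarrow> 0 \<le> z \<Longrightarrow> \<bar>y - x\<bar> \<le> q" for x y z :: real by simp
  ultimately show ?thesis by blast
qed

text \<open>Compares the message sent to \<open>b\<close> with the full marginal. This is what
  allows an edge message to be replaced by a function of the variable.\<close>

lemma normalized_product_remove_le:
  assumes fin: "finite B" and b: "b \<in> B"
    and nonneg: "\<And>b \<zeta>. b \<in> B \<Longrightarrow> 0 \<le> clause_message \<mu> b x \<zeta>"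
    and q: "0 \<le> q" "q \<le> 1/2"
    and msg: "\<And>\<zeta>. clause_message \<mu> b x \<zeta> = (if \<zeta> = (occ_sign x b = 1) then 1 else 1 - q)"
  shows "\<bar>normalized_product \<mu> (B - {b}) x True - normalized_product \<mu> B x True\<bar> \<le> q"
proof -
  define p where "p = (\<lambda>\<zeta>. \<Prod>b\<in>B - {b}. clause_message \<mu> b x \<zeta>)"
  have p0: "0 \<le> p \<zeta>" for \<zeta> using nonneg unfolding p_def by (intro prod_nonneg) auto
  have pB: "(\<Prod>b\<in>B. clause_message \<mu> b x \<zeta>) = clause_message \<mu> b x \<zeta> * p \<zeta>" for \<zeta>
    unfolding p_def using fin b by (simp add: prod.remove)
  have np: "normalized_product \<mu> (B - {b}) x True
      = (if p False + p True = 0 then 1/2 else p True / (p False + p True))"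
    by (simp add: normalized_product_def p_def Let_def)
  show ?thesis
  proof (cases "p False + p True = 0")
    case True
    \<comment> \<open>Both products vanish without \<open>b\<close>, hence also with
      \<open>b\<close>, and both sides take the default value 1/2.\<close>
    then have "p \<zeta> = 0" for \<zeta> using p0[of True] p0[of False] by (cases \<zeta>) auto
    then show ?thesis using np q by (simp add: normalized_product_def pB)
  next
    case False
    then have gt: "p True + p False > 0" "p False + p True > 0" using p0[of True] p0[of False] by auto
    have nz: "p \<zeta> * (1 - q) + p (\<not> \<zeta>) \<noteq> 0" for \<zeta>
    proof -
      have "p \<zeta> * (1 - q) \<ge> 0" using p0 q by simp
      then show ?thesis using q p0[of "\<not> \<zeta>"] gt by (cases \<zeta>) (auto simp: add_nonneg_eq_0_iff)
    qed
    show ?thesis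
    proof (cases "occ_sign x b = 1")
      case True
      have "normalized_product \<mu> B x True = p True / (p False * (1 - q) + p True)"
        using nz[of False] True by (simp add: normalized_product_def pB msg mult.commute)
      \<comment> \<open>The factor \<open>1 - q\<close> acts on the product for \<open>False\<close>
        here, so the comparison is made for the complementary probability.\<close>
      also have "\<dots> = 1 - p False * (1 - q) / (p False * (1 - q) + p True)"
        using nz[of False] by (simp add: field_simps)
      finally have "normalized_product \<mu> B x True = 1 - p False * (1 - q) / (p False * (1 - q) + p True)" .
      moreover have "normalized_product \<mu> (B - {b}) x True = 1 - p False / (p False + p True)"
        using np False by (simp add: field_simps)
      ultimately show ?thesis
        using removed_factor_le[OF p0[of False] p0[of True] gt(2) q] by simp
    next
      case False': False
      have "normalized_product \<mu> B x True = p True * (1 - q) / (p True * (1 - q) + p False)"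
        using nz[of True] False' by (simp add: normalized_product_def pB msg mult.commute add.commute)
      moreover have "normalized_product \<mu> (B - {b}) x True = p True / (p True + p False)"
        using np False by (simp add: add.commute)
      ultimately show ?thesis
        using removed_factor_le[OF p0[of True] p0[of False] gt(1) q] by (simp add: abs_minus_commute)
    qed
  qed
qed

text \<open>The part of degree at least two in the expansion of the product.\<close>

definition excess :: "('a \<Rightarrow> real) \<Rightarrow> 'a set \<Rightarrow> real" where
  "excess u A = (\<Prod>y\<in>A. 1 + u y) - 1 - (\<Sum>y\<in>A. u y)"

text \<open>After expansion all monomials have coefficient 1, so \<open>z\<close> may be replaced by
  its majorant monomial by monomial. The same reason underlies \<open>abs_excess_le\<close>.\<close>

lemma abs_prod_one_plus_minus_one_le:
  fixes z u :: "'a \<Rightarrow> real"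
  assumes "finite A" "\<And>y. y \<in> A \<Longrightarrow> \<bar>z y\<bar> \<le> u y"
  shows "\<bar>(\<Prod>y\<in>A. 1 + z y) - 1\<bar> \<le> (\<Prod>y\<in>A. 1 + u y) - 1"
  using assms
proof (induction A rule: finite_induct)
  case (insert a A)
  let ?Z = "\<Prod>y\<in>A. 1 + z y" and ?W = "\<Prod>y\<in>A. 1 + u y"
  have IH: "\<bar>?Z - 1\<bar> \<le> ?W - 1" using insert by auto
  have "\<bar>(1 + z a) * ?Z - 1\<bar> = \<bar>(?Z - 1) + z a * ?Z\<bar>" by (simp add: algebra_simps)
  also have "\<dots> \<le> \<bar>?Z - 1\<bar> + \<bar>z a\<bar> * \<bar>?Z\<bar>" by (metis abs_mult abs_triangle_ineq)
  also have "\<dots> \<le> (?W - 1) + u a * ?W"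
    using IH insert.prems[of a] by (intro add_mono mult_mono) auto
  finally show ?case using insert by (simp add: algebra_simps)
qed simp

lemma abs_excess_le:
  fixes z u :: "'a \<Rightarrow> real"
  assumes "finite A" "\<And>y. y \<in> A \<Longrightarrow> \<bar>z y\<bar> \<le> u y"
  shows "\<bar>excess z A\<bar> \<le> excess u A"
  using assms
proof (induction A rule: finite_induct)
  case (insert a A)
  let ?Z = "\<Prod>y\<in>A. 1 + z y" and ?W = "\<Prod>y\<in>A. 1 + u y"
  have IH: "\<bar>excess z A\<bar> \<le> excess u A" using insert by auto
  have 1: "\<bar>?Z - 1\<bar> \<le> ?W - 1" using insert by (intro abs_prod_one_plus_minus_one_le) auto
  have "excess z (insert a A) = excess z A + z a * (?Z - 1)"
    using insert by (simp add: excess_def algebra_simps)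
  also have "\<bar>\<dots>\<bar> \<le> \<bar>excess z A\<bar> + \<bar>z a\<bar> * \<bar>?Z - 1\<bar>" by (metis abs_mult abs_triangle_ineq)
  also have "\<dots> \<le> excess u A + u a * (?W - 1)"
    using IH 1 insert.prems[of a] by (intro add_mono mult_mono) auto
  also have "\<dots> = excess u (insert a A)"
    using insert by (simp add: excess_def algebra_simps)
  finally show ?case .
qed (simp add: excess_def)

lemma excess_nonneg: "finite A \<Longrightarrow> (\<And>y. y \<in> A \<Longrightarrow> 0 \<le> u y) \<Longrightarrow> 0 \<le> excess u A"
  using abs_excess_le[of A u u] by (smt (verit) abs_ge_zero abs_of_nonneg)

text \<open>Trims a family of clauses that is too long in total to one just above the threshold;
  expansion is available only for families of bounded total length.\<close>

lemma sum_ge_subset_sum_between: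
  fixes f :: "'a \<Rightarrow> real"
  assumes "finite D" "\<And>b. b \<in> D \<Longrightarrow> f b \<le> K" "sum f D > A" "A \<ge> 0"
  shows "\<exists>D'\<subseteq>D. A < sum f D' \<and> sum f D' \<le> A + K"
  using assms
proof (induction D rule: finite_induct)
  case (insert b D)
  show ?case
  proof (cases "sum f D > A")
    case True
    then show ?thesis using insert by (metis insert_iff subset_insertI2)
  next
    case False
    then have "sum f (insert b D) \<le> A + K" using insert.hyps insert.prems(1)[of b] by simp
    then show ?thesis using insert.prems by blast
  qed
qed simp

text \<open>Up to a constant factor, a bound in absolute value for the constant and linear terms of
  all clauses at \<open>x\<close>.\<close>

definition occ_weight :: "cnf \<Rightarrow> nat \<Rightarrow> real" where
  "occ_weight G x = (\<Sum>b\<in>var_clauses G x. (1 + 2 * real (length b)) / 2 ^ length b)"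

definition signed_weight :: "cnf \<Rightarrow> nat \<Rightarrow> real" where
  "signed_weight G x = (\<Sum>b\<in>var_clauses G x. of_int (occ_sign x b) / 2 ^ length b)"

text \<open>The linear term of the expansion, with edge messages already replaced by
  \<Gamma>.\<close>

definition pair_weight :: "cnf \<Rightarrow> (nat \<Rightarrow> real) \<Rightarrow> nat \<Rightarrow> real" where
  "pair_weight G \<Gamma> x = (\<Sum>b\<in>var_clauses G x. \<Sum>y\<in>clause_vars b - {x}.
     of_int (occ_sign x b) * of_int (occ_sign y b) * \<Gamma> y / 2 ^ length b)"

text \<open>Here \<open>of_bool (y \<in> T) + 2 * \<delta>\<close> majorizes twice the bias of a
  message from \<open>y\<close>: at most 1 for variables in \<open>T\<close>, at most 2 \<delta> for
  the others. The length condition will express that the clause does not drive.\<close>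

definition excess_weight :: "cnf \<Rightarrow> real \<Rightarrow> nat set \<Rightarrow> nat \<Rightarrow> real" where
  "excess_weight G \<delta> T x = (\<Sum>b\<in>var_clauses G x.
     if 2 * card (clause_vars b \<inter> T) < length b
     then excess (\<lambda>y. of_bool (y \<in> T) + 2 * \<delta>) (clause_vars b - {x}) / 2 ^ length b else 0)"

text \<open>Everything that the deterministic part needs to know about the formula. \<open>G\<close>
  holds the well-behaved clauses, and \<open>J\<close> covers the variables of all others;
  \<open>N\<close> serves only as a scale. \<open>few_pair\<close> and \<open>few_excess\<close> are
  uniform in \<Gamma> and \<open>T\<close> because these change from round to round and depend on
  the formula.\<close>

locale quasirandom =
  fixes \<Psi> G :: cnf and U J :: "nat set" and \<delta> N :: real
  assumes fin: "finite \<Psi>" "finite U"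
    and G_sub: "G \<subseteq> \<Psi>" and vars: "\<And>b. b \<in> \<Psi> \<Longrightarrow> clause_vars b \<subseteq> U"
    and delta: "0 < \<delta>" "\<delta> \<le> 1 / 1000"
    and tidy: "\<And>b. b \<in> G \<Longrightarrow> distinct (map fst b)"
    and long: "\<And>b j. b \<in> G \<Longrightarrow> length b \<le> Suc (2 * j) \<Longrightarrow> (3 / 5) ^ j \<le> \<delta> ^ 8"
    and light: "\<And>b. b \<in> G \<Longrightarrow> (1 + 2 * real (length b)) / 2 ^ length b \<le> \<delta> ^ 8"
    and not_too_long: "\<And>b. b \<in> G \<Longrightarrow> real (length b) \<le> \<delta> * N / 10"
    and N_nonneg: "0 \<le> N"
    and junk_vars: "\<And>b. b \<in> \<Psi> - G \<Longrightarrow> clause_vars b \<subseteq> J"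
    and junk: "J \<subseteq> U" "real (card J) \<le> \<delta> * N / 100"
    and expansion: "\<And>D. D \<subseteq> G \<Longrightarrow> (\<Sum>b\<in>D. real (length b)) \<le> 2 * \<delta> * N \<Longrightarrow>
      49 / 50 * (\<Sum>b\<in>D. real (length b)) \<le> real (card (\<Union> (clause_vars ` D))) + \<delta> * N / 1000"
    and few_heavy: "real (card {x \<in> U. occ_weight G x > 1 / \<delta> ^ 3}) \<le> \<delta> * N / 500"
    and few_signed: "real (card {x \<in> U - J. \<bar>signed_weight G x\<bar> > \<delta> / 100}) \<le> \<delta> * N / 500"
    and few_pair: "\<And>\<Gamma>. (\<And>y. \<bar>\<Gamma> y\<bar> \<le> 1 / 2) \<Longrightarrow>
      real (card {x \<in> U - J. \<bar>pair_weight G \<Gamma> x\<bar> > \<delta> / 100}) \<le> \<delta> * N / 500"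
    and few_excess: "\<And>T. T \<subseteq> U \<Longrightarrow> real (card T) \<le> \<delta> * N \<Longrightarrow>
      real (card {x \<in> U - J. excess_weight G \<delta> T x > \<delta> / 100}) \<le> \<delta> * N / 500"

section \<open>The invariant of the iteration\<close>

definition valid_messages :: "messages \<Rightarrow> bool" where
  "valid_messages \<mu> \<longleftrightarrow> (\<forall>y b \<zeta>. 0 \<le> \<mu> y b \<zeta>) \<and> (\<forall>y b. \<mu> y b True + \<mu> y b False = 1)"

lemma valid_messages_le_1: "valid_messages \<mu> \<Longrightarrow> \<mu> y b \<zeta> \<le> 1"
  by (cases \<zeta>) (smt (verit) valid_messages_def)+

lemma finite_clause_vars [simp]: "finite (clause_vars b)"
  by (simp add: clause_vars_def)

lemma card_clause_vars: "distinct (map fst b) \<Longrightarrow> card (clause_vars b) = length b"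
  using distinct_card[of "map fst b"] by (simp add: clause_vars_def)

lemma clause_message_nonneg:
  assumes "valid_messages \<mu>"
  shows "0 \<le> clause_message \<mu> b x \<zeta>"
proof -
  have "(\<Prod>y\<in>clause_vars b - {x}. \<mu> y b (occ_sign y b = -1)) \<le> (\<Prod>y\<in>clause_vars b - {x}. 1)"
    using assms valid_messages_le_1[OF assms]
    by (intro prod_mono) (auto simp: valid_messages_def)
  then show ?thesis by (simp add: clause_message_def)
qed

lemma valid_messages_BP: "valid_messages \<mu> \<Longrightarrow> valid_messages (BP \<Psi> \<mu>)"
  unfolding valid_messages_def[of "BP \<Psi> \<mu>"]
  by (subst (1 2 3) BP_def) (intro conjI allI normalized_product_range clause_message_nonneg)

text \<open>The clauses \<open>b'\<close> range over \<open>P - {b}\<close> rather than \<open>P\<close>: the message from \<open>y\<close> to \<open>b\<close>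
  ignores \<open>b\<close>, so a driving clause cannot keep itself alive.\<close>

definition tame :: "messages \<Rightarrow> cnf \<Rightarrow> real \<Rightarrow> nat set \<Rightarrow> cnf \<Rightarrow> (nat \<Rightarrow> real) \<Rightarrow> bool" where
  "tame \<mu> G \<delta> E P \<Gamma> \<longleftrightarrow> valid_messages \<mu> \<and> (\<forall>y. \<bar>\<Gamma> y\<bar> \<le> 1 / 2) \<and>
     (\<forall>b\<in>G. \<forall>y\<in>clause_vars b. y \<notin> E \<longrightarrow> (\<forall>b'\<in>P - {b}. y \<notin> clause_vars b') \<longrightarrow>
        \<bar>\<mu> y b True - 1 / 2\<bar> \<le> \<delta>) \<and>
     (\<forall>b\<in>G - P. \<forall>y\<in>clause_vars b. \<bar>\<mu> y b True - 1 / 2 - \<Gamma> y\<bar> \<le> \<delta> ^ 8)"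

definition forced_vars :: "nat set \<Rightarrow> cnf \<Rightarrow> clause \<Rightarrow> nat set" where
  "forced_vars E P b = {y \<in> clause_vars b. y \<in> E \<or> (\<exists>b'\<in>P - {b}. y \<in> clause_vars b')}"

definition driving :: "cnf \<Rightarrow> nat set \<Rightarrow> cnf \<Rightarrow> cnf" where
  "driving G E P = {b \<in> G. length b \<le> 2 * card (forced_vars E P b)}"

definition falsifying :: "messages \<Rightarrow> clause \<Rightarrow> nat \<Rightarrow> real" where
  "falsifying \<mu> b x = (\<Prod>y\<in>clause_vars b - {x}. \<mu> y b (occ_sign y b = -1))"

lemma clause_message_falsifying:
  "clause_message \<mu> b x \<zeta> = (if \<zeta> = (occ_sign x b = 1) then 1 else 1 - falsifying \<mu> b x)"
  by (simp add: clause_message_def falsifying_def)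

lemma falsifying_nonneg: "valid_messages \<mu> \<Longrightarrow> 0 \<le> falsifying \<mu> b x"
  unfolding falsifying_def by (intro prod_nonneg) (auto simp: valid_messages_def)

lemma abs_occ_sign: "\<bar>real_of_int (occ_sign x b)\<bar> = 1"
  by (simp add: occ_sign_def)

lemma abs_sum_mult_card_le:
  fixes f :: "'a \<Rightarrow> real"
  assumes "\<And>b. b \<in> A \<Longrightarrow> \<bar>f b\<bar> \<le> e" "real (card A) \<le> K" "0 \<le> e"
  shows "\<bar>sum f A\<bar> \<le> K * e"
proof -
  have "\<bar>sum f A\<bar> \<le> (\<Sum>b\<in>A. \<bar>f b\<bar>)" by (rule sum_abs)
  also have "\<dots> \<le> (\<Sum>b\<in>A. e)" using assms by (intro sum_mono) auto
  also have "\<dots> \<le> K * e" using assms by (simp add: mult_right_mono)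
  finally show ?thesis .
qed

context quasirandom
begin

lemma finite_G: "finite G" using fin G_sub finite_subset by blast

lemma delta_powers: "\<delta> ^ 8 \<le> 1 / 1000" "\<delta> ^ 5 \<le> \<delta> / 10 ^ 12"
proof -
  have "\<delta> ^ 8 \<le> (1 / 1000) ^ 8" using delta by (intro power_mono) auto
  also have "\<dots> \<le> 1 / 1000" by (simp add: power_divide)
  finally show "\<delta> ^ 8 \<le> 1 / 1000" .
  have "\<delta> ^ 4 \<le> (1 / 1000) ^ 4" using delta by (intro power_mono) auto
  also have "\<dots> = 1 / 10 ^ 12" by (simp add: power_divide)
  finally have "\<delta> * \<delta> ^ 4 \<le> \<delta> * (1 / 10 ^ 12)" using delta by (intro mult_left_mono) auto
  then show "\<delta> ^ 5 \<le> \<delta> / 10 ^ 12" by (simp add: numeral_eq_Suc)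
qed

text \<open>More than half of the variables of a clause that does not drive send messages with both
  values at most 3/5, and these factors alone make the product small.\<close>

lemma falsifying_le:
  assumes tame: "tame \<mu> G \<delta> E P \<Gamma>" and b: "b \<in> G" "b \<notin> driving G E P" and x: "x \<in> clause_vars b"
  shows "falsifying \<mu> b x \<le> \<delta> ^ 8"
proof -
  let ?V = "clause_vars b - {x}" and ?F = "forced_vars E P b"
  have val: "valid_messages \<mu>" using tame by (simp add: tame_def)
  have V: "card ?V = length b - 1" using x card_clause_vars[OF tidy[OF b(1)]] by simp
  have F: "2 * card ?F < length b" using b by (simp add: driving_def)
  have finF: "finite ?F" by (simp add: forced_vars_def)
  have half: "\<mu> y b \<zeta> \<le> 3 / 5" if "y \<in> ?V - ?F" for y \<zeta>
  proof -
    have "\<bar>\<mu> y b True - 1 / 2\<bar> \<le> \<delta>"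
      using tame that b unfolding tame_def forced_vars_def by auto
    moreover have "\<mu> y b True + \<mu> y b False = 1" using val by (simp add: valid_messages_def)
    ultimately show ?thesis using delta by (cases \<zeta>) auto
  qed
  have "falsifying \<mu> b x = (\<Prod>y\<in>?V - ?F. \<mu> y b (occ_sign y b = -1)) * (\<Prod>y\<in>?V \<inter> ?F. \<mu> y b (occ_sign y b = -1))"
    unfolding falsifying_def
    by (subst prod.union_disjoint[symmetric]) (auto intro!: prod.cong simp: finF)
  also have "\<dots> \<le> (\<Prod>y\<in>?V - ?F. 3 / 5) * (\<Prod>y\<in>?V \<inter> ?F. 1)"
    using half val valid_messages_le_1[OF val]
    by (intro mult_mono prod_mono prod_nonneg) (auto simp: valid_messages_def)
  also have "\<dots> = (3 / 5) ^ card (?V - ?F)" by simp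
  also have "\<dots> \<le> \<delta> ^ 8"
  proof (rule long[OF b(1)])
    \<comment> \<open>\<open>?V\<close> has L - 1 elements and \<open>?F\<close> at most (L - 1) /
      2, so L \<le> 2 j + 1 for the number j of remaining factors.\<close>
    have "card ?V - card ?F \<le> card (?V - ?F)" by (rule diff_card_le_card_Diff[OF finF])
    then show "length b \<le> Suc (2 * card (?V - ?F))" using V F by linarith
  qed
  finally show ?thesis .
qed

text \<open>Otherwise trim to \<open>D\<close> of total length between 0.5 and 0.6 times \<delta> N.
  Then \<open>P \<union> D\<close> has total length at most 1.1 \<delta> N and by expansion at most
  0.023 \<delta> N coincidences of variables. Half of the literals of \<open>D\<close> are charged
  to \<open>E\<close> or, with factor 2, to coincidences, which leaves at most 2 (1/20 + 2 * 0.023)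
  \<delta> N < \<delta> N / 2.\<close>

lemma driving_le:
  assumes E: "E \<subseteq> U" "real (card E) \<le> \<delta> * N / 20"
    and P: "P \<subseteq> G" "(\<Sum>b\<in>P. real (length b)) \<le> \<delta> * N / 2"
  shows "(\<Sum>b\<in>driving G E P. real (length b)) \<le> \<delta> * N / 2"
proof (rule ccontr)
  let ?len = "\<lambda>b. real (length b)"
  assume "\<not> ?thesis"
  moreover have finD: "finite (driving G E P)" using finite_G by (simp add: driving_def)
  moreover have "?len b \<le> \<delta> * N / 10" if "b \<in> driving G E P" for b
    using that not_too_long by (simp add: driving_def)
  moreover have dN: "\<delta> * N / 2 \<ge> 0" using delta N_nonneg by simp
  ultimately obtain D where D: "D \<subseteq> driving G E P" "\<delta> * N / 2 < sum ?len D"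
      "sum ?len D \<le> \<delta> * N / 2 + \<delta> * N / 10"
    using sum_ge_subset_sum_between[of "driving G E P" ?len "\<delta> * N / 10" "\<delta> * N / 2"]
    by (metis not_le)
  define A where "A = P \<union> D"
  have AG: "A \<subseteq> G" using P D by (auto simp: A_def driving_def)
  then have finA: "finite A" using finite_G finite_subset by blast
  have finP: "finite P" and finD: "finite D" using finA by (auto simp: A_def)
  let ?V = "\<Union> (clause_vars ` A)"
  have finV: "finite ?V" using finA by simp
  define deg where "deg y = card {b \<in> A. y \<in> clause_vars b}" for y
  have deg1: "deg y \<ge> 1" if "y \<in> ?V" for y
  proof -
    have "finite {b \<in> A. y \<in> clause_vars b}" "{b \<in> A. y \<in> clause_vars b} \<noteq> {}"
      using that finA by auto
    then show ?thesis unfolding deg_def by (simp add: Suc_le_eq card_gt_0_iff)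
  qed
  have "sum ?len A \<le> sum ?len P + sum ?len D" unfolding A_def
    using finP finD by (simp add: sum_Un sum_nonneg)
  then have Ale: "sum ?len A \<le> 11 / 10 * (\<delta> * N)" using P(2) D(3) by (simp add: field_simps)
  then have "49 / 50 * sum ?len A \<le> real (card ?V) + \<delta> * N / 1000"
    using expansion[OF AG] dN by simp
  then have coll: "sum ?len A - card ?V \<le> 23 / 1000 * (\<delta> * N)" using Ale by (simp add: field_simps)
  have "sum ?len A = (\<Sum>b\<in>A. \<Sum>y\<in>clause_vars b. 1)"
    using AG by (intro sum.cong) (auto simp: card_clause_vars tidy)
  also have "\<dots> = (\<Sum>b\<in>A. \<Sum>y\<in>{y \<in> ?V. y \<in> clause_vars b}. 1)"
    by (intro sum.cong) auto
  also have "\<dots> = (\<Sum>y\<in>?V. real (deg y))"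
    by (subst sum.swap_restrict[OF finA finV]) (simp add: deg_def)
  finally have degsum: "sum ?len A = (\<Sum>y\<in>?V. real (deg y))" .
  let ?F = "forced_vars E P"
  have "(\<Sum>b\<in>D. ?len b) \<le> (\<Sum>b\<in>D. 2 * real (card (?F b)))"
    using D by (intro sum_mono) (auto simp: driving_def)
  also have "\<dots> = 2 * (\<Sum>b\<in>D. \<Sum>y\<in>{y \<in> ?V. y \<in> ?F b}. 1)"
  proof -
    have "{y \<in> ?V. y \<in> ?F b} = ?F b" if "b \<in> D" for b
      using that by (auto simp: forced_vars_def A_def)
    then show ?thesis by (simp add: sum_distrib_left)
  qed
  also have "(\<Sum>b\<in>D. \<Sum>y\<in>{y \<in> ?V. y \<in> ?F b}. 1) = (\<Sum>y\<in>?V. real (card {b \<in> D. y \<in> ?F b}))"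
    by (subst sum.swap_restrict[OF finD finV]) simp
  also have "\<dots> \<le> (\<Sum>y\<in>?V. of_bool (y \<in> E) + 2 * (real (deg y) - 1))"
  proof (intro sum_mono)
    fix y assume y: "y \<in> ?V"
    have le: "card {b \<in> D. y \<in> ?F b} \<le> deg y" unfolding deg_def
      using finA by (intro card_mono) (auto simp: forced_vars_def A_def)
    show "real (card {b \<in> D. y \<in> ?F b}) \<le> of_bool (y \<in> E) + 2 * (real (deg y) - 1)"
    proof (cases "y \<in> E \<or> {b \<in> D. y \<in> ?F b} = {}")
      case True
      then have "card {b \<in> D. y \<in> ?F b} = 0 \<or> y \<in> E" by (metis card.empty)
      then show ?thesis using le deg1[OF y] by (cases "y \<in> E") simp_all
    next
      case False
      \<comment> \<open>A forced variable outside \<open>E\<close> lies in two distinct clauses of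
        \<open>A\<close>, so deg y \<le> 2 (deg y - 1). A clause in both \<open>P\<close> and
        \<open>D\<close> counts once in \<open>A\<close>, and the exclusion of \<open>b\<close> in
        \<open>forced_vars\<close> is what makes the two clauses distinct.\<close>
      then obtain b b' where b: "b \<in> D" "b' \<in> P" "b' \<noteq> b" "y \<in> clause_vars b" "y \<in> clause_vars b'"
        by (auto simp: forced_vars_def)
      then have "card {b, b'} \<le> deg y" unfolding deg_def
        using finA by (intro card_mono) (auto simp: A_def)
      then have "deg y \<ge> 2" using b by simp
      then show ?thesis using le False by simp
    qed
  qed
  also have "\<dots> = real (card (?V \<inter> E)) + 2 * (sum ?len A - card ?V)"
    using finV by (simp add: sum.distrib sum_subtractf sum_distrib_left[symmetric] degsum Int_def
        sum.If_cases of_bool_def)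
  also have "real (card (?V \<inter> E)) \<le> real (card E)"
    using E fin finite_subset by (intro of_nat_mono card_mono) auto
  finally have "sum ?len D \<le> 2 * (real (card E) + 2 * (sum ?len A - card ?V))" by simp
  then show False using D(2) coll E(2) dN by (simp add: field_simps)
qed

text \<open>The previous \<open>E\<close> enters only through the set of the excess weight, so
  exceptional variables do not accumulate. The last set collects the variables with too many clauses
  in \<open>P\<close>, since the expansion is not applied to those clauses.\<close>

definition exceptional :: "nat set \<Rightarrow> cnf \<Rightarrow> (nat \<Rightarrow> real) \<Rightarrow> nat set" where
  "exceptional E P \<Gamma> = J \<union> {x \<in> U. occ_weight G x > 1 / \<delta> ^ 3}
     \<union> {x \<in> U - J. \<bar>signed_weight G x\<bar> > \<delta> / 100}
     \<union> {x \<in> U - J. \<bar>pair_weight G \<Gamma> x\<bar> > \<delta> / 100}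
     \<union> {x \<in> U - J. excess_weight G \<delta> (E \<union> \<Union> (clause_vars ` P)) x > \<delta> / 100}
     \<union> {x \<in> U. real (card (var_clauses P x)) > 1 / \<delta> ^ 3}"

lemma exceptional_subset: "exceptional E P \<Gamma> \<subseteq> U"
  using junk by (auto simp: exceptional_def)

text \<open>The six sets contribute at most 1/100, four times 1/500 and 1/2000 of \<delta> N. The
  set \<open>?T\<close> has at most (1/20 + 1/2) \<delta> N elements, within the range of
  \<open>few_excess\<close>.\<close>

lemma card_exceptional_le:
  assumes tame: "tame \<mu> G \<delta> E P \<Gamma>"
    and E: "E \<subseteq> U" "real (card E) \<le> \<delta> * N / 20"
    and P: "P \<subseteq> G" "(\<Sum>b\<in>P. real (length b)) \<le> \<delta> * N / 2"
  shows "real (card (exceptional E P \<Gamma>)) \<le> \<delta> * N / 20"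
proof -
  let ?T = "E \<union> \<Union> (clause_vars ` P)"
  let ?H = "{x \<in> U. real (card (var_clauses P x)) > 1 / \<delta> ^ 3}"
  have finP: "finite P" using P finite_G finite_subset by blast
  have dN: "0 \<le> \<delta> * N" using delta N_nonneg by simp
  have "card (\<Union> (clause_vars ` P)) \<le> (\<Sum>b\<in>P. card (clause_vars b))"
    by (rule card_UN_le[OF finP])
  also have "\<dots> = (\<Sum>b\<in>P. length b)"
    using P by (intro sum.cong) (auto simp: card_clause_vars tidy)
  finally have "real (card (\<Union> (clause_vars ` P))) \<le> (\<Sum>b\<in>P. real (length b))"
    by (metis of_nat_le_iff of_nat_sum)
  then have "real (card ?T) \<le> \<delta> * N"
    using E P dN card_Un_le[of E "\<Union> (clause_vars ` P)"] by linarith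
  moreover have "?T \<subseteq> U" using E P G_sub vars by blast
  ultimately have 1: "real (card {x \<in> U - J. excess_weight G \<delta> ?T x > \<delta> / 100}) \<le> \<delta> * N / 500"
    by (rule few_excess[rotated])
  have 2: "real (card {x \<in> U - J. \<bar>pair_weight G \<Gamma> x\<bar> > \<delta> / 100}) \<le> \<delta> * N / 500"
    using tame by (intro few_pair) (auto simp: tame_def)
  have "real (card ?H) * (1 / \<delta> ^ 3) = (\<Sum>x\<in>?H. 1 / \<delta> ^ 3)" by simp
  also have "\<dots> \<le> (\<Sum>x\<in>?H. real (card (var_clauses P x)))" by (intro sum_mono) auto
  also have "\<dots> \<le> (\<Sum>x\<in>U. real (card (var_clauses P x)))" using fin by (intro sum_mono2) auto
  also have "\<dots> = (\<Sum>x\<in>U. \<Sum>b\<in>{b \<in> P. x \<in> clause_vars b}. 1)" by (simp add: var_clauses_def)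
  also have "\<dots> = (\<Sum>b\<in>P. \<Sum>x\<in>{x \<in> U. x \<in> clause_vars b}. 1)"
    by (rule sum.swap_restrict[OF fin(2) finP])
  also have "\<dots> = (\<Sum>b\<in>P. real (length b))"
  proof (intro sum.cong refl)
    fix b assume "b \<in> P"
    then have b: "b \<in> G" using P by auto
    then have "{x \<in> U. x \<in> clause_vars b} = clause_vars b" using vars G_sub by auto
    then show "(\<Sum>x\<in>{x \<in> U. x \<in> clause_vars b}. 1) = real (length b)"
      using b by (simp add: card_clause_vars tidy)
  qed
  also note P(2)
  finally have "real (card ?H) * (1 / \<delta> ^ 3) \<le> \<delta> * N / 2" .
  then have "real (card ?H) \<le> (\<delta> * N / 2) * \<delta> ^ 3" using delta by (simp add: field_simps)
  also have "\<dots> \<le> (\<delta> * N / 2) * (1 / 1000)"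
  proof (rule mult_left_mono)
    have "\<delta> ^ 3 \<le> (1 / 1000) ^ 3" using delta by (intro power_mono) auto
    also have "\<dots> \<le> 1 / 1000" by (simp add: power_divide)
    finally show "\<delta> ^ 3 \<le> 1 / 1000" .
  qed (use dN in simp)
  finally have 3: "real (card ?H) \<le> \<delta> * N / 2000" by simp
  have "card (exceptional E P \<Gamma>) \<le> card J + card {x \<in> U. occ_weight G x > 1 / \<delta> ^ 3}
     + card {x \<in> U - J. \<bar>signed_weight G x\<bar> > \<delta> / 100}
     + card {x \<in> U - J. \<bar>pair_weight G \<Gamma> x\<bar> > \<delta> / 100}
     + card {x \<in> U - J. excess_weight G \<delta> ?T x > \<delta> / 100} + card ?H"
    unfolding exceptional_def by (intro card_Un_le[THEN order_trans] add_mono order_refl)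
  then have "real (card (exceptional E P \<Gamma>)) \<le> real (card J) + real (card {x \<in> U. occ_weight G x > 1 / \<delta> ^ 3})
     + real (card {x \<in> U - J. \<bar>signed_weight G x\<bar> > \<delta> / 100})
     + real (card {x \<in> U - J. \<bar>pair_weight G \<Gamma> x\<bar> > \<delta> / 100})
     + real (card {x \<in> U - J. excess_weight G \<delta> ?T x > \<delta> / 100}) + real (card ?H)"
    by linarith
  then show ?thesis using 1 2 3 junk(2) few_heavy few_signed dN by linarith
qed

end

section \<open>One round of belief propagation and its iteration\<close>

context quasirandom
begin

text \<open>Clauses outside \<open>P\<close> are expanded into a constant part \<open>S1\<close>, a
  part \<open>S2\<close> linear in \<Gamma>, the error \<open>S3\<close> of replacing messages by
  \<Gamma>, and the excess \<open>S4\<close>. Clauses in \<open>P\<close> form \<open>S5\<close>;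
  they are few at \<open>x\<close>, and each has influence at most \<delta>^8 because it no longer
  drives. \<open>B\<close> may lack one clause, which covers edge messages as well as
  marginals.\<close>

lemma normalized_product_unbiased:
  assumes tame: "tame \<mu> G \<delta> E P \<Gamma>" and P: "P \<subseteq> G"
    and x: "x \<in> U" "x \<notin> exceptional E P \<Gamma>"
    and B: "B \<subseteq> var_clauses \<Psi> x" "card (var_clauses \<Psi> x - B) \<le> 1"
    and nodrive: "B \<inter> driving G E P = {}"
  shows "\<bar>normalized_product \<mu> B x True - 1 / 2\<bar> \<le> \<delta>"
proof -
  let ?T = "E \<union> \<Union> (clause_vars ` P)"
  let ?q = "\<lambda>b. falsifying \<mu> b x"
  let ?s = "\<lambda>y b. real_of_int (occ_sign y b)"
  let ?A = "\<lambda>b. clause_vars b - {x}"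
  let ?m = "\<lambda>b. (2::real) ^ length b"
  let ?u = "\<lambda>y. of_bool (y \<in> ?T) + 2 * \<delta>"
  define V where "V = var_clauses G x"
  have xJ: "x \<notin> J" using x by (simp add: exceptional_def)
  then have V: "var_clauses \<Psi> x = V" unfolding V_def
    using G_sub junk_vars by (auto simp: var_clauses_def)
  have finV: "finite V" using finite_G by (simp add: V_def var_clauses_def)
  have VG: "b \<in> G" "x \<in> clause_vars b" if "b \<in> V" for b
    using that by (auto simp: V_def var_clauses_def)
  have BV: "B \<subseteq> V" using B V by simp
  then have finB: "finite B" using finV finite_subset by blast
  have val: "valid_messages \<mu>" using tame by (simp add: tame_def)
  have d0: "0 < \<delta>" and d8: "\<delta> ^ 8 \<le> 1 / 1000" and d5: "\<delta> ^ 5 \<le> \<delta> / 10 ^ 12"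
    using delta delta_powers by auto
  have d35: "1 / \<delta> ^ 3 * \<delta> ^ 8 = \<delta> ^ 5" using d0 by (simp add: power_eq_if)
  have q0: "0 \<le> ?q b" for b by (rule falsifying_nonneg[OF val])
  have q8: "?q b \<le> \<delta> ^ 8" if "b \<in> B" for b
    using that BV VG nodrive by (intro falsifying_le[OF tame]) auto
  have occ: "occ_weight G x \<le> 1 / \<delta> ^ 3" and sig: "\<bar>signed_weight G x\<bar> \<le> \<delta> / 100"
    and pair: "\<bar>pair_weight G \<Gamma> x\<bar> \<le> \<delta> / 100" and exc: "excess_weight G \<delta> ?T x \<le> \<delta> / 100"
    and deg: "real (card (var_clauses P x)) \<le> 1 / \<delta> ^ 3"
    using x by (auto simp: exceptional_def)
  define R where "R = B - P"
  have RV: "R \<subseteq> V" using BV by (auto simp: R_def)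
  have finR: "finite R" using RV finV finite_subset by blast
  have VP: "V \<inter> P = var_clauses P x" using P by (auto simp: V_def var_clauses_def)
  have cBP: "real (card (B \<inter> P)) \<le> 1 / \<delta> ^ 3"
  proof -
    have "card (B \<inter> P) \<le> card (V \<inter> P)" using BV finV by (intro card_mono) auto
    then show ?thesis using deg VP by simp
  qed
  have cVR: "real (card (V - R)) \<le> 1 / \<delta> ^ 3 + 1"
  proof -
    have "V - R \<subseteq> (V \<inter> P) \<union> (V - B)" by (auto simp: R_def)
    then have "card (V - R) \<le> card ((V \<inter> P) \<union> (V - B))" using finV by (intro card_mono) auto
    also have "\<dots> \<le> card (V \<inter> P) + card (V - B)" by (rule card_Un_le)
    finally show ?thesis using deg VP B V by simp
  qed
  have light': "(1 + 2 * real (length b)) / ?m b \<le> \<delta> ^ 8" if "b \<in> V" for b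
    using that VG light by auto
  have cA: "real (card (?A b)) \<le> real (length b)" if "b \<in> V" for b
    using card_mono[of "clause_vars b" "?A b"] card_clause_vars[OF tidy[OF VG(1)[OF that]]] by simp
  define z where "z b y = - 2 * ?s y b * (\<mu> y b True - 1 / 2)" for b y
  have mu_z: "\<mu> y b (occ_sign y b = -1) = (1 + z b y) / 2" for y b
  proof -
    have "\<mu> y b True + \<mu> y b False = 1" using val by (simp add: valid_messages_def)
    then show ?thesis by (auto simp: z_def occ_sign_def field_simps)
  qed
  have half: "\<bar>\<mu> y b True - 1 / 2\<bar> \<le> 1 / 2" for y b
  proof -
    have "0 \<le> \<mu> y b True" using val by (simp add: valid_messages_def)
    then show ?thesis using valid_messages_le_1[OF val, of y b True] by arith
  qed
  have zu: "\<bar>z b y\<bar> \<le> ?u y" if "b \<in> R" "y \<in> ?A b" for b y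
  proof (cases "y \<in> ?T")
    case True
    then show ?thesis using half[of y b] d0 by (simp add: z_def abs_mult abs_occ_sign)
  next
    case False
    then have "\<bar>\<mu> y b True - 1 / 2\<bar> \<le> \<delta>"
    proof -
      have "b \<in> G" "y \<in> clause_vars b" "y \<notin> E" "\<forall>b'\<in>P - {b}. y \<notin> clause_vars b'"
        using that RV VG False by auto
      then show ?thesis using tame unfolding tame_def by simp
    qed
    then show ?thesis using False by (simp add: z_def abs_mult abs_occ_sign)
  qed
  have q_eq: "?q b = 2 / ?m b * (1 + (\<Sum>y\<in>?A b. z b y) + excess (z b) (?A b))" if "b \<in> V" for b
  proof -
    have l: "length b = Suc (card (?A b))"
      using VG[OF that] card_clause_vars[OF tidy[OF VG(1)[OF that]]] card_Suc_Diff1[of "clause_vars b" x]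
      by simp
    have "?q b = (\<Prod>y\<in>?A b. (1 + z b y) / 2)" by (simp add: falsifying_def mu_z)
    also have "\<dots> = (\<Prod>y\<in>?A b. 1 + z b y) / 2 ^ card (?A b)" by (simp add: prod_dividef)
    finally show ?thesis using l by (simp add: excess_def)
  qed
  have ex: "\<bar>excess (z b) (?A b)\<bar> \<le> excess ?u (?A b)" if "b \<in> R" for b
    using that zu by (intro abs_excess_le) auto
  have Rex: "(\<Sum>b\<in>R. excess ?u (?A b) / ?m b) \<le> \<delta> / 100"
  proof -
    \<comment> \<open>For \<open>b\<close> outside \<open>P\<close> the exclusion of
      \<open>b\<close> in \<open>forced_vars\<close> is void, so not driving is exactly the length
      condition in \<open>excess_weight\<close>.\<close>
    have small: "2 * card (clause_vars b \<inter> ?T) < length b" if "b \<in> R" for b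
    proof -
      have "forced_vars E P b = clause_vars b \<inter> ?T"
        using that by (auto simp: forced_vars_def R_def)
      moreover have "b \<in> G - driving G E P" using that nodrive VG RV by (auto simp: R_def)
      ultimately show ?thesis unfolding driving_def by auto
    qed
    have "(\<Sum>b\<in>R. excess ?u (?A b) / ?m b) = (\<Sum>b\<in>R. if 2 * card (clause_vars b \<inter> ?T) < length b
        then excess ?u (?A b) / ?m b else 0)"
      using small by (intro sum.cong) auto
    also have "\<dots> \<le> (\<Sum>b\<in>V. if 2 * card (clause_vars b \<inter> ?T) < length b
        then excess ?u (?A b) / ?m b else 0)"
      using RV finV d0 by (intro sum_mono2) (auto intro!: divide_nonneg_pos excess_nonneg)
    also have "\<dots> = excess_weight G \<delta> ?T x" by (simp add: excess_weight_def V_def)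
    finally show ?thesis using exc by simp
  qed
  define S1 where "S1 = (\<Sum>b\<in>R. ?s x b / ?m b)"
  define S2 where "S2 = (\<Sum>b\<in>R. \<Sum>y\<in>?A b. ?s x b * ?s y b * \<Gamma> y / ?m b)"
  define S3 where "S3 = (\<Sum>b\<in>R. \<Sum>y\<in>?A b. ?s x b * ?s y b * (\<mu> y b True - 1 / 2 - \<Gamma> y) / ?m b)"
  define S4 where "S4 = (\<Sum>b\<in>R. ?s x b * excess (z b) (?A b) / ?m b)"
  define S5 where "S5 = (\<Sum>b\<in>B \<inter> P. ?s x b * ?q b)"
  \<comment> \<open>With \<open>z\<close> = - 2 s (\<mu> - 1/2) and the prefactor
    \<open>2 / ?m b\<close>, the linear terms acquire the factor - 4.\<close>
  have expand: "(\<Sum>b\<in>B. ?s x b * ?q b) = 2 * S1 - 4 * S2 - 4 * S3 + 2 * S4 + S5"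
  proof -
    have "(\<Sum>b\<in>B. ?s x b * ?q b) = (\<Sum>b\<in>R. ?s x b * ?q b) + S5"
      unfolding S5_def R_def using finB by (subst sum.Int_Diff[of B _ P]) auto
    also have "(\<Sum>b\<in>R. ?s x b * ?q b) = (\<Sum>b\<in>R. 2 * (?s x b / ?m b)
       - 4 * (\<Sum>y\<in>?A b. ?s x b * ?s y b * \<Gamma> y / ?m b)
       - 4 * (\<Sum>y\<in>?A b. ?s x b * ?s y b * (\<mu> y b True - 1 / 2 - \<Gamma> y) / ?m b)
       + 2 * (?s x b * excess (z b) (?A b) / ?m b))"
    proof (intro sum.cong refl)
      fix b assume "b \<in> R"
      then have bV: "b \<in> V" using RV by auto
      have "?s x b * (\<Sum>y\<in>?A b. z b y) * 2 / ?m b = (\<Sum>y\<in>?A b. - 4 * (?s x b * ?s y b * \<Gamma> y / ?m b)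
           - 4 * (?s x b * ?s y b * (\<mu> y b True - 1 / 2 - \<Gamma> y) / ?m b))"
        unfolding sum_distrib_left sum_distrib_right sum_divide_distrib
        by (intro sum.cong refl) (simp add: z_def field_simps)
      also have "\<dots> = - 4 * (\<Sum>y\<in>?A b. ?s x b * ?s y b * \<Gamma> y / ?m b)
       - 4 * (\<Sum>y\<in>?A b. ?s x b * ?s y b * (\<mu> y b True - 1 / 2 - \<Gamma> y) / ?m b)"
        by (simp only: sum_subtractf sum_distrib_left)
      finally show "?s x b * ?q b = 2 * (?s x b / ?m b)
       - 4 * (\<Sum>y\<in>?A b. ?s x b * ?s y b * \<Gamma> y / ?m b)
       - 4 * (\<Sum>y\<in>?A b. ?s x b * ?s y b * (\<mu> y b True - 1 / 2 - \<Gamma> y) / ?m b)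
       + 2 * (?s x b * excess (z b) (?A b) / ?m b)"
        unfolding q_eq[OF bV] by (simp add: field_simps)
    qed
    also have "\<dots> = 2 * S1 - 4 * S2 - 4 * S3 + 2 * S4"
      unfolding S1_def S2_def S3_def S4_def
      by (simp only: sum.distrib sum_subtractf sum_distrib_left)
    finally show ?thesis .
  qed
  have S5: "\<bar>S5\<bar> \<le> \<delta> ^ 5"
    unfolding S5_def d35[symmetric]
    using q0 q8 cBP d0 by (intro abs_sum_mult_card_le) (auto simp: abs_mult abs_occ_sign)
  have S1: "\<bar>S1\<bar> \<le> \<delta> / 100 + 2 * \<delta> ^ 5"
  proof -
    \<comment> \<open>The signed weight runs over all of \<open>V\<close>; at most 1 / \<delta>^3 +
      1 clauses of weight at most \<delta>^8 are missing from \<open>R\<close>.\<close>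
    have "S1 = signed_weight G x - (\<Sum>b\<in>V - R. ?s x b / ?m b)"
      unfolding S1_def signed_weight_def V_def[symmetric] using RV finV by (simp add: sum_diff)
    moreover have "\<bar>\<Sum>b\<in>V - R. ?s x b / ?m b\<bar> \<le> (1 / \<delta> ^ 3 + 1) * \<delta> ^ 8"
    proof (rule abs_sum_mult_card_le[OF _ cVR])
      fix b assume "b \<in> V - R"
      have "1 / ?m b \<le> (1 + 2 * real (length b)) / ?m b" by (simp add: divide_right_mono)
      also have "\<dots> \<le> \<delta> ^ 8" using \<open>b \<in> V - R\<close> by (intro light') auto
      finally show "\<bar>?s x b / ?m b\<bar> \<le> \<delta> ^ 8" by (simp add: abs_occ_sign abs_divide)
    qed (use d0 in simp)
    moreover have "\<delta> ^ 8 \<le> \<delta> ^ 5" using d0 delta by (intro power_decreasing) auto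
    ultimately show ?thesis using sig d35 by (simp add: distrib_right)
  qed
  have S2: "\<bar>S2\<bar> \<le> \<delta> / 100 + 2 * \<delta> ^ 5"
  proof -
    have "S2 = pair_weight G \<Gamma> x - (\<Sum>b\<in>V - R. \<Sum>y\<in>?A b. ?s x b * ?s y b * \<Gamma> y / ?m b)"
      unfolding S2_def pair_weight_def V_def[symmetric] using RV finV by (simp add: sum_diff)
    moreover have "\<bar>\<Sum>b\<in>V - R. \<Sum>y\<in>?A b. ?s x b * ?s y b * \<Gamma> y / ?m b\<bar> \<le> (1 / \<delta> ^ 3 + 1) * \<delta> ^ 8"
    proof (rule abs_sum_mult_card_le[OF _ cVR])
      fix b assume b: "b \<in> V - R"
      have "\<bar>\<Sum>y\<in>?A b. ?s x b * ?s y b * \<Gamma> y / ?m b\<bar> \<le> real (length b) * (1 / ?m b)"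
      proof (rule abs_sum_mult_card_le)
        fix y
        have "\<bar>\<Gamma> y\<bar> \<le> 1 / 2" using tame by (simp add: tame_def)
        then have "\<bar>\<Gamma> y\<bar> \<le> 1" by simp
        then show "\<bar>?s x b * ?s y b * \<Gamma> y / ?m b\<bar> \<le> 1 / ?m b"
          by (simp add: abs_occ_sign abs_mult divide_right_mono)
      qed (use cA b in auto)
      also have "\<dots> \<le> (1 + 2 * real (length b)) / ?m b" by (simp add: divide_right_mono)
      also have "\<dots> \<le> \<delta> ^ 8" using b by (intro light') auto
      finally show "\<bar>\<Sum>y\<in>?A b. ?s x b * ?s y b * \<Gamma> y / ?m b\<bar> \<le> \<delta> ^ 8" .
    qed (use d0 in simp)
    moreover have "\<delta> ^ 8 \<le> \<delta> ^ 5" using d0 delta by (intro power_decreasing) auto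
    ultimately show ?thesis using pair d35 by (simp add: distrib_right)
  qed
  have occR: "(\<Sum>b\<in>R. (1 + 2 * real (length b)) / ?m b) \<le> 1 / \<delta> ^ 3"
  proof -
    have "(\<Sum>b\<in>R. (1 + 2 * real (length b)) / ?m b) \<le> (\<Sum>b\<in>V. (1 + 2 * real (length b)) / ?m b)"
      using RV finV by (intro sum_mono2) auto
    then show ?thesis using occ by (simp add: occ_weight_def V_def)
  qed
  have S3: "\<bar>S3\<bar> \<le> \<delta> ^ 5"
  proof -
    have "\<bar>S3\<bar> \<le> (\<Sum>b\<in>R. \<bar>\<Sum>y\<in>?A b. ?s x b * ?s y b * (\<mu> y b True - 1 / 2 - \<Gamma> y) / ?m b\<bar>)"
      unfolding S3_def by (rule sum_abs)
    also have "\<dots> \<le> (\<Sum>b\<in>R. \<delta> ^ 8 * ((1 + 2 * real (length b)) / ?m b))"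
    proof (rule sum_mono)
      fix b assume b: "b \<in> R"
      have "\<bar>\<Sum>y\<in>?A b. ?s x b * ?s y b * (\<mu> y b True - 1 / 2 - \<Gamma> y) / ?m b\<bar> \<le> real (length b) * (\<delta> ^ 8 / ?m b)"
      proof (rule abs_sum_mult_card_le)
        fix y assume "y \<in> ?A b"
        then have "\<bar>\<mu> y b True - 1 / 2 - \<Gamma> y\<bar> \<le> \<delta> ^ 8"
          using tame b RV VG unfolding tame_def R_def by auto
        then show "\<bar>?s x b * ?s y b * (\<mu> y b True - 1 / 2 - \<Gamma> y) / ?m b\<bar> \<le> \<delta> ^ 8 / ?m b"
          by (simp add: abs_occ_sign abs_mult divide_right_mono)
      qed (use cA b RV d0 in auto)
      also have "\<dots> \<le> (1 + 2 * real (length b)) * (\<delta> ^ 8 / ?m b)"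
        using d0 by (intro mult_right_mono) auto
      finally show "\<bar>\<Sum>y\<in>?A b. ?s x b * ?s y b * (\<mu> y b True - 1 / 2 - \<Gamma> y) / ?m b\<bar>
          \<le> \<delta> ^ 8 * ((1 + 2 * real (length b)) / ?m b)" by (simp add: mult.commute)
    qed
    also have "\<dots> = \<delta> ^ 8 * (\<Sum>b\<in>R. (1 + 2 * real (length b)) / ?m b)" by (simp add: sum_distrib_left)
    also have "\<dots> \<le> \<delta> ^ 8 * (1 / \<delta> ^ 3)" using occR d0 by (intro mult_left_mono) auto
    finally show ?thesis using d35 by (simp add: mult.commute)
  qed
  have S4: "\<bar>S4\<bar> \<le> \<delta> / 100"
  proof -
    have "\<bar>S4\<bar> \<le> (\<Sum>b\<in>R. \<bar>?s x b * excess (z b) (?A b) / ?m b\<bar>)" unfolding S4_def by (rule sum_abs)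
    also have "\<dots> \<le> (\<Sum>b\<in>R. excess ?u (?A b) / ?m b)"
      using ex by (intro sum_mono) (auto simp: abs_mult abs_occ_sign divide_right_mono)
    finally show ?thesis using Rex by simp
  qed
  have lin: "\<bar>\<Sum>b\<in>B. ?s x b * ?q b\<bar> \<le> 8 / 100 * \<delta> + 17 * \<delta> ^ 5"
    unfolding expand using S1 S2 S3 S4 S5 by linarith
  have sumR: "(\<Sum>b\<in>R. ?q b) \<le> 2 / \<delta> ^ 3 + 2 * (\<delta> / 100)"
  proof -
    have "(\<Sum>b\<in>R. ?q b) \<le> (\<Sum>b\<in>R. 2 * ((1 + 2 * real (length b)) / ?m b) + 2 * (excess ?u (?A b) / ?m b))"
    proof (rule sum_mono)
      fix b assume b: "b \<in> R"
      have "\<bar>\<Sum>y\<in>?A b. z b y\<bar> \<le> real (length b) * 1"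
      proof (rule abs_sum_mult_card_le)
        fix y show "\<bar>z b y\<bar> \<le> 1" using half[of y b] by (simp add: z_def abs_mult abs_occ_sign)
      qed (use cA b RV in auto)
      then have "1 + (\<Sum>y\<in>?A b. z b y) + excess (z b) (?A b) \<le> (1 + 2 * real (length b)) + excess ?u (?A b)"
        using ex[OF b] by linarith
      then have "?q b \<le> 2 / ?m b * ((1 + 2 * real (length b)) + excess ?u (?A b))"
        using q_eq[of b] b RV by (simp add: divide_right_mono subset_iff)
      then show "?q b \<le> 2 * ((1 + 2 * real (length b)) / ?m b) + 2 * (excess ?u (?A b) / ?m b)"
        by (simp add: add_divide_distrib distrib_left)
    qed
    also have "\<dots> = 2 * (\<Sum>b\<in>R. (1 + 2 * real (length b)) / ?m b) + 2 * (\<Sum>b\<in>R. excess ?u (?A b) / ?m b)"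
      by (simp only: sum.distrib sum_distrib_left)
    also have "\<dots> \<le> 2 * (1 / \<delta> ^ 3) + 2 * (\<delta> / 100)"
      using occR Rex by (intro add_mono mult_left_mono) auto
    finally show ?thesis by simp
  qed
  have sumB: "(\<Sum>b\<in>B. ?q b) \<le> 2 / \<delta> ^ 3 + 2 * (\<delta> / 100) + 1 / \<delta> ^ 3"
  proof -
    have "(\<Sum>b\<in>B. ?q b) = (\<Sum>b\<in>R. ?q b) + (\<Sum>b\<in>B \<inter> P. ?q b)"
      unfolding R_def using finB by (subst sum.Int_Diff[of B _ P]) auto
    moreover have "(\<Sum>b\<in>B \<inter> P. ?q b) \<le> (\<Sum>b\<in>B \<inter> P. 1)"
    proof (rule sum_mono)
      fix b assume "b \<in> B \<inter> P"
      then have "?q b \<le> \<delta> ^ 8" by (intro q8) simp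
      then show "?q b \<le> 1" using d8 by simp
    qed
    ultimately show ?thesis using sumR cBP by simp
  qed
  have sq: "(\<Sum>b\<in>B. (?q b)\<^sup>2) \<le> 4 * \<delta> ^ 5"
  proof -
    \<comment> \<open>One factor \<open>?q b\<close> is at most \<delta>^8, which beats the total
      influence of order 1 / \<delta>^3.\<close>
    have "(\<Sum>b\<in>B. (?q b)\<^sup>2) \<le> (\<Sum>b\<in>B. \<delta> ^ 8 * ?q b)"
      using q0 q8 by (intro sum_mono) (auto simp: power2_eq_square intro!: mult_right_mono)
    also have "\<dots> = \<delta> ^ 8 * (\<Sum>b\<in>B. ?q b)" by (simp add: sum_distrib_left)
    also have "\<dots> \<le> \<delta> ^ 8 * (2 / \<delta> ^ 3 + 2 * (\<delta> / 100) + 1 / \<delta> ^ 3)"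
      using sumB d0 by (intro mult_left_mono) auto
    also have "\<dots> = 3 * (1 / \<delta> ^ 3 * \<delta> ^ 8) + \<delta> ^ 8 * (2 * (\<delta> / 100))" by (simp add: field_simps)
    also have "\<dots> \<le> 3 * \<delta> ^ 5 + \<delta> ^ 8 * 1" unfolding d35 using d0 delta by (intro add_mono mult_left_mono) auto
    also have "\<delta> ^ 8 \<le> \<delta> ^ 5" using d0 delta by (intro power_decreasing) auto
    finally show ?thesis by simp
  qed
  have "\<bar>normalized_product \<mu> B x True - 1 / 2\<bar>
    \<le> \<bar>\<Sum>b\<in>B. ?s x b * ?q b\<bar> + 2 * (\<Sum>b\<in>B. (?q b)\<^sup>2)"
  proof (rule normalized_product_bias_le[OF finB _ clause_message_falsifying])
    fix b assume "b \<in> B"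
    then show "0 \<le> ?q b \<and> ?q b \<le> 1 / 2" using q0[of b] q8[of b] d8 by simp
  qed
  then show ?thesis using lin sq d5 d0 by simp
qed

text \<open>The new \<Gamma> is the bias of the full marginal. The message to \<open>b\<close> omits
  \<open>b\<close> from the product, so for its unbiasedness only the other clauses at
  \<open>y\<close> must not drive; for \<open>b\<close> that does not drive, the omission changes
  the marginal by at most \<delta>^8.\<close>

lemma tame_BP:
  assumes tame: "tame \<mu> G \<delta> E P \<Gamma>" and P: "P \<subseteq> G"
  shows "tame (BP \<Psi> \<mu>) G \<delta> (exceptional E P \<Gamma>) (driving G E P)
    (\<lambda>y. normalized_product \<mu> (var_clauses \<Psi> y) y True - 1 / 2)"
  unfolding tame_def
proof (intro conjI allI ballI impI)
  have val: "valid_messages \<mu>" using tame by (simp add: tame_def)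
  note nonneg = clause_message_nonneg[OF val]
  have fin_var: "finite (var_clauses \<Psi> y)" for y using fin by (simp add: var_clauses_def)
  show "valid_messages (BP \<Psi> \<mu>)" by (rule valid_messages_BP[OF val])
  show "\<bar>normalized_product \<mu> (var_clauses \<Psi> y) y True - 1 / 2\<bar> \<le> 1 / 2" for y
  proof -
    have "0 \<le> normalized_product \<mu> (var_clauses \<Psi> y) y \<zeta>" for \<zeta>
      by (intro normalized_product_range nonneg)
    moreover have "normalized_product \<mu> (var_clauses \<Psi> y) y True + normalized_product \<mu> (var_clauses \<Psi> y) y False = 1"
      by (intro normalized_product_range nonneg)
    ultimately show ?thesis by (smt (verit) field_sum_of_halves)
  qed
  {
    fix b y assume "b \<in> G" "y \<in> clause_vars b" "y \<notin> exceptional E P \<Gamma>"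
      and nd: "\<forall>b'\<in>driving G E P - {b}. y \<notin> clause_vars b'"
    show "\<bar>BP \<Psi> \<mu> y b True - 1 / 2\<bar> \<le> \<delta>"
      unfolding BP_def
    proof (rule normalized_product_unbiased[OF tame P])
      show "y \<in> U" using \<open>b \<in> G\<close> \<open>y \<in> clause_vars b\<close> vars G_sub by blast
      have "var_clauses \<Psi> y - (var_clauses \<Psi> y - {b}) \<subseteq> {b}" by auto
      then show "card (var_clauses \<Psi> y - (var_clauses \<Psi> y - {b})) \<le> 1"
        using card_mono[of "{b}"] by fastforce
      show "(var_clauses \<Psi> y - {b}) \<inter> driving G E P = {}" using nd by (auto simp: var_clauses_def)
    qed (use \<open>y \<notin> exceptional E P \<Gamma>\<close> in auto)
  }
  fix b y assume b: "b \<in> G - driving G E P" and y: "y \<in> clause_vars b"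
  have q: "falsifying \<mu> b y \<le> \<delta> ^ 8" using b y by (intro falsifying_le[OF tame]) auto
  have "\<bar>BP \<Psi> \<mu> y b True - normalized_product \<mu> (var_clauses \<Psi> y) y True\<bar> \<le> falsifying \<mu> b y"
    unfolding BP_def
    using b y G_sub q delta_powers(1)
    by (intro normalized_product_remove_le fin_var nonneg falsifying_nonneg[OF val] clause_message_falsifying)
      (auto simp: var_clauses_def)
  then show "\<bar>BP \<Psi> \<mu> y b True - 1 / 2 - (normalized_product \<mu> (var_clauses \<Psi> y) y True - 1 / 2)\<bar> \<le> \<delta> ^ 8"
    using q by simp
qed

lemma tame_BP_iterate:
  "\<exists>E P \<Gamma>. tame (BP_iterate \<Psi> w) G \<delta> E P \<Gamma> \<and> E \<subseteq> U \<and> real (card E) \<le> \<delta> * N / 20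
     \<and> P \<subseteq> G \<and> (\<Sum>b\<in>P. real (length b)) \<le> \<delta> * N / 2"
proof (induction w)
  case 0
  have "tame (BP_iterate \<Psi> 0) G \<delta> {} {} (\<lambda>_. 0)"
    using delta by (simp add: tame_def BP_iterate_def valid_messages_def)
  moreover have "0 \<le> \<delta> * N" using delta N_nonneg by simp
  ultimately show ?case by (intro exI[of _ "{}"] exI[of _ "\<lambda>_. 0"]) simp
next
  case (Suc w)
  then obtain E P \<Gamma> where *: "tame (BP_iterate \<Psi> w) G \<delta> E P \<Gamma>" "E \<subseteq> U"
    "real (card E) \<le> \<delta> * N / 20" "P \<subseteq> G" "(\<Sum>b\<in>P. real (length b)) \<le> \<delta> * N / 2" by blast
  have "BP_iterate \<Psi> (Suc w) = BP \<Psi> (BP_iterate \<Psi> w)" by (simp add: BP_iterate_def)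
  then have "tame (BP_iterate \<Psi> (Suc w)) G \<delta> (exceptional E P \<Gamma>) (driving G E P)
    (\<lambda>y. normalized_product (BP_iterate \<Psi> w) (var_clauses \<Psi> y) y True - 1 / 2)"
    using tame_BP[OF *(1,4)] by simp
  moreover have "driving G E P \<subseteq> G" by (auto simp: driving_def)
  ultimately show ?case
    using exceptional_subset card_exceptional_le[OF *] driving_le[OF *(2-)] by blast
qed

text \<open>A marginal uses all clauses at \<open>x\<close>, so a biased variable is exceptional or
  lies in a clause driving in the last round; 1/20 + 1/2 \<le> 1.\<close>

theorem few_biased_marginals:
  "real (card {x \<in> U. \<bar>BP_marginal \<Psi> w x - 1 / 2\<bar> > \<delta>}) \<le> \<delta> * N"
proof -
  obtain E P \<Gamma> where *: "tame (BP_iterate \<Psi> w) G \<delta> E P \<Gamma>" "E \<subseteq> U"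
    "real (card E) \<le> \<delta> * N / 20" "P \<subseteq> G" "(\<Sum>b\<in>P. real (length b)) \<le> \<delta> * N / 2"
    using tame_BP_iterate by blast
  let ?D = "driving G E P" and ?E = "exceptional E P \<Gamma>"
  have finD: "finite ?D" using finite_G by (simp add: driving_def)
  have "{x \<in> U. \<bar>BP_marginal \<Psi> w x - 1 / 2\<bar> > \<delta>} \<subseteq> ?E \<union> \<Union> (clause_vars ` ?D)"
  proof
    fix x assume x: "x \<in> {x \<in> U. \<bar>BP_marginal \<Psi> w x - 1 / 2\<bar> > \<delta>}"
    show "x \<in> ?E \<union> \<Union> (clause_vars ` ?D)"
    proof (rule ccontr)
      assume "\<not> ?thesis"
      then have "\<bar>BP_marginal \<Psi> w x - 1 / 2\<bar> \<le> \<delta>"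
        unfolding BP_marginal_def using x
        by (intro normalized_product_unbiased[OF *(1,4)]) (auto simp: var_clauses_def)
      then show False using x by simp
    qed
  qed
  then have "card {x \<in> U. \<bar>BP_marginal \<Psi> w x - 1 / 2\<bar> > \<delta>} \<le> card (?E \<union> \<Union> (clause_vars ` ?D))"
    using finD finite_subset[OF exceptional_subset fin(2)] by (intro card_mono) auto
  also have "\<dots> \<le> card ?E + card (\<Union> (clause_vars ` ?D))" by (rule card_Un_le)
  also have "card (\<Union> (clause_vars ` ?D)) \<le> (\<Sum>b\<in>?D. card (clause_vars b))"
    by (rule card_UN_le[OF finD])
  also have "\<dots> = (\<Sum>b\<in>?D. length b)"
    by (intro sum.cong) (auto simp: card_clause_vars tidy driving_def)
  finally have "real (card {x \<in> U. \<bar>BP_marginal \<Psi> w x - 1 / 2\<bar> > \<delta>})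
    \<le> real (card ?E) + (\<Sum>b\<in>?D. real (length b))"
    by (simp flip: of_nat_sum of_nat_add)
  also have "\<dots> \<le> \<delta> * N / 20 + \<delta> * N / 2"
    using card_exceptional_le[OF *] driving_le[OF *(2-)] by (intro add_mono)
  also have "\<dots> \<le> \<delta> * N" using delta N_nonneg by simp
  finally show ?thesis .
qed

end

section \<open>Residual clauses of a random formula\<close>

text \<open>The literals of a uniformly random clause are independent, because clauses are lists
  with repetitions.\<close>

lemma sum_prod_list_lists:
  fixes g :: "'a \<Rightarrow> real"
  assumes "finite L"
  shows "(\<Sum>C\<in>{C. length C = k \<and> set C \<subseteq> L}. prod_list (map g C)) = (\<Sum>l\<in>L. g l) ^ k"
proof (induction k)
  case 0
  have "{C. length C = 0 \<and> set C \<subseteq> L} = {[]}" by auto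
  then show ?case by simp
next
  case (Suc k)
  let ?A = "{C. length C = k \<and> set C \<subseteq> L}"
  have eq: "{C. length C = Suc k \<and> set C \<subseteq> L} = (\<lambda>(l, C). l # C) ` (L \<times> ?A)"
    by (auto simp: length_Suc_conv image_iff)
  have "(\<Sum>C\<in>{C. length C = Suc k \<and> set C \<subseteq> L}. prod_list (map g C))
      = (\<Sum>(l, C)\<in>L \<times> ?A. g l * prod_list (map g C))"
    unfolding eq by (subst sum.reindex) (auto simp: inj_on_def split_def)
  also have "\<dots> = (\<Sum>l\<in>L. g l) * (\<Sum>C\<in>?A. prod_list (map g C))"
    by (simp add: sum.cartesian_product[symmetric] sum_product)
  finally show ?case using Suc by simp
qed

lemma finite_clauses: "finite (clauses k n)"
  unfolding clauses_def using finite_lists_length_eq[of "{1..n} \<times> (UNIV :: bool set)" k]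
  by (simp add: conj_commute)

lemma card_clauses: "card (clauses k n) = (2 * n) ^ k"
  unfolding clauses_def using card_lists_length_eq[of "{1..n} \<times> (UNIV :: bool set)" k]
  by (simp add: conj_commute card_cartesian_product mult.commute)

lemma random_cnf_eq: "random_cnf k n m = random_subset (clauses k n) m"
  by (simp add: random_cnf_def random_subset_def)

lemma exp_le_one_plus_square:
  assumes "\<bar>x\<bar> \<le> (1::real)"
  shows "exp x \<le> 1 + x + x\<^sup>2"
proof (cases "x \<ge> 0")
  case True
  then show ?thesis using exp_bound[of x] assms by simp
next
  case False
  define y where "y = - x"
  have y: "y > 0" using False by (simp add: y_def)
  have "1 + y \<le> exp y" by (rule exp_ge_add_one_self)
  then have "exp x \<le> 1 / (1 + y)" using y by (simp add: y_def exp_minus field_simps)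
  also have "\<dots> \<le> 1 - y + y\<^sup>2"
  proof -
    have "1 \<le> (1 - y + y\<^sup>2) * (1 + y)" using y by (simp add: power2_eq_square algebra_simps)
    then show ?thesis using y by (simp add: pos_divide_le_eq)
  qed
  finally show ?thesis by (simp add: y_def)
qed

lemma exp_le_one_plus_double: "0 \<le> x \<Longrightarrow> x \<le> 1 \<Longrightarrow> exp x \<le> 1 + 2 * (x::real)"
  using exp_le_one_plus_square[of x] mult_left_le[of x x] by (simp add: power2_eq_square)

section \<open>Negating the occurrences of one variable\<close>

definition flip_literal :: "nat \<Rightarrow> literal \<Rightarrow> literal" where
  "flip_literal x l = (if fst l = x then (x, \<not> snd l) else l)"

text \<open>An involution on the clauses of length \<open>k\<close>; it is the symmetry that gives
  signed weights mean zero.\<close>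

definition flip :: "nat \<Rightarrow> clause \<Rightarrow> clause" where
  "flip x = map (flip_literal x)"

lemma fst_flip_literal [simp]: "fst (flip_literal x l) = fst l"
  by (simp add: flip_literal_def)

lemma flip_literal_flip_literal [simp]: "flip_literal x (flip_literal x l) = l"
  by (cases l) (simp add: flip_literal_def)

lemma flip_flip [simp]: "flip x (flip x C) = C"
  by (induction C) (auto simp: flip_def)

lemma length_flip [simp]: "length (flip x C) = length C"
  by (simp add: flip_def)

lemma map_fst_flip [simp]: "map fst (flip x C) = map fst C"
  by (simp add: flip_def)

lemma clause_vars_flip [simp]: "clause_vars (flip x C) = clause_vars C"
  unfolding clause_vars_def using arg_cong[OF map_fst_flip, of set x C] by (simp only: set_map)

lemma flip_in_clauses: "C \<in> clauses k n \<Longrightarrow> flip x C \<in> clauses k n"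
  by (auto simp: clauses_def flip_def flip_literal_def split: if_splits)

lemma in_set_flip_iff: "l \<in> set (flip x b) \<longleftrightarrow> flip_literal x l \<in> set b"
proof
  assume "l \<in> set (flip x b)"
  then show "flip_literal x l \<in> set b" by (auto simp: flip_def)
next
  assume "flip_literal x l \<in> set b"
  then have "flip_literal x (flip_literal x l) \<in> set (flip x b)" unfolding flip_def set_map by (rule imageI)
  then show "l \<in> set (flip x b)" by simp
qed

lemma occ_sign_flip_other: "y \<noteq> x \<Longrightarrow> occ_sign y (flip x b) = occ_sign y b"
  by (simp add: occ_sign_def in_set_flip_iff) (simp add: flip_literal_def)

text \<open>Distinctness matters: a clause with both literals on \<open>x\<close> has sign 1 before
  and after the flip.\<close>

lemma occ_sign_flip:
  assumes "distinct (map fst b)" "x \<in> clause_vars b"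
  shows "occ_sign x (flip x b) = - occ_sign x b"
proof -
  have inj: "inj_on fst (set b)" using assms by (simp add: distinct_map)
  obtain v where v: "(x, v) \<in> set b" using assms by (auto simp: clause_vars_def)
  have "(x, \<not> v) \<notin> set b"
  proof
    assume "(x, \<not> v) \<in> set b"
    then have "(x, v) = (x, \<not> v)" using inj v by (intro inj_onD[OF inj]) auto
    then show False by simp
  qed
  then show ?thesis using v by (cases v) (simp_all add: occ_sign_def in_set_flip_iff flip_literal_def)
qed

section \<open>Exponential moments under a fixed partial assignment\<close>

locale partial_assignment =
  fixes n k :: nat and S :: "nat set" and \<sigma> :: "nat \<Rightarrow> bool"
  assumes S: "S \<subseteq> {1..n}" and n: "n > 0"
begin

definition U :: "nat set" where "U = {1..n} - S"

definition N :: real where "N = real (card U)"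

text \<open>The mean number of unassigned literals in a uniformly random clause of length
  \<open>k\<close>.\<close>

definition \<kappa> :: real where "\<kappa> = real k * N / real n"

definition alive :: "clause \<Rightarrow> bool" where
  "alive C \<longleftrightarrow> (\<forall>l\<in>set C. fst l \<in> S \<longrightarrow> snd l \<noteq> \<sigma> (fst l))"

definition rest :: "clause \<Rightarrow> clause" where
  "rest C = filter (\<lambda>l. fst l \<notin> S) C"

text \<open>Pulls a weight of residual clauses back to the original clauses. Sums over the formula
  then count residual clauses with multiplicity.\<close>

definition lift :: "(clause \<Rightarrow> real) \<Rightarrow> clause \<Rightarrow> real" where
  "lift w C = (if alive C then w (rest C) else 0)"

lemma finite_U: "finite U" by (simp add: U_def)

lemma N_nonneg: "0 \<le> N" by (simp add: N_def)

lemma N_le: "N \<le> real n"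
  using card_mono[of "{1..n}" U] by (simp add: N_def U_def)

lemma rest_in: "C \<in> clauses k n \<Longrightarrow> set (rest C) \<subseteq> U \<times> UNIV"
  by (fastforce simp: clauses_def rest_def U_def)

lemma length_rest_le: "C \<in> clauses k n \<Longrightarrow> length (rest C) \<le> k"
  using length_filter_le[of _ C] by (auto simp: clauses_def rest_def)

text \<open>The sum factorizes over literals: on an assigned variable the true literal contributes 0
  (the clause is satisfied) and the false one 1, on an unassigned variable both contribute
  \<open>g x\<close>.\<close>

lemma sum_lift_prod_list:
  "(\<Sum>C\<in>clauses k n. lift (\<lambda>b. prod_list (map (\<lambda>l. g (fst l)) b)) C)
     = (real n - N + 2 * (\<Sum>x\<in>U. g x)) ^ k"
proof -
  let ?h = "\<lambda>l. if fst l \<in> S then (if snd l = \<sigma> (fst l) then 0 else 1) else g (fst l)"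
  have "lift (\<lambda>b. prod_list (map (\<lambda>l. g (fst l)) b)) C = prod_list (map ?h C)" for C
  proof (induction C)
    case (Cons l C)
    have "alive (l # C) \<longleftrightarrow> (fst l \<in> S \<longrightarrow> snd l \<noteq> \<sigma> (fst l)) \<and> alive C" by (simp add: alive_def)
    moreover have "rest (l # C) = (if fst l \<in> S then rest C else l # rest C)" by (simp add: rest_def)
    ultimately show ?case using Cons by (auto simp: lift_def split: if_splits)
  qed (simp add: lift_def alive_def rest_def)
  then have "(\<Sum>C\<in>clauses k n. lift (\<lambda>b. prod_list (map (\<lambda>l. g (fst l)) b)) C)
     = (\<Sum>l\<in>{1..n} \<times> UNIV. ?h l) ^ k"
    unfolding clauses_def by (simp add: sum_prod_list_lists)
  also have "(\<Sum>l\<in>{1..n} \<times> (UNIV :: bool set). ?h l) = (\<Sum>x\<in>{1..n}. \<Sum>b\<in>UNIV. ?h (x, b))"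
    unfolding sum.cartesian_product by (intro sum.cong refl) auto
  also have "\<dots> = (\<Sum>x\<in>{1..n}. if x \<in> S then 1 else 2 * g x)"
    by (intro sum.cong) (auto simp: UNIV_bool)
  also have "\<dots> = (\<Sum>x\<in>S. 1) + (\<Sum>x\<in>U. 2 * g x)"
  proof -
    have "{1..n} \<inter> S = S" "{1..n} \<inter> - S = U" using S by (auto simp: U_def)
    then show ?thesis by (simp add: sum.If_cases)
  qed
  also have "\<dots> = real n - N + 2 * (\<Sum>x\<in>U. g x)"
  proof -
    have "card U = n - card S" using S finite_subset[OF S] by (simp add: U_def card_Diff_subset)
    moreover have "card S \<le> n" using card_mono[OF _ S] by simp
    ultimately show ?thesis by (simp add: N_def sum_distrib_left of_nat_diff)
  qed
  finally show ?thesis .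
qed

lemma sum_lift_mono:
  assumes "\<And>b. set b \<subseteq> U \<times> UNIV \<Longrightarrow> v b \<le> w b"
  shows "(\<Sum>C\<in>clauses k n. lift v C) \<le> (\<Sum>C\<in>clauses k n. lift w C)"
  using assms rest_in by (intro sum_mono) (auto simp: lift_def)

text \<open>The neutral weight is 1/2 per unassigned variable: then a random literal contributes
  exactly 1/2 on average, whence 2^k. The parameter \<open>y\<close> is the relative excess over it
  and enters through (1 + N y / n)^k \<le> exp (\<kappa> y).\<close>

lemma sum_lift_le:
  assumes w: "\<And>b. set b \<subseteq> U \<times> UNIV \<Longrightarrow> w b \<le> K * prod_list (map (\<lambda>l. g (fst l)) b)"
    and K: "0 \<le> K" and g: "\<And>x. 0 \<le> g x" and gs: "(\<Sum>x\<in>U. g x) \<le> N * (1 + y) / 2"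
  shows "(\<Sum>C\<in>clauses k n. lift w C) \<le> real (card (clauses k n)) * (K * exp (\<kappa> * y) / 2 ^ k)"
proof -
  have nr: "real n > 0" using n by simp
  have "(\<Sum>C\<in>clauses k n. lift w C) \<le> (\<Sum>C\<in>clauses k n. lift (\<lambda>b. K * prod_list (map (\<lambda>l. g (fst l)) b)) C)"
    by (rule sum_lift_mono[OF w])
  also have "\<dots> = K * (\<Sum>C\<in>clauses k n. lift (\<lambda>b. prod_list (map (\<lambda>l. g (fst l)) b)) C)"
    unfolding sum_distrib_left by (intro sum.cong) (auto simp: lift_def)
  also have "\<dots> = K * (real n - N + 2 * (\<Sum>x\<in>U. g x)) ^ k"
    by (simp only: sum_lift_prod_list)
  also have "\<dots> \<le> K * (real n * exp (N * y / real n)) ^ k"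
  proof (intro mult_left_mono power_mono K)
    have "real n - N + 2 * (\<Sum>x\<in>U. g x) \<le> real n * (1 + N * y / real n)"
    proof -
      have "2 * (\<Sum>x\<in>U. g x) \<le> N + N * y" using gs by (simp add: distrib_left)
      then show ?thesis using nr by (simp add: distrib_left)
    qed
    also have "\<dots> \<le> real n * exp (N * y / real n)"
      by (intro mult_left_mono exp_ge_add_one_self) simp
    finally show "real n - N + 2 * (\<Sum>x\<in>U. g x) \<le> real n * exp (N * y / real n)" .
    have "0 \<le> (\<Sum>x\<in>U. g x)" using g by (simp add: sum_nonneg)
    then show "0 \<le> real n - N + 2 * (\<Sum>x\<in>U. g x)" using N_le by simp
  qed
  also have "(real n * exp (N * y / real n)) ^ k = real (card (clauses k n)) * (exp (\<kappa> * y) / 2 ^ k)"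
    by (simp add: card_clauses power_mult_distrib \<kappa>_def exp_of_nat_mult[symmetric] mult_ac)
  finally show ?thesis by (simp add: mult_ac)
qed

text \<open>\<open>flip x\<close> permutes the clauses and, as \<open>x\<close> is unassigned,
  preserves being alive and commutes with \<open>rest\<close>.\<close>

lemma sum_lift_eq_0:
  assumes x: "x \<in> U" and odd: "\<And>b. w (flip x b) = - w b"
  shows "(\<Sum>C\<in>clauses k n. lift w C) = 0"
proof -
  have xS: "x \<notin> S" using x by (simp add: U_def)
  have "alive (flip x C) = alive C" for C
    using xS by (induction C) (auto simp: alive_def flip_def flip_literal_def)
  moreover have "rest (flip x C) = flip x (rest C)" for C
    by (induction C) (auto simp: rest_def flip_def)
  ultimately have flip: "lift w (flip x C) = - lift w C" for C by (simp add: lift_def odd)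
  have "(\<Sum>C\<in>clauses k n. lift w C) = (\<Sum>C\<in>clauses k n. lift w (flip x C))"
    by (rule sum.reindex_bij_witness[where i = "flip x" and j = "flip x"]) (auto intro: flip_in_clauses)
  then show ?thesis by (simp add: flip sum_negf)
qed

lemma lift_exp: "exp (l * lift w C) = 1 + lift (\<lambda>b. exp (l * w b) - 1) C"
  by (simp add: lift_def)

end

text \<open>\<open>m_le\<close> encodes t \<le> T: it cancels the 2^k in the mean of a lifted weight
  and leaves the scale N.\<close>

locale random_partial_assignment = partial_assignment +
  fixes m :: nat
  assumes m_small: "2 * m\<^sup>2 \<le> card (clauses k n)" and m_le: "real m \<le> 2 * N * 2 ^ k"
begin

abbreviation prb :: "cnf set \<Rightarrow> real" where
  "prb A \<equiv> measure_pmf.prob (random_cnf k n m) A"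

lemma card_pos: "card (clauses k n) > 0"
  using n by (simp add: card_clauses)

lemma prb_lift_ge:
  assumes w: "(\<Sum>C\<in>clauses k n. lift (\<lambda>b. exp (l * w b) - 1) C) \<le> real (card (clauses k n)) * (X / 2 ^ k)"
    and X: "0 \<le> X" and l: "0 \<le> l"
  shows "prb {\<Phi>. (\<Sum>C\<in>\<Phi>. lift w C) \<ge> h} \<le> 2 * exp (2 * N * X - l * h)"
  unfolding random_cnf_eq
proof (rule prob_sum_ge_le[OF finite_clauses card_pos m_small l])
  show "(\<Sum>C\<in>clauses k n. exp (l * lift w C)) \<le> real (card (clauses k n)) * (1 + X / 2 ^ k)"
    unfolding lift_exp sum.distrib using w by (simp add: distrib_left)
  have "real m * (X / 2 ^ k) \<le> (2 * N * 2 ^ k) * (X / 2 ^ k)"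
    using m_le X by (intro mult_right_mono) auto
  then show "real m * (X / 2 ^ k) \<le> 2 * N * X" by simp
qed

lemma prb_positive_ge:
  assumes w: "\<And>b. set b \<subseteq> U \<times> UNIV \<Longrightarrow> w b \<le> K * prod_list (map (\<lambda>l. g (fst l)) b)"
    and w0: "\<And>b. set b \<subseteq> U \<times> UNIV \<Longrightarrow> 0 \<le> w b \<and> l * w b \<le> 1"
    and K: "0 \<le> K" and g: "\<And>x. 0 \<le> g x" and gs: "(\<Sum>x\<in>U. g x) \<le> N * (1 + y) / 2"
    and l: "0 \<le> l"
  shows "prb {\<Phi>. (\<Sum>C\<in>\<Phi>. lift w C) \<ge> h} \<le> 2 * exp (4 * N * l * K * exp (\<kappa> * y) - l * h)"
proof -
  have "(\<Sum>C\<in>clauses k n. lift (\<lambda>b. exp (l * w b) - 1) C)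
      \<le> real (card (clauses k n)) * ((2 * l * K) * exp (\<kappa> * y) / 2 ^ k)"
  proof (rule sum_lift_le[OF _ _ g gs])
    fix b :: clause assume b: "set b \<subseteq> U \<times> UNIV"
    have "exp (l * w b) - 1 \<le> 2 * l * w b"
      using exp_le_one_plus_double[of "l * w b"] w0[OF b] l by simp
    also have "\<dots> \<le> 2 * l * (K * prod_list (map (\<lambda>l. g (fst l)) b))"
      using w[OF b] l by (intro mult_left_mono) auto
    finally show "exp (l * w b) - 1 \<le> (2 * l * K) * prod_list (map (\<lambda>l. g (fst l)) b)" by simp
  qed (use l K in auto)
  from prb_lift_ge[OF this _ l, of h] show ?thesis using l K by (simp add: mult_ac)
qed

text \<open>The linear term vanishes, and l^2 |w| \<le> 1 turns the quadratic one into |w|. The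
  moment term thus does not grow with \<open>l\<close>, which may be as large as the inverse square
  root of the maximal weight.\<close>

lemma prb_centered_ge:
  assumes w: "\<And>b. set b \<subseteq> U \<times> UNIV \<Longrightarrow> \<bar>w b\<bar> \<le> K * prod_list (map (\<lambda>l. g (fst l)) b)"
    and w0: "\<And>b. set b \<subseteq> U \<times> UNIV \<Longrightarrow> l ^ 2 * \<bar>w b\<bar> \<le> 1"
    and centered: "(\<Sum>C\<in>clauses k n. lift w C) = 0"
    and K: "0 \<le> K" and g: "\<And>x. 0 \<le> g x" and gs: "(\<Sum>x\<in>U. g x) \<le> N * (1 + y) / 2"
    and l: "1 \<le> l"
  shows "prb {\<Phi>. (\<Sum>C\<in>\<Phi>. lift w C) \<ge> h} \<le> 2 * exp (2 * N * K * exp (\<kappa> * y) - l * h)"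
proof -
  have "(\<Sum>C\<in>clauses k n. lift (\<lambda>b. exp (l * w b) - 1) C)
      \<le> (\<Sum>C\<in>clauses k n. lift (\<lambda>b. l * w b + \<bar>w b\<bar>) C)"
  proof (rule sum_lift_mono)
    fix b :: clause assume b: "set b \<subseteq> U \<times> UNIV"
    have "l * \<bar>w b\<bar> \<le> l ^ 2 * \<bar>w b\<bar>" using l by (intro mult_right_mono) (auto simp: power2_eq_square)
    then have "\<bar>l * w b\<bar> \<le> 1" using w0[OF b] l by (simp add: abs_mult)
    then have "exp (l * w b) - 1 \<le> l * w b + (l * w b)\<^sup>2" using exp_le_one_plus_square[of "l * w b"] by simp
    also have "(l * w b)\<^sup>2 = (l\<^sup>2 * \<bar>w b\<bar>) * \<bar>w b\<bar>"
      by (simp add: power2_eq_square mult_ac flip: abs_mult)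
    also have "\<dots> \<le> 1 * \<bar>w b\<bar>" by (intro mult_right_mono w0[OF b]) simp
    finally show "exp (l * w b) - 1 \<le> l * w b + \<bar>w b\<bar>" by simp
  qed
  also have "\<dots> = l * (\<Sum>C\<in>clauses k n. lift w C) + (\<Sum>C\<in>clauses k n. lift (\<lambda>b. \<bar>w b\<bar>) C)"
    unfolding sum_distrib_left sum.distrib[symmetric] by (intro sum.cong) (auto simp: lift_def)
  also have "\<dots> \<le> real (card (clauses k n)) * (K * exp (\<kappa> * y) / 2 ^ k)"
    using sum_lift_le[OF w K g gs] centered by simp
  finally show ?thesis using prb_lift_ge[of l w "K * exp (\<kappa> * y)" h] K l by (simp add: mult_ac)
qed

end

section \<open>Large deviation estimates\<close>

text \<open>Trades the missing constant and linear terms for a factor \<open>s\<^sup>2\<close>; the product that remains has an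
  expectation that factorizes over the literals of a random clause.\<close>

lemma excess_le_scaled:
  fixes u :: "'a \<Rightarrow> real"
  assumes fin: "finite A" and u: "\<And>y. 0 \<le> u y" and s: "0 < s" "s \<le> 1"
  shows "excess u A \<le> s\<^sup>2 * (\<Prod>y\<in>A. 1 + u y / s)"
proof -
  have us: "u y \<le> u y / s" for y using u[of y] s by (simp add: pos_le_divide_eq mult_left_le)
  have u0: "0 \<le> u y / s" for y using u s by simp
  have le: "(\<Prod>y\<in>B. 1 + u y) \<le> (\<Prod>y\<in>B. 1 + u y / s)" for B
    using u us by (intro prod_mono) (auto intro: add_nonneg_nonneg)
  have first: "(\<Prod>y\<in>B. 1 + u y) - 1 \<le> s * ((\<Prod>y\<in>B. 1 + u y / s) - 1)" if "finite B" for B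
    using that
  proof (induction B rule: finite_induct)
    case (insert a B)
    have "(\<Prod>y\<in>insert a B. 1 + u y) - 1 = ((\<Prod>y\<in>B. 1 + u y) - 1) + u a * (\<Prod>y\<in>B. 1 + u y)"
      using insert by (simp add: algebra_simps)
    also have "\<dots> \<le> s * ((\<Prod>y\<in>B. 1 + u y / s) - 1) + u a * (\<Prod>y\<in>B. 1 + u y / s)"
      using insert le u by (intro add_mono mult_left_mono) auto
    also have "\<dots> = s * ((\<Prod>y\<in>insert a B. 1 + u y / s) - 1)"
      using insert s by (simp add: field_simps)
    finally show ?case .
  qed simp
  have "excess u A \<le> s\<^sup>2 * ((\<Prod>y\<in>A. 1 + u y / s) - 1)"
    using fin
  proof (induction A rule: finite_induct)
    case (insert a A)
    have Q: "0 \<le> (\<Prod>y\<in>A. 1 + u y / s)" using u0 by (intro prod_nonneg) (auto intro: add_nonneg_nonneg)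
    have "excess u (insert a A) = excess u A + u a * ((\<Prod>y\<in>A. 1 + u y) - 1)"
      using insert by (simp add: excess_def algebra_simps)
    also have "\<dots> \<le> s\<^sup>2 * ((\<Prod>y\<in>A. 1 + u y / s) - 1) + u a * (s * ((\<Prod>y\<in>A. 1 + u y / s) - 1))"
      using insert first u by (intro add_mono mult_left_mono) auto
    also have "\<dots> \<le> s\<^sup>2 * ((\<Prod>y\<in>A. 1 + u y / s) - 1) + u a * (s * (\<Prod>y\<in>A. 1 + u y / s))"
      using u s by (intro add_left_mono mult_left_mono) auto
    also have "\<dots> = s\<^sup>2 * ((\<Prod>y\<in>insert a A. 1 + u y / s) - 1)"
      using insert s by (simp add: field_simps power2_eq_square)
    finally show ?case .
  qed (simp add: excess_def)
  then show ?thesis using s by (smt (verit) mult_left_mono zero_le_power2)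
qed

text \<open>Expanding the right side and choosing \<open>c\<close> in exactly one factor gives the
  left side. This absorbs the distinguished variable into a product over all literals.\<close>

lemma sum_prod_remove_le:
  fixes c G :: "'a \<Rightarrow> real"
  assumes fin: "finite V" and c: "\<And>x. 0 \<le> c x" and G: "\<And>x. 0 \<le> G x"
  shows "(\<Sum>x\<in>V. c x * (\<Prod>y\<in>V - {x}. G y)) \<le> (\<Prod>y\<in>V. G y + c y)"
  using fin
proof (induction V rule: finite_induct)
  case (insert a V)
  have "(\<Sum>x\<in>insert a V. c x * (\<Prod>y\<in>insert a V - {x}. G y))
     = c a * (\<Prod>y\<in>V. G y) + (\<Sum>x\<in>V. c x * (\<Prod>y\<in>insert a V - {x}. G y))"
    using insert by simp
  also have "(\<Sum>x\<in>V. c x * (\<Prod>y\<in>insert a V - {x}. G y)) = (\<Sum>x\<in>V. G a * (c x * (\<Prod>y\<in>V - {x}. G y)))"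
  proof (intro sum.cong refl)
    fix x assume "x \<in> V"
    then have "insert a V - {x} = insert a (V - {x})" using insert by auto
    then show "c x * (\<Prod>y\<in>insert a V - {x}. G y) = G a * (c x * (\<Prod>y\<in>V - {x}. G y))"
      using insert by simp
  qed
  also have "\<dots> = G a * (\<Sum>x\<in>V. c x * (\<Prod>y\<in>V - {x}. G y))" by (simp add: sum_distrib_left)
  also have "c a * (\<Prod>y\<in>V. G y) + \<dots> \<le> c a * (\<Prod>y\<in>V. G y + c y) + G a * (\<Prod>y\<in>V. G y + c y)"
    using insert c G by (intro add_mono mult_left_mono prod_mono) auto
  also have "\<dots> = (\<Prod>y\<in>insert a V. G y + c y)"
    using insert by (simp add: algebra_simps)
  finally show ?case .
qed simp

lemma prod_list_clause_vars:
  assumes "distinct (map fst b)"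
  shows "prod_list (map (\<lambda>l. g (fst l)) b) = (\<Prod>y\<in>clause_vars b. g y :: real)"
  using prod.distinct_set_conv_list[OF assms, of g] by (simp add: clause_vars_def comp_def)

section \<open>Tail bounds for long residual clauses\<close>

context random_partial_assignment
begin

definition \<delta> :: real where "\<delta> = exp (- \<kappa> / 500)"

text \<open>The square root of \<delta>, which is the margin that remains in the estimate of the
  excess.\<close>

definition \<epsilon> :: real where "\<epsilon> = exp (- \<kappa> / 1000)"

definition tidy :: "clause \<Rightarrow> bool" where
  "tidy b \<longleftrightarrow> distinct (map fst b) \<and> \<kappa> / 10 \<le> real (length b)"

lemma prb_Ex_subset_le:
  assumes "\<And>Y. Y \<subseteq> U \<Longrightarrow> prb (A Y) \<le> p"
  shows "prb (\<Union>Y\<in>Pow U. A Y) \<le> exp N * p"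
proof -
  have p0: "0 \<le> p" using order_trans[OF measure_nonneg assms[of "{}"]] by simp
  have "prb (\<Union>Y\<in>Pow U. A Y) \<le> (\<Sum>Y\<in>Pow U. prb (A Y))"
    using finite_U by (intro measure_pmf.finite_measure_subadditive_finite) auto
  also have "\<dots> \<le> (\<Sum>Y\<in>Pow U. p)" using assms by (intro sum_mono) auto
  also have "\<dots> = 2 ^ card U * p" using finite_U by (simp add: card_Pow)
  also have "(2::real) ^ card U \<le> exp 1 ^ card U"
    using exp_ge_add_one_self[of 1] by (intro power_mono) auto
  also have "exp 1 ^ card U = exp N" by (simp add: N_def exp_of_nat_mult[symmetric])
  finally show ?thesis using p0 by (simp add: mult_right_mono)
qed

lemma lift_sum: "lift (\<lambda>b. \<Sum>x\<in>Y. f x b) C = (\<Sum>x\<in>Y. lift (f x) C)"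
  by (simp add: lift_def)

end

text \<open>The first assumption comes from the choice of 10^8; the other two hold for large n, as
  \<delta> N is at least linear in n for fixed k and r.\<close>

locale long_clause_regime = random_partial_assignment +
  assumes kappa_large: "\<kappa> \<ge> 10 ^ 8" and k_small: "real k \<le> \<delta> * N / 1000"
    and repeats_small: "real m * (exp (real k) * real k ^ 2 / real n) \<le> \<delta> * N / 2000"
begin

lemma delta_eps: "\<delta> = \<epsilon> ^ 2" "\<epsilon> > 0" "\<delta> > 0"
  by (simp_all add: \<delta>_def \<epsilon>_def exp_of_nat_mult[symmetric])

lemma eps_small: "\<epsilon> \<le> 1 / 10 ^ 100"
proof -
  have "\<epsilon> \<le> exp (- 1000 * 100)" unfolding \<epsilon>_def using kappa_large by simp
  also have "\<dots> = exp (- 1000) ^ 100" by (simp add: exp_of_nat_mult[symmetric])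
  also have "\<dots> \<le> (1 / 1001) ^ 100"
  proof (rule power_mono)
    have "1 + 1000 \<le> exp (1000::real)" by (rule exp_ge_add_one_self)
    then show "exp (- 1000) \<le> 1 / (1001::real)" by (simp add: exp_minus field_simps)
  qed simp
  also have "\<dots> \<le> 1 / 10 ^ 100" unfolding power_one_over
    by (intro divide_left_mono power_mono) auto
  finally show ?thesis .
qed

lemma delta_small: "\<delta> \<le> 1 / 10 ^ 100" "\<delta> \<le> \<epsilon>"
proof -
  have "\<epsilon> \<le> 1" using eps_small by (rule order_trans) simp
  then show "\<delta> \<le> \<epsilon>" using delta_eps by (simp add: power2_eq_square mult_left_le)
  then show "\<delta> \<le> 1 / 10 ^ 100" using eps_small by simp
qed

lemma exp_kappa: "exp (\<kappa> / 1000) = 1 / \<epsilon>" "exp (\<kappa> / 500) = 1 / \<delta>"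
  by (simp_all add: \<epsilon>_def \<delta>_def exp_minus field_simps)

lemma k_pos: "k \<ge> 1"
proof (rule ccontr)
  assume "\<not> 1 \<le> k"
  then have "\<kappa> = 0" by (simp add: \<kappa>_def)
  then show False using kappa_large by simp
qed

lemma deltaN: "\<delta> * N \<ge> 1000" using k_small k_pos by simp

lemma N_ge: "N \<ge> 1000" "\<delta> * N \<le> N"
proof -
  have "\<delta> \<le> 1" using delta_small(1) by (rule order_trans) simp
  then show "\<delta> * N \<le> N" using N_nonneg by (simp add: mult_left_le_one_le delta_eps less_imp_le)
  then show "N \<ge> 1000" using deltaN by simp
qed

text \<open>The identity 4/25 * 1/10 = 8/500 fixes the constant 1/500 in \<delta>. The rate 4/25 is
  one that all three kinds of influence (falsifying product, first-order weight, excess)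
  attain.\<close>

lemma tidy_length: "tidy b \<Longrightarrow> real (length b) \<ge> 10 ^ 7" "tidy b \<Longrightarrow> exp (- 4 / 25 * real (length b)) \<le> \<delta> ^ 8"
proof -
  assume "tidy b"
  then have "\<kappa> / 10 \<le> real (length b)" by (simp add: tidy_def)
  then show "real (length b) \<ge> 10 ^ 7" "exp (- 4 / 25 * real (length b)) \<le> \<delta> ^ 8"
    using kappa_large by (simp_all add: \<delta>_def exp_of_nat_mult[symmetric])
qed

lemma exp_half_power: "1 / 2 ^ L \<le> exp (- 2 / 3 * real L)"
proof -
  have "exp (2 / 3) \<le> exp (ln (2::real))" using ln2_ge_two_thirds by (simp only: exp_le_cancel_iff)
  then have "exp (2 / 3) \<le> (2::real)" by simp
  then have "exp (2 / 3) ^ L \<le> (2::real) ^ L" by (intro power_mono) auto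
  then show ?thesis by (simp add: exp_of_nat_mult[symmetric] exp_minus field_simps)
qed

lemma quadratic_le_exp:
  assumes "x \<ge> (0::real)" shows "x * (1 + 2 * x) \<le> 4 * 10 ^ 6 * exp (x / 1000)"
proof -
  have "x * (1 + 2 * x) = 1000 * (x / 1000) + 2 * 10 ^ 6 * (x / 1000) ^ 2"
    by (simp add: power2_eq_square algebra_simps)
  also have "\<dots> \<le> 4 * 10 ^ 6 * (1 + x / 1000 + (x / 1000) ^ 2 / 2)"
    using assms by (simp add: algebra_simps)
  also have "\<dots> \<le> 4 * 10 ^ 6 * exp (x / 1000)"
    using exp_lower_Taylor_quadratic[of "x / 1000"] assms by (intro mult_left_mono) auto
  finally show ?thesis .
qed

text \<open>A common majorant for the signed sums, the pair sums and the occurrence weights summed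
  over the variables of the clause, whatever sets of variables are chosen.\<close>

definition weight_cap :: "clause \<Rightarrow> real" where
  "weight_cap b = (if tidy b then real (length b) * (1 + 2 * real (length b)) / 2 ^ length b else 0)"

lemma weight_cap_nonneg: "0 \<le> weight_cap b"
  by (simp add: weight_cap_def)

lemma weight_cap_small: "weight_cap b \<le> \<delta> ^ 8"
proof (cases "tidy b")
  case True
  let ?L = "real (length b)"
  have L: "?L \<ge> 10 ^ 7" by (rule tidy_length[OF True])
  have "?L * (1 + 2 * ?L) * (1 / 2 ^ length b) \<le> (4 * 10 ^ 6 * exp (?L / 1000)) * exp (- 2 / 3 * ?L)"
    by (intro mult_mono quadratic_le_exp exp_half_power) auto
  also have "4 * 10 ^ 6 \<le> exp (?L / 2)"
    using exp_ge_add_one_self[of "?L / 2"] L by (rule_tac order_trans[of _ "1 + ?L / 2"]) auto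
  then have "(4 * 10 ^ 6 * exp (?L / 1000)) * exp (- 2 / 3 * ?L) \<le> (exp (?L / 2) * exp (?L / 1000)) * exp (- 2 / 3 * ?L)"
    by (intro mult_right_mono) auto
  also have "\<dots> = exp (- (2 / 3 - 1 / 2 - 1 / 1000) * ?L)"
    by (simp add: exp_add[symmetric] algebra_simps)
  also have "\<dots> \<le> exp (- 4 / 25 * ?L)" by simp
  also have "\<dots> \<le> \<delta> ^ 8" by (rule tidy_length[OF True])
  finally show ?thesis using True by (simp add: weight_cap_def)
qed (use delta_eps in \<open>simp add: weight_cap_def\<close>)

text \<open>The quadratic factor is absorbed into exp (L / 1000) to obtain a product over literals.
  The weight is slightly above 1/2, with excess y = 1/500, so the moment grows only to exp (\<kappa>
  / 500) = 1 / \<delta>.\<close>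

lemma weight_cap_le_prod:
  "weight_cap b \<le> 4 * 10 ^ 6 * prod_list (map (\<lambda>l. exp (1 / 1000) / 2) b)"
proof -
  let ?L = "real (length b)"
  have "weight_cap b \<le> ?L * (1 + 2 * ?L) / 2 ^ length b" by (simp add: weight_cap_def)
  also have "\<dots> \<le> 4 * 10 ^ 6 * exp (?L / 1000) / 2 ^ length b"
    by (intro divide_right_mono quadratic_le_exp) auto
  also have "\<dots> = 4 * 10 ^ 6 * prod_list (map (\<lambda>l. exp (1 / 1000) / 2) b)"
    by (simp add: map_replicate_const prod_list_replicate power_divide exp_of_nat_mult[symmetric])
  finally show ?thesis .
qed

lemma sum_half_exp_le: "(\<Sum>x\<in>U. exp (1 / 1000) / 2) \<le> N * (1 + 1 / 500) / 2"
proof -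
  have "exp (1 / 1000) \<le> 1 + 2 * (1 / 1000 :: real)" by (rule exp_le_one_plus_double) auto
  then have "N * exp (1 / 1000) \<le> N * (1 + 1 / 500)" using N_nonneg by (intro mult_left_mono) auto
  then show ?thesis by (simp add: N_def)
qed

text \<open>The moment bound is of order N / \<delta>, far below the threshold of order N /
  \<delta>^2; the parameter l = 1 suffices.\<close>

lemma prb_heavy: "prb {\<Phi>. (\<Sum>C\<in>\<Phi>. lift weight_cap C) \<ge> N / (1000 * \<delta>\<^sup>2)} \<le> 2 * exp (- \<delta> * N / 2000)"
proof -
  have d: "0 < \<delta>" "\<delta> \<le> 1 / 10 ^ 12"
    using delta_eps delta_small by (auto intro: order_trans)
  have "prb {\<Phi>. (\<Sum>C\<in>\<Phi>. lift weight_cap C) \<ge> N / (1000 * \<delta>\<^sup>2)}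
     \<le> 2 * exp (4 * N * 1 * (4 * 10 ^ 6) * exp (\<kappa> * (1 / 500)) - 1 * (N / (1000 * \<delta>\<^sup>2)))"
  proof (rule prb_positive_ge[OF weight_cap_le_prod _ _ _ sum_half_exp_le])
    fix b
    have "\<delta> ^ 8 \<le> 1" using d by (intro power_le_one) auto
    then show "0 \<le> weight_cap b \<and> 1 * weight_cap b \<le> 1"
      using weight_cap_small[of b] weight_cap_nonneg by simp
  qed auto
  also have "\<dots> \<le> 2 * exp (- \<delta> * N / 2000)"
  proof -
    have "16 * 10 ^ 6 * \<delta> + \<delta> ^ 3 / 2000 \<le> 1 / 1000"
    proof -
      have "\<delta> ^ 3 \<le> 1" using d by (intro power_le_one) auto
      then show ?thesis using d by simp
    qed
    moreover define P where "P = N / \<delta>\<^sup>2"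
    moreover have "0 \<le> P" using N_nonneg by (simp add: P_def)
    ultimately have "(16 * 10 ^ 6 * \<delta> + \<delta> ^ 3 / 2000) * P \<le> 1 / 1000 * P"
      by (intro mult_right_mono)
    then have "16 * 10 ^ 6 * (\<delta> * P) + \<delta> ^ 3 * P / 2000 \<le> P / 1000"
      by (simp add: algebra_simps)
    moreover have P: "\<delta> * P = N / \<delta>" "\<delta> ^ 3 * P = \<delta> * N" "N / (1000 * \<delta>\<^sup>2) = P / 1000"
      using d by (simp_all add: P_def field_simps power2_eq_square power3_eq_cube)
    ultimately have "16 * 10 ^ 6 * (N / \<delta>) + \<delta> * N / 2000 \<le> P / 1000" by (simp only: P)
    then have "16 * 10 ^ 6 * (N / \<delta>) - P / 1000 \<le> - (\<delta> * N / 2000)" by argo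
    then have "4 * N * 1 * (4 * 10 ^ 6) * (1 / \<delta>) - 1 * (N / (1000 * \<delta>\<^sup>2)) \<le> - \<delta> * N / 2000"
      unfolding P by simp
    then show ?thesis using exp_kappa(2) by simp
  qed
  finally show ?thesis .
qed

text \<open>With l = 1 / \<delta>^4 the cap \<delta>^8 just meets l^2 |w| \<le> 1. Then l times the
  threshold is N / (10^5 \<delta>^2), which dominates the moment term of order N / \<delta> and
  leaves 4 N, enough for union bounds over two subsets of \<open>U\<close>.\<close>

lemma prb_centered:
  assumes w: "\<And>b. \<bar>w b\<bar> \<le> weight_cap b" and centered: "(\<Sum>C\<in>clauses k n. lift w C) = 0"
  shows "prb {\<Phi>. (\<Sum>C\<in>\<Phi>. lift w C) \<ge> \<delta>\<^sup>2 * N / 10 ^ 5} \<le> 2 * exp (- 4 * N)"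
proof -
  have d: "0 < \<delta>" "\<delta> \<le> 1 / 10 ^ 14" "\<delta> \<le> 1"
    using delta_eps delta_small by (auto intro: order_trans)
  let ?l = "1 / \<delta> ^ 4"
  have "prb {\<Phi>. (\<Sum>C\<in>\<Phi>. lift w C) \<ge> \<delta>\<^sup>2 * N / 10 ^ 5}
     \<le> 2 * exp (2 * N * (4 * 10 ^ 6) * exp (\<kappa> * (1 / 500)) - ?l * (\<delta>\<^sup>2 * N / 10 ^ 5))"
  proof (rule prb_centered_ge[OF _ _ centered _ _ sum_half_exp_le])
    fix b :: clause
    show "\<bar>w b\<bar> \<le> 4 * 10 ^ 6 * prod_list (map (\<lambda>l. exp (1 / 1000) / 2) b)"
      using w[of b] weight_cap_le_prod[of b] by linarith
    have "?l ^ 2 * \<bar>w b\<bar> \<le> ?l ^ 2 * \<delta> ^ 8"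
      using w[of b] weight_cap_small[of b] by (intro mult_left_mono) auto
    also have "\<dots> = 1" using d by (simp add: power_divide flip: power_mult)
    finally show "?l ^ 2 * \<bar>w b\<bar> \<le> 1" .
  next
    have "\<delta> ^ 4 \<le> 1" using d by (intro power_le_one) auto
    then show "1 \<le> ?l" using d by simp
  qed auto
  also have "\<dots> \<le> 2 * exp (- 4 * N)"
  proof -
    have "8 * 10 ^ 6 * \<delta> + 4 * \<delta>\<^sup>2 \<le> 1 / 10 ^ 5"
    proof -
      have "\<delta>\<^sup>2 \<le> \<delta>" using d by (simp add: power2_eq_square mult_left_le)
      then show ?thesis using d by simp
    qed
    moreover define P where "P = N / \<delta>\<^sup>2"
    moreover have "0 \<le> P" using N_nonneg by (simp add: P_def)
    ultimately have "(8 * 10 ^ 6 * \<delta> + 4 * \<delta>\<^sup>2) * P \<le> 1 / 10 ^ 5 * P"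
      by (intro mult_right_mono)
    then have "8 * 10 ^ 6 * (\<delta> * P) + 4 * (\<delta>\<^sup>2 * P) \<le> P / 10 ^ 5"
      by (simp add: algebra_simps)
    moreover have "\<delta> * P = N / \<delta>" "\<delta>\<^sup>2 * P = N" "?l * (\<delta>\<^sup>2 * N / 10 ^ 5) = P / 10 ^ 5"
      using d by (simp_all add: P_def field_simps power2_eq_square power4_eq_xxxx)
    ultimately have "2 * N * (4 * 10 ^ 6) * (1 / \<delta>) - ?l * (\<delta>\<^sup>2 * N / 10 ^ 5) \<le> - 4 * N"
      by simp
    then show ?thesis using exp_kappa(2) by simp
  qed
  finally show ?thesis .
qed

end

text \<open>Either the tail already repeats a variable, or the head uses one of the at most
  \<open>k\<close> variables of the tail; the recursion closes by k^2 + k \<le> (k + 1)^2.\<close>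

lemma count_nondistinct_le:
  assumes "n > 0"
  shows "real (card {C \<in> clauses k n. \<not> distinct (map fst C)}) \<le> real k ^ 2 * (2 * real n) ^ k / real n"
proof (induction k)
  case 0
  have "{C \<in> clauses 0 n. \<not> distinct (map fst C)} = {}" by (auto simp: clauses_def)
  then show ?case by (simp only: card.empty) simp
next
  case (Suc k)
  let ?L = "{1..n} \<times> (UNIV :: bool set)"
  let ?bad = "{C \<in> clauses k n. \<not> distinct (map fst C)}"
  let ?A = "(\<lambda>(l, C). l # C) ` (?L \<times> ?bad)"
  let ?B = "(\<lambda>(C, l). l # C) ` Sigma (clauses k n) (\<lambda>C. (fst ` set C) \<times> UNIV)"
  have finL: "card ?L = 2 * n" "finite ?L" by (simp_all add: card_cartesian_product)
  have finB: "finite (Sigma (clauses k n) (\<lambda>C. (fst ` set C) \<times> (UNIV :: bool set)))"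
    using finite_clauses by auto
  have "{C \<in> clauses (Suc k) n. \<not> distinct (map fst C)} \<subseteq> ?A \<union> ?B"
  proof
    fix C assume C: "C \<in> {C \<in> clauses (Suc k) n. \<not> distinct (map fst C)}"
    then obtain l C' where C': "C = l # C'" "C' \<in> clauses k n" "l \<in> ?L"
      by (auto simp: clauses_def length_Suc_conv)
    show "C \<in> ?A \<union> ?B"
    proof (cases "distinct (map fst C')")
      case False
      then show ?thesis using C' by (auto simp: image_iff)
    next
      case True
      then have "fst l \<in> fst ` set C'" using C C' by auto
      then have "(C', l) \<in> Sigma (clauses k n) (\<lambda>C. (fst ` set C) \<times> UNIV)"
        using C' by (cases l) auto
      then show ?thesis using C' by (force simp: image_iff)
    qed
  qed
  then have "card {C \<in> clauses (Suc k) n. \<not> distinct (map fst C)} \<le> card (?A \<union> ?B)"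
    using finB finite_clauses by (intro card_mono) auto
  also have "\<dots> \<le> card ?A + card ?B" by (rule card_Un_le)
  also have "card ?A \<le> card (?L \<times> ?bad)" using finite_clauses by (intro card_image_le) auto
  also have "\<dots> = 2 * n * card ?bad" using finL by (simp add: card_cartesian_product)
  also have "card ?B \<le> card (Sigma (clauses k n) (\<lambda>C. (fst ` set C) \<times> (UNIV :: bool set)))"
    by (rule card_image_le[OF finB])
  also have "\<dots> = (\<Sum>C\<in>clauses k n. card ((fst ` set C) \<times> (UNIV :: bool set)))"
    using finite_clauses by (intro card_SigmaI) auto
  also have "\<dots> \<le> (\<Sum>C\<in>clauses k n. 2 * k)"
  proof (rule sum_mono)
    fix C assume "C \<in> clauses k n"
    then have "card (fst ` set C) \<le> k"
      using card_image_le[of "set C" fst] card_length[of C] by (simp add: clauses_def)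
    then show "card ((fst ` set C) \<times> (UNIV :: bool set)) \<le> 2 * k" by (simp add: card_cartesian_product)
  qed
  also have "\<dots> = 2 * k * (2 * n) ^ k" by (simp add: card_clauses)
  finally have "card {C \<in> clauses (Suc k) n. \<not> distinct (map fst C)} \<le> 2 * n * card ?bad + 2 * k * (2 * n) ^ k"
    by simp
  then have "real (card {C \<in> clauses (Suc k) n. \<not> distinct (map fst C)})
      \<le> real (2 * n * card ?bad + 2 * k * (2 * n) ^ k)" by (rule of_nat_mono)
  also have "\<dots> = 2 * real n * real (card ?bad) + 2 * real k * (2 * real n) ^ k" by simp
  also have "\<dots> \<le> 2 * real n * (real k ^ 2 * (2 * real n) ^ k / real n) + 2 * real k * (2 * real n) ^ k"
    using Suc by (intro add_mono mult_left_mono) auto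
  also have "\<dots> = (real k ^ 2 + real k) * (2 * (2 * real n) ^ k)"
    using assms by (simp add: field_simps)
  also have "\<dots> \<le> (real (Suc k)) ^ 2 * (2 * (2 * real n) ^ k)"
    by (intro mult_right_mono) (auto simp: power2_eq_square algebra_simps)
  also have "\<dots> = (real (Suc k)) ^ 2 * (2 * real n) ^ Suc k / real n" using assms by simp
  finally show ?case .
qed

section \<open>Short clauses, repeated variables and signed sums\<close>

context long_clause_regime
begin

definition short_length :: "clause \<Rightarrow> real" where
  "short_length b = (if real (length b) < \<kappa> / 10 then real (length b) else 0)"

text \<open>The weight 1/10 per literal penalizes length. For L < \<kappa> / 10 this costs (10 e)^L
  \<le> exp (4 L) \<le> exp (2 \<kappa> / 5), while the mean gains exp (- 4 \<kappa> / 5).\<close>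

lemma prb_short: "prb {\<Phi>. (\<Sum>C\<in>\<Phi>. lift short_length C) \<ge> \<delta> * N / 1000} \<le> 2 * exp (- \<delta> * N / 2000)"
proof -
  let ?X = "exp (2 / 5 * \<kappa>) * exp (\<kappa> * (- 4 / 5))"
  have "(\<Sum>C\<in>clauses k n. lift (\<lambda>b. exp (1 * short_length b) - 1) C)
     \<le> real (card (clauses k n)) * (exp (2 / 5 * \<kappa>) * exp (\<kappa> * (- 4 / 5)) / 2 ^ k)"
  proof (rule sum_lift_le[where g = "\<lambda>_. 1 / 10"])
    fix b :: clause
    have one: "0 \<le> prod_list (map (\<lambda>l. 1 / 10 :: real) b)" by (induction b) auto
    show "exp (1 * short_length b) - 1 \<le> exp (2 / 5 * \<kappa>) * prod_list (map (\<lambda>l. 1 / 10) b)"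
    proof (cases "real (length b) < \<kappa> / 10")
      case True
      let ?L = "length b"
      have "(10::real) \<le> exp 3"
      proof -
        have "(1 + 1 / 4) ^ 12 \<le> exp (1 / 4 :: real) ^ 12"
          by (intro power_mono exp_ge_add_one_self) auto
        also have "\<dots> = exp 3" by (simp add: exp_of_nat_mult[symmetric])
        finally show ?thesis by (rule order_trans[rotated]) (simp add: field_simps)
      qed
      then have "(10::real) ^ ?L \<le> exp 3 ^ ?L" by (intro power_mono) auto
      also have "\<dots> = exp (3 * real ?L)" by (simp add: exp_of_nat_mult[symmetric] mult.commute)
      finally have "exp (real ?L) * 10 ^ ?L \<le> exp (real ?L) * exp (3 * real ?L)" by simp
      also have "\<dots> = exp (4 * real ?L)" by (simp add: exp_add[symmetric])
      also have "\<dots> \<le> exp (2 / 5 * \<kappa>)" using True by simp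
      finally have "exp (real ?L) \<le> exp (2 / 5 * \<kappa>) * (1 / 10) ^ ?L" by (simp add: field_simps)
      then show ?thesis using True
        by (simp add: short_length_def map_replicate_const prod_list_replicate)
    qed (use one in \<open>simp add: short_length_def\<close>)
  next
    show "(\<Sum>x\<in>U. 1 / 10) \<le> N * (1 + (- 4 / 5)) / 2" by (simp add: N_def)
  qed auto
  from prb_lift_ge[OF this, of "\<delta> * N / 1000"]
  have "prb {\<Phi>. (\<Sum>C\<in>\<Phi>. lift short_length C) \<ge> \<delta> * N / 1000} \<le> 2 * exp (2 * N * ?X - \<delta> * N / 1000)"
    by simp
  also have "2 * N * ?X - \<delta> * N / 1000 \<le> - \<delta> * N / 2000"
  proof -
    have "?X = exp (- (2 / 5) * \<kappa>)" by (simp add: exp_add[symmetric] algebra_simps)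
    also have "\<dots> \<le> exp (2 * (- \<kappa> / 500))" using kappa_large by simp
    also have "\<dots> = \<delta> * \<delta>" by (simp add: \<delta>_def exp_add[symmetric])
    also have "\<dots> \<le> (1 / 4000) * \<delta>"
    proof (rule mult_right_mono)
      show "\<delta> \<le> 1 / 4000" using delta_small(1) by (rule order_trans) simp
    qed (use delta_eps in simp)
    finally have "?X * (2 * N) \<le> (1 / 4000) * \<delta> * (2 * N)" using N_nonneg by (intro mult_right_mono) auto
    then show ?thesis by (simp add: algebra_simps)
  qed
  finally show ?thesis by simp
qed

text \<open>Repetitions are counted in the original clause, where they have frequency of order k^2 /
  n; each is charged \<open>k\<close>, an upper bound for the residual length.\<close>

lemma prb_repeat:
  "prb {\<Phi>. (\<Sum>C\<in>\<Phi>. if distinct (map fst C) then 0 else real k) \<ge> \<delta> * N / 1000}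
     \<le> 2 * exp (- \<delta> * N / 2000)"
proof -
  let ?w = "\<lambda>C. if distinct (map fst C) then 0 else real k"
  let ?M = "clauses k n"
  let ?X = "exp (real k) * real k ^ 2 / real n"
  have "prb {\<Phi>. (\<Sum>C\<in>\<Phi>. ?w C) \<ge> \<delta> * N / 1000} \<le> 2 * exp (\<delta> * N / 2000 - 1 * (\<delta> * N / 1000))"
    unfolding random_cnf_eq
  proof (rule prob_sum_ge_le[OF finite_clauses card_pos m_small _ _ repeats_small])
    have "(\<Sum>C\<in>?M. exp (1 * ?w C)) \<le> (\<Sum>C\<in>?M. 1 + (if \<not> distinct (map fst C) then exp (real k) else 0))"
      by (intro sum_mono) auto
    also have "\<dots> = real (card ?M) + exp (real k) * real (card {C \<in> ?M. \<not> distinct (map fst C)})"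
      unfolding sum.distrib using finite_clauses by (simp add: sum.If_cases Int_def)
    also have "\<dots> \<le> real (card ?M) + exp (real k) * (real k ^ 2 * (2 * real n) ^ k / real n)"
      using n by (intro add_left_mono mult_left_mono count_nondistinct_le) auto
    also have "\<dots> = real (card ?M) * (1 + ?X)" by (simp add: card_clauses field_simps)
    finally show "(\<Sum>C\<in>?M. exp (1 * ?w C)) \<le> real (card ?M) * (1 + ?X)" .
  qed simp
  then show ?thesis by (simp add: mult.commute)
qed

text \<open>The contribution of one residual clause to the sum of the signed weights over
  \<open>Y\<close>.\<close>

definition signed_sum :: "nat set \<Rightarrow> clause \<Rightarrow> real" where
  "signed_sum Y b = (\<Sum>x\<in>Y. if tidy b \<and> x \<in> clause_vars b then of_int (occ_sign x b) / 2 ^ length b else 0)"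

text \<open>The same for the pair weights, with \<Gamma> replaced by the indicator of
  \<open>Z\<close>.\<close>

definition pair_sum :: "nat set \<Rightarrow> nat set \<Rightarrow> clause \<Rightarrow> real" where
  "pair_sum Y Z b = (\<Sum>x\<in>Y. \<Sum>y\<in>Z. if tidy b \<and> x \<in> clause_vars b \<and> y \<in> clause_vars b - {x}
     then of_int (occ_sign x b) * of_int (occ_sign y b) / 2 ^ length b else 0)"

lemma tidy_flip [simp]: "tidy (flip x b) \<longleftrightarrow> tidy b"
  by (simp add: tidy_def)

lemma card_Int_clause_vars_le: "real (card (Y \<inter> clause_vars b)) \<le> real (length b)"
proof -
  have "card (Y \<inter> clause_vars b) \<le> card (clause_vars b)" by (intro card_mono) auto
  also have "\<dots> \<le> length (map fst b)" unfolding clause_vars_def set_map[symmetric] by (rule card_length)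
  finally show ?thesis by simp
qed

lemma abs_signed_sum_le: "finite Y \<Longrightarrow> \<bar>signed_sum Y b\<bar> \<le> weight_cap b"
proof -
  assume Y: "finite Y"
  show ?thesis
  proof (cases "tidy b")
    case True
    have "signed_sum Y b = (\<Sum>x\<in>Y \<inter> clause_vars b. of_int (occ_sign x b) / 2 ^ length b)"
      unfolding signed_sum_def using Y True by (simp add: sum.inter_restrict)
    also have "\<bar>\<dots>\<bar> \<le> real (length b) * (1 / 2 ^ length b)"
      by (intro abs_sum_mult_card_le card_Int_clause_vars_le) (auto simp: abs_divide abs_occ_sign)
    also have "\<dots> \<le> weight_cap b" using True
      by (simp add: weight_cap_def divide_right_mono algebra_simps)
    finally show ?thesis .
  qed (simp add: signed_sum_def weight_cap_def)
qed

lemma abs_pair_sum_le: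
  assumes Y: "finite Y" and Z: "finite Z"
  shows "\<bar>pair_sum Y Z b\<bar> \<le> weight_cap b"
proof (cases "tidy b")
  case True
  have "pair_sum Y Z b = (\<Sum>x\<in>Y. if x \<in> clause_vars b then (\<Sum>y\<in>Z. if y \<in> clause_vars b - {x}
      then of_int (occ_sign x b) * of_int (occ_sign y b) / 2 ^ length b else 0) else 0)"
    unfolding pair_sum_def using True by (intro sum.cong) auto
  also have "\<dots> = (\<Sum>x\<in>Y \<inter> clause_vars b. \<Sum>y\<in>Z. if y \<in> clause_vars b - {x}
      then of_int (occ_sign x b) * of_int (occ_sign y b) / 2 ^ length b else 0)"
    by (simp only: sum.inter_restrict[OF Y])
  also have "\<bar>\<dots>\<bar> \<le> real (length b) * (real (length b) / 2 ^ length b)"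
  proof (intro abs_sum_mult_card_le card_Int_clause_vars_le)
    fix x
    have "(\<Sum>y\<in>Z. if y \<in> clause_vars b - {x}
        then real_of_int (occ_sign x b) * of_int (occ_sign y b) / 2 ^ length b else 0)
      = (\<Sum>y\<in>Z \<inter> (clause_vars b - {x}). of_int (occ_sign x b) * of_int (occ_sign y b) / 2 ^ length b)"
      using Z by (simp add: sum.inter_restrict)
    also have "\<bar>\<dots>\<bar> \<le> real (length b) * (1 / 2 ^ length b)"
    proof (rule abs_sum_mult_card_le)
      have "card (Z \<inter> (clause_vars b - {x})) \<le> card (Z \<inter> clause_vars b)" by (intro card_mono) auto
      then show "real (card (Z \<inter> (clause_vars b - {x}))) \<le> real (length b)"
        using card_Int_clause_vars_le[of Z b] by linarith
    qed (auto simp: abs_divide abs_mult abs_occ_sign)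
    finally show "\<bar>\<Sum>y\<in>Z. if y \<in> clause_vars b - {x}
        then real_of_int (occ_sign x b) * of_int (occ_sign y b) / 2 ^ length b else 0\<bar>
        \<le> real (length b) / 2 ^ length b" by simp
  qed simp
  also have "\<dots> \<le> weight_cap b" using True
    by (simp add: weight_cap_def divide_right_mono mult_left_mono)
  finally show ?thesis .
qed (simp add: pair_sum_def weight_cap_def)

lemma signed_sum_centered: "Y \<subseteq> U \<Longrightarrow> (\<Sum>C\<in>clauses k n. lift (\<lambda>b. e * signed_sum Y b) C) = 0"
proof -
  assume Y: "Y \<subseteq> U"
  have "(\<Sum>C\<in>clauses k n. lift (\<lambda>b. e * signed_sum Y b) C) = (\<Sum>x\<in>Y. \<Sum>C\<in>clauses k n.
     lift (\<lambda>b. e * (if tidy b \<and> x \<in> clause_vars b then of_int (occ_sign x b) / 2 ^ length b else 0)) C)"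
    unfolding signed_sum_def sum_distrib_left lift_sum by (rule sum.swap)
  also have "\<dots> = (\<Sum>x\<in>Y. 0)"
  proof (intro sum.cong refl sum_lift_eq_0)
    fix x b assume "x \<in> Y"
    then show "x \<in> U" using Y by auto
    show "e * (if tidy (flip x b) \<and> x \<in> clause_vars (flip x b)
           then of_int (occ_sign x (flip x b)) / 2 ^ length (flip x b) else 0)
        = - (e * (if tidy b \<and> x \<in> clause_vars b then of_int (occ_sign x b) / 2 ^ length b else 0))"
      by (auto simp: occ_sign_flip tidy_def)
  qed
  finally show ?thesis by simp
qed

text \<open>Flipping \<open>x\<close> negates the sign of \<open>x\<close> and leaves that of y
  \<noteq> x unchanged, so every pair has mean zero.\<close>

lemma pair_sum_centered: "Y \<subseteq> U \<Longrightarrow> (\<Sum>C\<in>clauses k n. lift (\<lambda>b. e * pair_sum Y Z b) C) = 0"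
proof -
  assume Y: "Y \<subseteq> U"
  let ?f = "\<lambda>x y b. if tidy b \<and> x \<in> clause_vars b \<and> y \<in> clause_vars b - {x}
     then real_of_int (occ_sign x b) * of_int (occ_sign y b) / 2 ^ length b else 0"
  have "(\<Sum>C\<in>clauses k n. lift (\<lambda>b. e * pair_sum Y Z b) C)
     = (\<Sum>C\<in>clauses k n. \<Sum>x\<in>Y. \<Sum>y\<in>Z. lift (\<lambda>b. e * ?f x y b) C)"
    unfolding pair_sum_def sum_distrib_left lift_sum ..
  also have "\<dots> = (\<Sum>x\<in>Y. \<Sum>C\<in>clauses k n. \<Sum>y\<in>Z. lift (\<lambda>b. e * ?f x y b) C)"
    by (rule sum.swap)
  also have "\<dots> = (\<Sum>x\<in>Y. \<Sum>y\<in>Z. \<Sum>C\<in>clauses k n. lift (\<lambda>b. e * ?f x y b) C)"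
    by (intro sum.cong refl sum.swap)
  also have "\<dots> = (\<Sum>x\<in>Y. \<Sum>y\<in>Z. 0)"
  proof (intro sum.cong refl sum_lift_eq_0)
    fix x y b assume "x \<in> Y"
    then show "x \<in> U" using Y by auto
    show "e * ?f x y (flip x b) = - (e * ?f x y b)"
      by (auto simp: occ_sign_flip occ_sign_flip_other tidy_def)
  qed
  finally show ?thesis by simp
qed

lemma union_bound_N: "p \<le> 2 * exp (- 4 * N) \<Longrightarrow> exp N * (exp N * p) \<le> exp (- \<delta> * N / 2000)"
  "p \<le> 2 * exp (- 4 * N) \<Longrightarrow> exp N * p \<le> exp (- \<delta> * N / 2000)"
proof -
  assume p: "p \<le> 2 * exp (- 4 * N)"
  have "exp N * (exp N * p) \<le> exp N * (exp N * (2 * exp (- 4 * N)))" using p by simp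
  also have "\<dots> \<le> exp N * (exp N * (exp 1 * exp (- 4 * N)))"
    using exp_ge_add_one_self[of 1] by simp
  also have "\<dots> = exp (1 - 2 * N)" by (simp add: exp_add[symmetric])
  also have "\<dots> \<le> exp (- \<delta> * N / 2000)"
    unfolding exp_le_cancel_iff using N_ge by linarith
  finally show "exp N * (exp N * p) \<le> exp (- \<delta> * N / 2000)" .
  have "exp N * p \<le> exp N * (2 * exp (- 4 * N))" using p by simp
  also have "\<dots> \<le> exp N * (exp 1 * exp (- 4 * N))"
    using exp_ge_add_one_self[of 1] by simp
  also have "\<dots> = exp (1 - 3 * N)" by (simp add: exp_add[symmetric])
  also have "\<dots> \<le> exp (- \<delta> * N / 2000)"
    unfolding exp_le_cancel_iff using N_ge by linarith
  finally show "exp N * p \<le> exp (- \<delta> * N / 2000)" .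
qed

lemma prb_signed:
  assumes e: "\<bar>e\<bar> = 1"
  shows "prb (\<Union>Y\<in>Pow U. {\<Phi>. (\<Sum>C\<in>\<Phi>. lift (\<lambda>b. e * signed_sum Y b) C) \<ge> \<delta>\<^sup>2 * N / 10 ^ 5})
    \<le> exp (- \<delta> * N / 2000)"
proof (rule order_trans[OF prb_Ex_subset_le union_bound_N(2)])
  fix Y assume Y: "Y \<subseteq> U"
  then have "finite Y" using finite_U finite_subset by blast
  then show "prb {\<Phi>. (\<Sum>C\<in>\<Phi>. lift (\<lambda>b. e * signed_sum Y b) C) \<ge> \<delta>\<^sup>2 * N / 10 ^ 5} \<le> 2 * exp (- 4 * N)"
    using e by (intro prb_centered signed_sum_centered Y) (simp add: abs_mult abs_signed_sum_le)
qed simp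

lemma prb_pair:
  assumes e: "\<bar>e\<bar> = 1"
  shows "prb (\<Union>Y\<in>Pow U. \<Union>Z\<in>Pow U. {\<Phi>. (\<Sum>C\<in>\<Phi>. lift (\<lambda>b. e * pair_sum Y Z b) C) \<ge> \<delta>\<^sup>2 * N / 10 ^ 5})
    \<le> exp (- \<delta> * N / 2000)"
proof (rule order_trans[OF prb_Ex_subset_le[OF prb_Ex_subset_le] union_bound_N(1)])
  fix Y Z assume Y: "Y \<subseteq> U" and "Z \<subseteq> U"
  then have "finite Y" "finite Z" using finite_U finite_subset by blast+
  then show "prb {\<Phi>. (\<Sum>C\<in>\<Phi>. lift (\<lambda>b. e * pair_sum Y Z b) C) \<ge> \<delta>\<^sup>2 * N / 10 ^ 5} \<le> 2 * exp (- 4 * N)"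
    using e by (intro prb_centered pair_sum_centered Y) (simp add: abs_mult abs_pair_sum_le)
qed simp

end

section \<open>Higher-order terms and expansion\<close>

context long_clause_regime
begin

definition excess_sum :: "nat set \<Rightarrow> nat set \<Rightarrow> clause \<Rightarrow> real" where
  "excess_sum Y T b = (\<Sum>x\<in>Y. if tidy b \<and> 2 * card (clause_vars b \<inter> T) < length b \<and> x \<in> clause_vars b
     then excess (\<lambda>y. of_bool (y \<in> T) + 2 * \<delta>) (clause_vars b - {x}) / 2 ^ length b else 0)"

lemma excess_sum_eq:
  assumes "finite Y" "tidy b" "2 * card (clause_vars b \<inter> T) < length b"
  shows "excess_sum Y T b = (\<Sum>x\<in>Y \<inter> clause_vars b.
     excess (\<lambda>y. of_bool (y \<in> T) + 2 * \<delta>) (clause_vars b - {x}) / 2 ^ length b)"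
  unfolding excess_sum_def using assms by (simp add: sum.inter_restrict)

lemma excess_sum_eq_0:
  "\<not> (tidy b \<and> 2 * card (clause_vars b \<inter> T) < length b) \<Longrightarrow> excess_sum Y T b = 0"
  unfolding excess_sum_def by (intro sum.neutral) auto

lemma excess_sum_nonneg: "0 \<le> excess_sum Y T b"
  unfolding excess_sum_def using delta_eps
  by (intro sum_nonneg) (auto intro!: divide_nonneg_pos excess_nonneg)

text \<open>As \<open>T\<close> covers less than half of the clause, the product is at most (1 + 2
  \<delta>)^L 2^(L/2), against the denominator 2^L.\<close>

lemma excess_sum_small:
  assumes Y: "finite Y"
  shows "excess_sum Y T b \<le> \<delta> ^ 8"
proof (cases "tidy b \<and> 2 * card (clause_vars b \<inter> T) < length b")
  case True
  let ?L = "real (length b)" and ?V = "clause_vars b"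
  let ?c = "card (?V \<inter> T)"
  have d: "0 < \<delta>" "\<delta> \<le> 1 / 200"
    using delta_eps delta_small by (auto intro: order_trans)
  have V: "card ?V = length b" using True by (simp add: tidy_def card_clause_vars)
  have L: "?L \<ge> 10 ^ 7" using True by (intro tidy_length) simp
  have single: "excess (\<lambda>y. of_bool (y \<in> T) + 2 * \<delta>) (?V - {x}) / 2 ^ length b
      \<le> exp (?L / 100) * exp (- 1 / 3 * ?L)" for x
  proof -
    have "excess (\<lambda>y. of_bool (y \<in> T) + 2 * \<delta>) (?V - {x}) \<le> (\<Prod>y\<in>?V - {x}. 1 + (of_bool (y \<in> T) + 2 * \<delta>))"
    proof -
      have "0 \<le> (\<Sum>y\<in>?V - {x}. of_bool (y \<in> T) + 2 * \<delta>)" using d by (intro sum_nonneg) auto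
      then show ?thesis unfolding excess_def by linarith
    qed
    also have "\<dots> \<le> (\<Prod>y\<in>?V. 1 + (of_bool (y \<in> T) + 2 * \<delta>))"
      using d by (intro prod_mono2) auto
    also have "\<dots> \<le> (\<Prod>y\<in>?V. (1 + 2 * \<delta>) * (if y \<in> T then 2 else 1))"
      using d by (intro prod_mono) auto
    also have "\<dots> = (1 + 2 * \<delta>) ^ length b * 2 ^ ?c"
      by (simp add: prod.distrib V prod.If_cases Int_def)
    finally have "excess (\<lambda>y. of_bool (y \<in> T) + 2 * \<delta>) (?V - {x}) / 2 ^ length b
        \<le> (1 + 2 * \<delta>) ^ length b * 2 ^ ?c / 2 ^ length b" by (intro divide_right_mono) auto
    also have "\<dots> = (1 + 2 * \<delta>) ^ length b * (1 / 2 ^ (length b - ?c))"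
      using True by (simp add: power_diff)
    also have "\<dots> \<le> exp (?L / 100) * exp (- 1 / 3 * ?L)"
    proof (rule mult_mono)
      have "(1 + 2 * \<delta>) ^ length b \<le> exp (2 * \<delta>) ^ length b"
        using d exp_ge_add_one_self by (intro power_mono) auto
      also have "\<dots> = exp (?L * (2 * \<delta>))" by (simp add: exp_of_nat_mult[symmetric])
      also have "\<dots> \<le> exp (?L / 100)"
        using d mult_left_mono[of "2 * \<delta>" "1 / 100" ?L] by simp
      finally show "(1 + 2 * \<delta>) ^ length b \<le> exp (?L / 100)" .
      have "1 / 2 ^ (length b - ?c) \<le> exp (- 2 / 3 * real (length b - ?c))" by (rule exp_half_power)
      also have "\<dots> \<le> exp (- 1 / 3 * ?L)" using True by simp
      finally show "1 / 2 ^ (length b - ?c) \<le> exp (- 1 / 3 * ?L)" .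
    qed auto
    finally show ?thesis .
  qed
  have "excess_sum Y T b \<le> \<bar>excess_sum Y T b\<bar>" by simp
  also have "\<dots> \<le> ?L * (exp (?L / 100) * exp (- 1 / 3 * ?L))"
    unfolding excess_sum_eq[OF Y conjunct1[OF True] conjunct2[OF True]]
  proof (rule abs_sum_mult_card_le)
    fix x
    have "0 \<le> excess (\<lambda>y. of_bool (y \<in> T) + 2 * \<delta>) (?V - {x})"
      using d by (intro excess_nonneg) auto
    then show "\<bar>excess (\<lambda>y. of_bool (y \<in> T) + 2 * \<delta>) (?V - {x}) / 2 ^ length b\<bar>
        \<le> exp (?L / 100) * exp (- 1 / 3 * ?L)" using single[of x] by simp
  qed (use card_Int_clause_vars_le[of Y b] in auto)
  also have "?L \<le> exp (?L / 10) * exp (?L / 100)"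
  proof -
    have "?L \<le> (1 + ?L / 10) * 10" by simp
    also have "\<dots> \<le> exp (?L / 10) * exp (?L / 100)"
    proof (intro mult_mono exp_ge_add_one_self)
      show "10 \<le> exp (?L / 100)"
        using L exp_ge_add_one_self[of "?L / 100"] by (rule_tac order_trans[of _ "1 + ?L / 100"]) auto
    qed auto
    finally show ?thesis .
  qed
  then have "?L * (exp (?L / 100) * exp (- 1 / 3 * ?L))
      \<le> exp (?L / 10) * exp (?L / 100) * (exp (?L / 100) * exp (- 1 / 3 * ?L))"
    by (intro mult_right_mono) auto
  also have "\<dots> = exp (- (1 / 3 - 1 / 50 - 1 / 10) * ?L)"
    by (simp add: exp_add[symmetric] algebra_simps)
  also have "\<dots> \<le> exp (- 4 / 25 * ?L)" by simp
  also have "\<dots> \<le> \<delta> ^ 8" using True by (intro tidy_length) simp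
  finally show ?thesis .
next
  case False
  then show ?thesis using delta_eps(3) by (subst excess_sum_eq_0[OF False]) simp
qed

text \<open>Two factors \<delta> come from \<open>excess_le_scaled\<close> with s = 6000 \<delta>,
  the third from the smallness of \<open>Y\<close>: the summation over \<open>x\<close> is absorbed
  by adding \<open>of_bool (y \<in> Y) / (8 * \<delta>)\<close> to the weight of each
  variable.\<close>

lemma excess_sum_le_prod:
  assumes Y: "finite Y"
  shows "excess_sum Y T b \<le> 144 * 10 ^ 6 * \<delta> ^ 3 * prod_list (map (\<lambda>l.
    (1 + (of_bool (fst l \<in> T) + 2 * \<delta>) / (6000 * \<delta>)) / 2 + of_bool (fst l \<in> Y) / (8 * \<delta>)) b)"
    (is "_ \<le> ?K * prod_list (map (\<lambda>l. ?g (fst l)) b)")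
proof -
  have d: "0 < \<delta>" "6000 * \<delta> \<le> 1"
    using delta_eps delta_small by (auto intro: order_trans)
  have g0: "0 \<le> ?g y" for y using d by simp
  show ?thesis
  proof (cases "tidy b \<and> 2 * card (clause_vars b \<inter> T) < length b")
    case True
    let ?V = "clause_vars b" and ?u = "\<lambda>y. of_bool (y \<in> T) + 2 * \<delta>"
    let ?G = "\<lambda>y. (1 + ?u y / (6000 * \<delta>)) / 2" and ?c = "\<lambda>x. of_bool (x \<in> Y) / (8 * \<delta>)"
    have dist: "distinct (map fst b)" using True by (simp add: tidy_def)
    have V: "card ?V = length b" by (rule card_clause_vars[OF dist])
    have "excess_sum Y T b = (\<Sum>x\<in>Y \<inter> ?V. excess ?u (?V - {x}) / 2 ^ length b)"
      using True by (intro excess_sum_eq[OF Y]) auto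
    also have "\<dots> \<le> (\<Sum>x\<in>Y \<inter> ?V. ?K * (?c x * (\<Prod>y\<in>?V - {x}. ?G y)))"
    proof (rule sum_mono)
      fix x assume x: "x \<in> Y \<inter> ?V"
      then have L: "length b = Suc (card (?V - {x}))" using V card_Suc_Diff1[of ?V x] by simp
      have "excess ?u (?V - {x}) \<le> (6000 * \<delta>)\<^sup>2 * (\<Prod>y\<in>?V - {x}. 1 + ?u y / (6000 * \<delta>))"
        using d by (intro excess_le_scaled) auto
      then have "excess ?u (?V - {x}) / 2 ^ length b
          \<le> (6000 * \<delta>)\<^sup>2 * (\<Prod>y\<in>?V - {x}. 1 + ?u y / (6000 * \<delta>)) / 2 ^ length b"
        by (intro divide_right_mono) auto
      also have "\<dots> = (6000 * \<delta>)\<^sup>2 / 2 * (\<Prod>y\<in>?V - {x}. ?G y)"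
        unfolding L prod_dividef by (simp add: field_simps)
      \<comment> \<open>The constant 144 * 10^6 is 8 * 6000^2 / 2.\<close>
      also have "(6000 * \<delta>)\<^sup>2 / 2 = ?K * ?c x"
        using x d by (simp add: field_simps power2_eq_square power3_eq_cube)
      finally show "excess ?u (?V - {x}) / 2 ^ length b \<le> ?K * (?c x * (\<Prod>y\<in>?V - {x}. ?G y))"
        by (simp only: mult.assoc)
    qed
    also have "\<dots> \<le> (\<Sum>x\<in>?V. ?K * (?c x * (\<Prod>y\<in>?V - {x}. ?G y)))"
      using d by (intro sum_mono2) (auto intro!: mult_nonneg_nonneg divide_nonneg_pos prod_nonneg add_nonneg_nonneg)
    also have "\<dots> = ?K * (\<Sum>x\<in>?V. ?c x * (\<Prod>y\<in>?V - {x}. ?G y))" by (simp only: sum_distrib_left)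
    also have "\<dots> \<le> ?K * (\<Prod>y\<in>?V. ?G y + ?c y)"
      using d by (intro mult_left_mono sum_prod_remove_le) auto
    also have "(\<Prod>y\<in>?V. ?G y + ?c y) = prod_list (map (\<lambda>l. ?g (fst l)) b)"
      using prod_list_clause_vars[OF dist, of ?g] by simp
    finally show ?thesis .
  next
    case False
    have "0 \<le> prod_list (map (\<lambda>l. ?g (fst l)) b)" using g0 by (induction b) auto
    then show ?thesis using d by (subst excess_sum_eq_0[OF False]) simp
  qed
qed

text \<open>The moment bound per unit of l is of order (\<delta>^3 / \<epsilon>) N = \<delta>^2
  \<epsilon> N, below the threshold by a factor of order \<epsilon>. As each weight is at most
  \<delta>^8, l = 1 / \<delta>^8 is admissible and the exponent is of order N / \<delta>^6.\<close>

lemma prb_excess: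
  "prb (\<Union>Y\<in>Pow U. \<Union>T\<in>Pow U. {\<Phi>. real (card Y) \<le> \<delta> * N / 500 \<and> real (card T) \<le> \<delta> * N
      \<and> (\<Sum>C\<in>\<Phi>. lift (excess_sum Y T) C) \<ge> \<delta>\<^sup>2 * N / 10 ^ 5}) \<le> exp (- \<delta> * N / 2000)"
proof (rule order_trans[OF prb_Ex_subset_le[OF prb_Ex_subset_le] union_bound_N(1)])
  fix Y T assume Y: "Y \<subseteq> U" and T: "T \<subseteq> U"
  have d: "0 < \<delta>" "\<delta> \<le> 1" "0 < \<epsilon>" "\<epsilon> \<le> 1 / 10 ^ 16"
    using delta_eps(2,3) delta_small eps_small by (auto intro: order_trans)
  show "prb {\<Phi>. real (card Y) \<le> \<delta> * N / 500 \<and> real (card T) \<le> \<delta> * N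
      \<and> (\<Sum>C\<in>\<Phi>. lift (excess_sum Y T) C) \<ge> \<delta>\<^sup>2 * N / 10 ^ 5} \<le> 2 * exp (- 4 * N)"
  proof (cases "real (card Y) \<le> \<delta> * N / 500 \<and> real (card T) \<le> \<delta> * N")
    case True
    have finY: "finite Y" using Y finite_U finite_subset by blast
    let ?g = "\<lambda>y. (1 + (of_bool (y \<in> T) + 2 * \<delta>) / (6000 * \<delta>)) / 2 + of_bool (y \<in> Y) / (8 * \<delta>)"
    let ?K = "144 * 10 ^ 6 * \<delta> ^ 3" and ?l = "1 / \<delta> ^ 8"
    have card_ind: "(\<Sum>y\<in>U. of_bool (y \<in> A)) = real (card A)" if "A \<subseteq> U" for A
      using that finite_U by (simp add: of_bool_def sum.If_cases Int_absorb1)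
    \<comment> \<open>The scales 6000 and 8 are balanced: \<open>T\<close> together with the term 2
      \<delta> adds at most N / 4000, and so does \<open>Y\<close>.\<close>
    have gs: "(\<Sum>y\<in>U. ?g y) \<le> N * (1 + 1 / 1000) / 2"
    proof -
      have "(\<Sum>y\<in>U. ?g y) = (N + (\<Sum>y\<in>U. of_bool (y \<in> T)) / (6000 * \<delta>) + 2 * \<delta> * N / (6000 * \<delta>)) / 2
          + (\<Sum>y\<in>U. of_bool (y \<in> Y)) / (8 * \<delta>)"
        by (simp add: sum.distrib sum_divide_distrib[symmetric] add_divide_distrib N_def)
      also have "\<dots> = (N + real (card T) / (6000 * \<delta>) + 2 * \<delta> * N / (6000 * \<delta>)) / 2 + real (card Y) / (8 * \<delta>)"
        by (simp only: card_ind[OF T] card_ind[OF Y])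
      also have "\<dots> \<le> (N + (\<delta> * N) / (6000 * \<delta>) + 2 * \<delta> * N / (6000 * \<delta>)) / 2 + (\<delta> * N / 500) / (8 * \<delta>)"
        using True d by (intro add_mono divide_right_mono order_refl) auto
      also have "\<dots> = N * (1 + 1 / 1000) / 2" using d by (simp add: field_simps)
      finally show ?thesis .
    qed
    have "prb {\<Phi>. (\<Sum>C\<in>\<Phi>. lift (excess_sum Y T) C) \<ge> \<delta>\<^sup>2 * N / 10 ^ 5}
        \<le> 2 * exp (4 * N * ?l * ?K * exp (\<kappa> * (1 / 1000)) - ?l * (\<delta>\<^sup>2 * N / 10 ^ 5))"
    proof (rule prb_positive_ge[OF excess_sum_le_prod[OF finY] _ _ _ gs])
      fix b
      have "?l * excess_sum Y T b \<le> ?l * \<delta> ^ 8"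
        using d by (intro mult_left_mono excess_sum_small finY) auto
      also have "\<dots> = 1" using d by simp
      finally show "0 \<le> excess_sum Y T b \<and> ?l * excess_sum Y T b \<le> 1"
        using excess_sum_nonneg by simp
    qed (use d in auto)
    also have "4 * N * ?l * ?K * exp (\<kappa> * (1 / 1000)) - ?l * (\<delta>\<^sup>2 * N / 10 ^ 5) \<le> - 4 * N"
    proof -
      have e1: "exp (\<kappa> * (1 / 1000)) = 1 / \<epsilon>" using exp_kappa by simp
      have "576 * 10 ^ 6 * \<epsilon> + 4 * \<delta> ^ 6 \<le> 1 / 10 ^ 5"
      proof -
        have "\<delta> ^ 6 \<le> \<delta> ^ 1" using d by (intro power_decreasing) auto
        then show ?thesis using d delta_small by simp
      qed
      moreover define P where "P = N / \<delta> ^ 6"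
      moreover have "0 \<le> P" using N_nonneg d by (simp add: P_def)
      ultimately have "(576 * 10 ^ 6 * \<epsilon> + 4 * \<delta> ^ 6) * P \<le> 1 / 10 ^ 5 * P"
        by (intro mult_right_mono)
      then have "576 * 10 ^ 6 * (\<epsilon> * P) + 4 * (\<delta> ^ 6 * P) \<le> P / 10 ^ 5"
        by (simp add: algebra_simps)
      moreover have P: "\<delta> ^ 6 * P = N" "?l * (\<delta>\<^sup>2 * N / 10 ^ 5) = P / 10 ^ 5"
        using d by (simp_all add: P_def field_simps flip: power_add)
      moreover have e2: "4 * N * ?l * ?K * (1 / \<epsilon>) = 576 * 10 ^ 6 * (\<epsilon> * P)"
        unfolding P_def delta_eps(1) using d by (simp add: field_simps flip: power_mult power_add power_Suc)
      ultimately show ?thesis unfolding e1 e2 P by simp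
    qed
    finally show ?thesis using True by simp
  next
    case False
    then have "{\<Phi>. real (card Y) \<le> \<delta> * N / 500 \<and> real (card T) \<le> \<delta> * N
      \<and> (\<Sum>C\<in>\<Phi>. lift (excess_sum Y T) C) \<ge> \<delta>\<^sup>2 * N / 10 ^ 5} = {}" by blast
    then show ?thesis by (simp only: measure_empty) simp
  qed
qed simp

definition residual_len :: "cnf \<Rightarrow> real" where
  "residual_len D = (\<Sum>C\<in>D. real (length (rest C)))"

definition residual_vars :: "cnf \<Rightarrow> nat set" where
  "residual_vars D = (\<Union>C\<in>D. clause_vars (rest C))"

text \<open>Stated for original clauses, so that two clauses with the same residue count twice in
  \<open>residual_len\<close>; this also makes duplicates detectable.\<close>

definition crowded :: "cnf set" where
  "crowded = {D. (\<forall>C\<in>D. alive C \<and> tidy (rest C)) \<and> residual_len D \<le> 2 * \<delta> * N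
     \<and> 49 / 50 * residual_len D > real (card (residual_vars D)) + \<delta> * N / 1000}"

lemma card_residual_vars_le: "finite D \<Longrightarrow> real (card (residual_vars D)) \<le> residual_len D"
proof -
  assume D: "finite D"
  have "card (residual_vars D) \<le> (\<Sum>C\<in>D. card (clause_vars (rest C)))"
    unfolding residual_vars_def by (rule card_UN_le[OF D])
  also have "\<dots> \<le> (\<Sum>C\<in>D. length (rest C))"
    using card_Int_clause_vars_le[of UNIV] by (intro sum_mono) simp
  finally show ?thesis unfolding residual_len_def by (simp flip: of_nat_sum)
qed

lemma prb_crowded: "prb {\<Phi>. \<exists>D\<in>crowded. D \<subseteq> \<Phi>} \<le> exp (- \<delta> * N / 2000)"
proof -
  have d: "0 < \<delta>" "\<delta> \<le> 1 / 6" "2 * \<delta> \<le> (1 / 8) ^ 50" "\<delta> \<le> 1 / 4000"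
  proof -
    show "0 < \<delta>" by (rule delta_eps)
    show "\<delta> \<le> 1 / 6" "2 * \<delta> \<le> (1 / 8) ^ 50" "\<delta> \<le> 1 / 4000"
      using delta_small(1) by (simp_all add: power_divide)
  qed
  define g where "g = 1 / (2 * \<delta>)"
  have g: "g \<ge> 3" using d by (simp add: g_def field_simps)
  let ?M = "clauses k n"
  let ?ok = "\<lambda>D. (\<forall>C\<in>D. alive C \<and> tidy (rest C)) \<and> residual_len D \<le> 2 * \<delta> * N"
  (* An exponential tilt of the number of coincidences among the variables of D: a literal of a
     further clause hits a variable of D with probability at most 2 * \<delta> = 1 / g, so on average
     adding a clause multiplies F by at most ?s. *)
  define F where "F D = (if ?ok D then g powr (49 / 50 * residual_len D - real (card (residual_vars D))) else 0)" for D
  let ?s = "exp (\<kappa> * (- 1 / 2)) / 2 ^ k"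
  \<comment> \<open>A literal on a fresh variable multiplies \<open>F\<close> by g powr (- 1/50).
    The slack 49/50 in the expansion is there to make this small; it needs 2 \<delta> \<le>
    8^(-50).\<close>
  have small: "g powr (- 1 / 50) \<le> 1 / 8"
  proof -
    have "g powr (- 1 / 50) = (2 * \<delta>) powr (1 / 50)"
      using d by (simp add: g_def powr_minus_divide powr_divide)
    also have "\<dots> \<le> ((1 / 8) ^ 50) powr (1 / 50)" using d by (intro powr_mono2) auto
    also have "\<dots> = ((1 / 8) powr real 50) powr (1 / 50)" by (subst powr_realpow) auto
    also have "\<dots> = 1 / 8" unfolding powr_powr by simp
    finally show ?thesis .
  qed
  have step: "(\<Sum>C\<in>?M - D. F (insert C D)) \<le> ?s * real (card ?M) * F D" if DM: "D \<subseteq> ?M" for D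
  proof -
    have finD: "finite D" using DM finite_clauses finite_subset by blast
    have len_insert: "residual_len (insert C D) = real (length (rest C)) + residual_len D" if "C \<notin> D" for C
      using that finD by (simp add: residual_len_def)
    show ?thesis
    proof (cases "?ok D")
      case False
      have "F (insert C D) = 0" if "C \<in> ?M - D" for C
      proof -
        have "\<not> ?ok (insert C D)" using False len_insert[of C] that by auto
        then show ?thesis by (simp only: F_def if_False)
      qed
      then show ?thesis using False by (simp add: F_def)
    next
      case True
      let ?V = "residual_vars D"
      have finV: "finite ?V" using finD by (simp add: residual_vars_def)
      define h where "h y = (if y \<in> ?V then g powr (49 / 50) else g powr (- 1 / 50))" for y
      have VU: "?V \<subseteq> U"
        using DM rest_in by (fastforce simp: residual_vars_def clause_vars_def)
      \<comment> \<open>At most 2 \<delta> N old variables have weight g powr (49/50); as 2 \<delta>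
        g = 1, they contribute no more than N g powr (- 1/50), the bound for fresh ones. Each kind
        gives at most N / 8, hence y = - 1/2.\<close>
      have hs: "(\<Sum>y\<in>U. h y) \<le> N * (1 + - 1 / 2) / 2"
      proof -
        have "(\<Sum>y\<in>U. h y) \<le> (\<Sum>y\<in>U. (if y \<in> ?V then g powr (49 / 50) else 0) + g powr (- 1 / 50))"
          by (intro sum_mono) (auto simp: h_def)
        also have "\<dots> = real (card ?V) * g powr (49 / 50) + N * g powr (- 1 / 50)"
          using finite_U VU by (simp add: sum.distrib sum.If_cases Int_absorb1 N_def)
        also have "real (card ?V) * g powr (49 / 50) \<le> (2 * \<delta> * N) * g powr (49 / 50)"
          using card_residual_vars_le[OF finD] True by (intro mult_right_mono) auto
        also have "g powr (49 / 50) = g * g powr (- 1 / 50)"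
          using g by (simp add: powr_mult_base)
        also have "(2 * \<delta> * N) * (g * g powr (- 1 / 50)) = N * g powr (- 1 / 50)"
          using d by (simp add: g_def)
        also have "N * g powr (- 1 / 50) + N * g powr (- 1 / 50) \<le> N * (1 / 8) + N * (1 / 8)"
          using small N_nonneg by (intro add_mono mult_left_mono) auto
        finally show ?thesis by simp
      qed
      have "F (insert C D) \<le> F D * lift (\<lambda>b. prod_list (map (\<lambda>l. h (fst l)) b)) C" if C: "C \<in> ?M - D" for C
      proof (cases "alive C \<and> tidy (rest C) \<and> ?ok (insert C D)")
        case ok: True
        let ?b = "rest C"
        let ?W = "clause_vars ?b"
        have dist: "distinct (map fst ?b)" using ok by (simp add: tidy_def)
        have "prod_list (map (\<lambda>l. h (fst l)) ?b) = (\<Prod>y\<in>?W. h y)"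
          by (rule prod_list_clause_vars[OF dist])
        also have "\<dots> = (g powr (49 / 50)) ^ card (?W \<inter> ?V) * (g powr (- 1 / 50)) ^ card (?W - ?V)"
          unfolding h_def by (subst prod.If_cases) (auto simp: Diff_eq)
        also have "\<dots> = g powr (49 / 50 * real (card (?W \<inter> ?V)) - 1 / 50 * real (card (?W - ?V)))"
        proof -
          have pow: "(g powr a) ^ c = g powr (a * real c)" for a c
            using g by (simp add: powr_power mult.commute)
          show ?thesis unfolding pow powr_add[symmetric] by simp
        qed
        finally have v: "prod_list (map (\<lambda>l. h (fst l)) ?b)
            = g powr (49 / 50 * real (card (?W \<inter> ?V)) - 1 / 50 * real (card (?W - ?V)))" .
        have "length ?b = card (?W \<inter> ?V) + card (?W - ?V)"
          unfolding card_clause_vars[OF dist, symmetric] by (subst card_Int_Diff[of ?W ?V]) auto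
        moreover have "residual_vars (insert C D) = ?V \<union> (?W - ?V)" by (auto simp: residual_vars_def)
        then have "card (residual_vars (insert C D)) = card ?V + card (?W - ?V)"
          using card_Un_disjoint[OF finV, of "?W - ?V"] by (simp only:) auto
        ultimately have "49 / 50 * residual_len (insert C D) - real (card (residual_vars (insert C D)))
          = (49 / 50 * residual_len D - real (card ?V))
            + (49 / 50 * real (card (?W \<inter> ?V)) - 1 / 50 * real (card (?W - ?V)))"
          using len_insert[of C] C by (simp add: field_simps)
        then have "F (insert C D) = F D * prod_list (map (\<lambda>l. h (fst l)) ?b)"
          unfolding v using True ok by (simp add: F_def powr_add)
        then show ?thesis using ok by (simp add: lift_def)
      next
        case False
        have "0 \<le> prod_list (map (\<lambda>l. h (fst l)) b)" for b :: clause
          by (induction b) (auto simp: h_def)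
        then have "0 \<le> lift (\<lambda>b. prod_list (map (\<lambda>l. h (fst l)) b)) C" by (simp add: lift_def)
        moreover have "F (insert C D) = 0" using False by (auto simp: F_def)
        ultimately show ?thesis by (simp add: F_def)
      qed
      then have "(\<Sum>C\<in>?M - D. F (insert C D))
          \<le> (\<Sum>C\<in>?M - D. F D * lift (\<lambda>b. prod_list (map (\<lambda>l. h (fst l)) b)) C)"
        by (intro sum_mono) auto
      also have "\<dots> \<le> (\<Sum>C\<in>?M. F D * lift (\<lambda>b. prod_list (map (\<lambda>l. h (fst l)) b)) C)"
      proof (rule sum_mono2)
        fix C
        have "0 \<le> prod_list (map (\<lambda>l. h (fst l)) b)" for b :: clause
          by (induction b) (auto simp: h_def)
        then show "0 \<le> F D * lift (\<lambda>b. prod_list (map (\<lambda>l. h (fst l)) b)) C" by (simp add: lift_def F_def)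
      qed (auto simp: finite_clauses)
      also have "\<dots> = F D * (\<Sum>C\<in>?M. lift (\<lambda>b. prod_list (map (\<lambda>l. h (fst l)) b)) C)"
        by (simp only: sum_distrib_left)
      also have "\<dots> \<le> F D * (real (card ?M) * (1 * exp (\<kappa> * (- 1 / 2)) / 2 ^ k))"
        by (intro mult_left_mono sum_lift_le[OF _ _ _ hs]) (auto simp: h_def F_def)
      finally show ?thesis by (simp add: mult_ac)
    qed
  qed
  have "m \<le> 2 * m\<^sup>2" by (cases m) (auto simp: power2_eq_square)
  then have mM: "m \<le> card ?M" using m_small by linarith
  have "prb {\<Phi>. \<exists>D\<in>crowded. D \<subseteq> \<Phi>} \<le> exp (real m * ?s) * F {} / g powr (\<delta> * N / 1000)"
    unfolding random_cnf_eq
  proof (rule prob_subset_in_le[OF finite_clauses card_pos mM _ _ step])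
    show "0 \<le> F D" for D by (simp add: F_def)
    show "g powr (\<delta> * N / 1000) \<le> F D" if "D \<in> crowded" for D
    proof -
      have ok: "?ok D" and "49 / 50 * residual_len D > real (card (residual_vars D)) + \<delta> * N / 1000"
        using that unfolding crowded_def by blast+
      then have "\<delta> * N / 1000 \<le> 49 / 50 * residual_len D - real (card (residual_vars D))" by linarith
      then have "g powr (\<delta> * N / 1000) \<le> g powr (49 / 50 * residual_len D - real (card (residual_vars D)))"
        using g by (intro powr_mono) auto
      then show ?thesis using ok by (simp add: F_def)
    qed
  qed (use g in auto)
  also have "F {} \<le> 1" using g by (simp add: F_def residual_len_def residual_vars_def)
  then have "exp (real m * ?s) * F {} / g powr (\<delta> * N / 1000) \<le> exp (real m * ?s) * 1 / g powr (\<delta> * N / 1000)"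
    by (intro divide_right_mono mult_left_mono) auto
  also have "\<dots> \<le> exp (2 * N * exp (\<kappa> * (- 1 / 2))) * 1 / exp (\<delta> * N / 1000)"
  proof (intro frac_le mult_right_mono)
    have "real m * ?s \<le> (2 * N * 2 ^ k) * ?s" using m_le by (intro mult_right_mono) auto
    then show "exp (real m * ?s) \<le> exp (2 * N * exp (\<kappa> * (- 1 / 2)))" by simp
    have "exp (\<delta> * N / 1000) = exp 1 powr (\<delta> * N / 1000)" by (simp add: powr_def)
    also have "\<dots> \<le> g powr (\<delta> * N / 1000)"
      using g deltaN exp_le by (intro powr_mono2) auto
    finally show "exp (\<delta> * N / 1000) \<le> g powr (\<delta> * N / 1000)" .
  qed auto
  also have "\<dots> = exp (2 * N * exp (\<kappa> * (- 1 / 2)) - \<delta> * N / 1000)" by (simp add: exp_diff)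
  also have "\<dots> \<le> exp (- \<delta> * N / 2000)"
  proof -
    have "exp (\<kappa> * (- 1 / 2)) \<le> exp (2 * (- \<kappa> / 500))" using kappa_large by simp
    also have "\<dots> = \<delta> * \<delta>" by (simp add: \<delta>_def exp_add[symmetric])
    also have "\<dots> \<le> (1 / 4000) * \<delta>" using d by (intro mult_right_mono) auto
    finally have "exp (\<kappa> * (- 1 / 2)) * (2 * N) \<le> (1 / 4000) * \<delta> * (2 * N)"
      using N_nonneg by (intro mult_right_mono) auto
    then show ?thesis by (simp add: algebra_simps)
  qed
  finally show ?thesis .
qed

end

section \<open>Quasirandomness of the residual formula\<close>

context long_clause_regime
begin

lemma tidy_long:
  assumes b: "tidy b" and j: "length b \<le> Suc (2 * j)"
  shows "(3 / 5) ^ j \<le> \<delta> ^ 8"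
proof -
  let ?L = "real (length b)"
  have L: "?L \<ge> 10 ^ 7" by (rule tidy_length[OF b])
  have "(3 / 5 :: real) ^ j \<le> exp (- 2 / 5) ^ j"
    using exp_ge_add_one_self[of "- 2 / 5"] by (intro power_mono) auto
  also have "\<dots> = exp (- 2 / 5 * real j)" by (simp add: exp_of_nat_mult[symmetric] mult.commute)
  also have "\<dots> \<le> exp (- 4 / 25 * ?L)" using j L by simp
  also have "\<dots> \<le> \<delta> ^ 8" by (rule tidy_length[OF b])
  finally show ?thesis .
qed

definition shrunk :: "cnf \<Rightarrow> cnf" where
  "shrunk \<Phi> = rest ` {C \<in> \<Phi>. alive C}"

definition parents :: "cnf \<Rightarrow> clause \<Rightarrow> cnf" where
  "parents \<Phi> b = {C \<in> \<Phi>. alive C \<and> rest C = b}"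

text \<open>A unique parent makes sums over residual clauses agree with sums over original clauses,
  although equal residual clauses are merged.\<close>

definition good :: "cnf \<Rightarrow> cnf" where
  "good \<Phi> = {b \<in> shrunk \<Phi>. tidy b \<and> card (parents \<Phi> b) = 1}"

definition junk_vars :: "cnf \<Rightarrow> nat set" where
  "junk_vars \<Phi> = \<Union> (clause_vars ` (shrunk \<Phi> - good \<Phi>))"

definition bad :: "cnf set" where
  "bad = {\<Phi>. (\<Sum>C\<in>\<Phi>. lift weight_cap C) \<ge> N / (1000 * \<delta>\<^sup>2)}
    \<union> {\<Phi>. (\<Sum>C\<in>\<Phi>. lift short_length C) \<ge> \<delta> * N / 1000}
    \<union> {\<Phi>. (\<Sum>C\<in>\<Phi>. if distinct (map fst C) then 0 else real k) \<ge> \<delta> * N / 1000}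
    \<union> {\<Phi>. \<exists>D\<in>crowded. D \<subseteq> \<Phi>}
    \<union> (\<Union>e\<in>{1, -1}. \<Union>Y\<in>Pow U. {\<Phi>. (\<Sum>C\<in>\<Phi>. lift (\<lambda>b. e * signed_sum Y b) C) \<ge> \<delta>\<^sup>2 * N / 10 ^ 5})
    \<union> (\<Union>e\<in>{1, -1}. \<Union>Y\<in>Pow U. \<Union>Z\<in>Pow U.
          {\<Phi>. (\<Sum>C\<in>\<Phi>. lift (\<lambda>b. e * pair_sum Y Z b) C) \<ge> \<delta>\<^sup>2 * N / 10 ^ 5})
    \<union> (\<Union>Y\<in>Pow U. \<Union>T\<in>Pow U. {\<Phi>. real (card Y) \<le> \<delta> * N / 500 \<and> real (card T) \<le> \<delta> * N
        \<and> (\<Sum>C\<in>\<Phi>. lift (excess_sum Y T) C) \<ge> \<delta>\<^sup>2 * N / 10 ^ 5})"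

lemma prb_bad: "prb bad \<le> 12 * exp (- \<delta> * N / 2000)"
proof -
  have Un: "prb (A \<union> B) \<le> p + q" if "prb A \<le> p" "prb B \<le> q" for A B p q
    using measure_Un_le[of A "measure_pmf (random_cnf k n m)" B] that by simp
  have pm: "prb (\<Union>e\<in>{1, -1 :: real}. A e) \<le> p + p"
    if "\<And>e. \<bar>e\<bar> = 1 \<Longrightarrow> prb (A e) \<le> p" for A p
    using Un[OF that[of 1] that[of "-1"]] by simp
  let ?e = "exp (- \<delta> * N / 2000)"
  have "prb bad \<le> 2 * ?e + 2 * ?e + 2 * ?e + ?e + (?e + ?e) + (?e + ?e) + ?e"
    unfolding bad_def
    by (intro Un pm prb_heavy prb_short prb_repeat prb_crowded prb_signed prb_pair prb_excess)
  then show ?thesis by simp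
qed

context
  fixes \<Phi> :: cnf
  assumes \<Phi>: "\<Phi> \<subseteq> clauses k n" and not_bad: "\<Phi> \<notin> bad"
begin

lemma signed_sum_less:
  assumes "\<bar>e\<bar> = 1" "Y \<subseteq> U"
  shows "(\<Sum>C\<in>\<Phi>. lift (\<lambda>b. e * signed_sum Y b) C) < \<delta>\<^sup>2 * N / 10 ^ 5"
proof (rule ccontr)
  assume "\<not> ?thesis"
  moreover have "e \<in> {1, -1}" using assms by (auto simp: abs_if split: if_splits)
  ultimately have "\<Phi> \<in> (\<Union>e\<in>{1, -1}. \<Union>Y\<in>Pow U.
      {\<Phi>. (\<Sum>C\<in>\<Phi>. lift (\<lambda>b. e * signed_sum Y b) C) \<ge> \<delta>\<^sup>2 * N / 10 ^ 5})"
    using assms(2) by (intro UN_I[of e] UN_I[of Y]) auto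
  then have "\<Phi> \<in> bad" unfolding bad_def by (simp only: Un_iff simp_thms)
  then show False using not_bad by contradiction
qed

lemma pair_sum_less:
  assumes "\<bar>e\<bar> = 1" "Y \<subseteq> U" "Z \<subseteq> U"
  shows "(\<Sum>C\<in>\<Phi>. lift (\<lambda>b. e * pair_sum Y Z b) C) < \<delta>\<^sup>2 * N / 10 ^ 5"
proof (rule ccontr)
  assume "\<not> ?thesis"
  moreover have "e \<in> {1, -1}" using assms by (auto simp: abs_if split: if_splits)
  ultimately have "\<Phi> \<in> (\<Union>e\<in>{1, -1}. \<Union>Y\<in>Pow U. \<Union>Z\<in>Pow U.
      {\<Phi>. (\<Sum>C\<in>\<Phi>. lift (\<lambda>b. e * pair_sum Y Z b) C) \<ge> \<delta>\<^sup>2 * N / 10 ^ 5})"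
    using assms(2,3) by (intro UN_I[of e] UN_I[of Y] UN_I[of Z]) auto
  then have "\<Phi> \<in> bad" unfolding bad_def by (simp only: Un_iff simp_thms)
  then show False using not_bad by contradiction
qed

lemma excess_sum_less:
  assumes "Y \<subseteq> U" "T \<subseteq> U" "real (card Y) \<le> \<delta> * N / 500" "real (card T) \<le> \<delta> * N"
  shows "(\<Sum>C\<in>\<Phi>. lift (excess_sum Y T) C) < \<delta>\<^sup>2 * N / 10 ^ 5"
proof (rule ccontr)
  assume "\<not> ?thesis"
  then have "\<Phi> \<in> (\<Union>Y\<in>Pow U. \<Union>T\<in>Pow U. {\<Phi>. real (card Y) \<le> \<delta> * N / 500 \<and> real (card T) \<le> \<delta> * N
        \<and> (\<Sum>C\<in>\<Phi>. lift (excess_sum Y T) C) \<ge> \<delta>\<^sup>2 * N / 10 ^ 5})"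
    using assms by (intro UN_I[of Y] UN_I[of T]) auto
  then have "\<Phi> \<in> bad" unfolding bad_def by (simp only: Un_iff simp_thms)
  then show False using not_bad by contradiction
qed

lemma finite_\<Phi>: "finite \<Phi>" using \<Phi> finite_clauses finite_subset by blast

lemma finite_shrunk: "finite (shrunk \<Phi>)" using finite_\<Phi> by (simp add: shrunk_def)

lemma shrunk_vars: "b \<in> shrunk \<Phi> \<Longrightarrow> clause_vars b \<subseteq> U"
  using \<Phi> rest_in by (fastforce simp: shrunk_def clause_vars_def)

lemma shrunk_length: "b \<in> shrunk \<Phi> \<Longrightarrow> length b \<le> k"
  using \<Phi> length_rest_le by (fastforce simp: shrunk_def)

lemma junk_vars_subset: "junk_vars \<Phi> \<subseteq> U"
  using shrunk_vars by (fastforce simp: junk_vars_def)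

text \<open>Merging equal residual clauses can only decrease a sum of nonnegative weights.\<close>

lemma sum_shrunk_le:
  assumes "\<And>b. 0 \<le> f b"
  shows "(\<Sum>b\<in>{b \<in> shrunk \<Phi>. p b}. f b) \<le> (\<Sum>C\<in>\<Phi>. lift (\<lambda>b. if p b then f b else 0) C)"
proof -
  have "(\<Sum>b\<in>{b \<in> shrunk \<Phi>. p b}. f b) = (\<Sum>b\<in>rest ` {C \<in> \<Phi>. alive C}. if p b then f b else 0)"
    using finite_\<Phi> by (simp add: shrunk_def sum.inter_filter)
  also have "\<dots> \<le> (\<Sum>C\<in>{C \<in> \<Phi>. alive C}. if p (rest C) then f (rest C) else 0)"
    using finite_\<Phi> assms sum_image_le[of "{C \<in> \<Phi>. alive C}" "\<lambda>b. if p b then f b else 0" rest]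
    by (simp add: comp_def)
  also have "\<dots> = (\<Sum>C\<in>\<Phi>. lift (\<lambda>b. if p b then f b else 0) C)"
    using finite_\<Phi> by (simp add: lift_def sum.inter_filter)
  finally show ?thesis .
qed

lemma card_Union_vars_le: "finite D \<Longrightarrow> real (card (\<Union> (clause_vars ` D))) \<le> (\<Sum>b\<in>D. real (length b))"
proof -
  assume D: "finite D"
  have "card (\<Union> (clause_vars ` D)) \<le> (\<Sum>b\<in>D. card (clause_vars b))" by (rule card_UN_le[OF D])
  also have "\<dots> \<le> (\<Sum>b\<in>D. length b)"
    using card_Int_clause_vars_le[of UNIV] by (intro sum_mono) simp
  finally show ?thesis by (simp flip: of_nat_sum)
qed

lemma not_crowded:
  assumes "D \<subseteq> \<Phi>" "\<And>C. C \<in> D \<Longrightarrow> alive C \<and> tidy (rest C)" "residual_len D \<le> 2 * \<delta> * N"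
  shows "49 / 50 * residual_len D \<le> real (card (residual_vars D)) + \<delta> * N / 1000"
proof -
  have "D \<notin> crowded" using not_bad assms(1) by (auto simp: bad_def)
  then show ?thesis using assms(2,3) by (auto simp: crowded_def not_less)
qed

text \<open>Two parents of each clause in a family of duplicates have \<open>2 * L\<close> literals but at most
  \<open>L\<close> variables, so \<open>not_crowded\<close> also bounds the number of duplicates.\<close>

lemma few_duplicates:
  "(\<Sum>b\<in>{b \<in> shrunk \<Phi>. tidy b \<and> card (parents \<Phi> b) \<noteq> 1}. real (length b)) \<le> \<delta> * N / 500"
    (is "sum ?len ?D \<le> _")
proof (rule ccontr)
  assume "\<not> ?thesis"
  then have "sum ?len ?D > \<delta> * N / 500" by simp
  moreover have "finite ?D" using finite_shrunk by simp
  moreover have "?len b \<le> \<delta> * N / 1000" if "b \<in> ?D" for b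
  proof -
    have "?len b \<le> real k" using shrunk_length that by simp
    then show ?thesis using k_small by linarith
  qed
  moreover have "0 \<le> \<delta> * N / 500" using deltaN by simp
  ultimately obtain D where D: "D \<subseteq> ?D" "\<delta> * N / 500 < sum ?len D" "sum ?len D \<le> \<delta> * N / 500 + \<delta> * N / 1000"
    using sum_ge_subset_sum_between[of ?D ?len "\<delta> * N / 1000" "\<delta> * N / 500"] by blast
  have finD: "finite D" using D(1) finite_shrunk finite_subset by fastforce
  have "\<exists>C1 C2. C1 \<noteq> C2 \<and> C1 \<in> parents \<Phi> b \<and> C2 \<in> parents \<Phi> b" if "b \<in> D" for b
  proof -
    have b: "b \<in> ?D" using that D(1) by (rule_tac subsetD)
    then have "b \<in> rest ` {C \<in> \<Phi>. alive C}" by (simp add: shrunk_def)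
    then obtain C where "b = rest C" "C \<in> {C \<in> \<Phi>. alive C}" by (rule imageE)
    then have C: "C \<in> parents \<Phi> b" by (simp add: parents_def)
    have "parents \<Phi> b \<noteq> {C}"
    proof
      assume "parents \<Phi> b = {C}"
      then show False using b by simp
    qed
    then obtain C' where "C' \<in> parents \<Phi> b" "C' \<noteq> C" using C by blast
    then show ?thesis using C by blast
  qed
  then obtain c1 c2 where c: "\<And>b. b \<in> D \<Longrightarrow> c1 b \<noteq> c2 b \<and> c1 b \<in> parents \<Phi> b \<and> c2 b \<in> parents \<Phi> b"
    by metis
  have r: "rest (c1 b) = b" "rest (c2 b) = b" if "b \<in> D" for b
    using c[OF that] by (auto simp: parents_def)
  have inj: "inj_on c1 D" "inj_on c2 D"
    using r by (auto intro!: inj_on_inverseI[where g = rest])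
  let ?E = "c1 ` D \<union> c2 ` D"
  have "c1 b \<noteq> c2 b'" if "b \<in> D" "b' \<in> D" for b b'
  proof
    assume eq: "c1 b = c2 b'"
    then have "b = b'" using r(1)[OF that(1)] r(2)[OF that(2)] by simp
    then show False using eq c[OF that(1)] by simp
  qed
  then have disj: "c1 ` D \<inter> c2 ` D = {}" by auto
  have len: "residual_len ?E = 2 * sum ?len D"
    unfolding residual_len_def using finD disj inj r
    by (simp add: sum.union_disjoint sum.reindex)
  have "residual_vars ?E = \<Union> (clause_vars ` D)" unfolding residual_vars_def using r by auto
  then have vars: "real (card (residual_vars ?E)) \<le> sum ?len D" using card_Union_vars_le[OF finD] by simp
  have "49 / 50 * residual_len ?E \<le> real (card (residual_vars ?E)) + \<delta> * N / 1000"
  proof (rule not_crowded)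
    show "?E \<subseteq> \<Phi>" using c by (auto simp: parents_def)
    show "alive C \<and> tidy (rest C)" if "C \<in> ?E" for C
      using that c r D(1) by (auto simp: parents_def)
    show "residual_len ?E \<le> 2 * \<delta> * N" unfolding len using D(3) deltaN by linarith
  qed
  \<comment> \<open>With total length L of \<open>D\<close> this reads 49/50 * 2 L \<le> L +
    \<delta> N / 1000, so 0.96 L \<le> \<delta> N / 1000, against L > \<delta> N / 500.\<close>
  then show False using len vars D(2) deltaN by linarith
qed

lemma card_junk_vars: "real (card (junk_vars \<Phi>)) \<le> \<delta> * N / 100"
proof -
  let ?S = "{b \<in> shrunk \<Phi>. real (length b) < \<kappa> / 10}"
  let ?R = "{b \<in> shrunk \<Phi>. \<not> distinct (map fst b)}"
  let ?D = "{b \<in> shrunk \<Phi>. tidy b \<and> card (parents \<Phi> b) \<noteq> 1}"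
  let ?len = "\<lambda>b. real (length b)"
  have S: "sum ?len ?S \<le> \<delta> * N / 1000"
  proof -
    have "(\<lambda>b. if real (length b) < \<kappa> / 10 then ?len b else 0) = short_length"
      by (simp add: short_length_def fun_eq_iff)
    then have "sum ?len ?S \<le> (\<Sum>C\<in>\<Phi>. lift short_length C)"
      using sum_shrunk_le[of ?len "\<lambda>b. real (length b) < \<kappa> / 10"] by simp
    also have "\<dots> < \<delta> * N / 1000" using not_bad by (auto simp: bad_def not_le)
    finally show ?thesis by simp
  qed
  have R: "sum ?len ?R \<le> \<delta> * N / 1000"
  proof -
    have "sum ?len ?R \<le> (\<Sum>C\<in>\<Phi>. lift (\<lambda>b. if \<not> distinct (map fst b) then ?len b else 0) C)"
      by (rule sum_shrunk_le) simp
    also have "\<dots> \<le> (\<Sum>C\<in>\<Phi>. if distinct (map fst C) then 0 else real k)"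
    proof (rule sum_mono)
      fix C assume "C \<in> \<Phi>"
      then have "length (rest C) \<le> k" using \<Phi> length_rest_le by blast
      moreover have "distinct (map fst C) \<Longrightarrow> distinct (map fst (rest C))"
        unfolding rest_def by (rule distinct_map_filter)
      ultimately show "lift (\<lambda>b. if \<not> distinct (map fst b) then ?len b else 0) C
          \<le> (if distinct (map fst C) then 0 else real k)" by (auto simp: lift_def)
    qed
    also have "\<dots> < \<delta> * N / 1000" using not_bad by (auto simp: bad_def not_le)
    finally show ?thesis by simp
  qed
  have "shrunk \<Phi> - good \<Phi> \<subseteq> ?S \<union> ?R \<union> ?D" by (auto simp: good_def tidy_def)
  then have "junk_vars \<Phi> \<subseteq> \<Union> (clause_vars ` ?S) \<union> \<Union> (clause_vars ` ?R) \<union> \<Union> (clause_vars ` ?D)"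
    unfolding junk_vars_def by blast
  then have "card (junk_vars \<Phi>) \<le> card (\<Union> (clause_vars ` ?S) \<union> \<Union> (clause_vars ` ?R) \<union> \<Union> (clause_vars ` ?D))"
    using finite_shrunk by (intro card_mono) auto
  also have "\<dots> \<le> card (\<Union> (clause_vars ` ?S)) + card (\<Union> (clause_vars ` ?R)) + card (\<Union> (clause_vars ` ?D))"
    by (intro card_Un_le[THEN order_trans] add_right_mono card_Un_le)
  finally have "real (card (junk_vars \<Phi>)) \<le> real (card (\<Union> (clause_vars ` ?S)))
      + real (card (\<Union> (clause_vars ` ?R))) + real (card (\<Union> (clause_vars ` ?D)))" by linarith
  also have "\<dots> \<le> sum ?len ?S + sum ?len ?R + sum ?len ?D"
    using finite_shrunk by (intro add_mono card_Union_vars_le) auto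
  also have "\<dots> \<le> \<delta> * N / 1000 + \<delta> * N / 1000 + \<delta> * N / 500"
    by (intro add_mono S R few_duplicates)
  also have "\<dots> \<le> \<delta> * N / 100" using deltaN by linarith
  finally show ?thesis .
qed

lemma rest_inj_good:
  assumes "C \<in> \<Phi>" "alive C" "C' \<in> \<Phi>" "alive C'" "rest C = rest C'" "rest C \<in> good \<Phi>"
  shows "C = C'"
proof -
  have "card (parents \<Phi> (rest C)) = 1" using assms by (simp add: good_def)
  then obtain X where "parents \<Phi> (rest C) = {X}" by (auto simp: card_1_singleton_iff)
  moreover have "C \<in> parents \<Phi> (rest C)" "C' \<in> parents \<Phi> (rest C)" using assms by (auto simp: parents_def)
  ultimately show ?thesis by simp
qed

lemma good_expansion:
  assumes D: "D \<subseteq> good \<Phi>" "(\<Sum>b\<in>D. real (length b)) \<le> 2 * \<delta> * N"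
  shows "49 / 50 * (\<Sum>b\<in>D. real (length b)) \<le> real (card (\<Union> (clause_vars ` D))) + \<delta> * N / 1000"
proof -
  let ?E = "{C \<in> \<Phi>. alive C \<and> rest C \<in> D}"
  have img: "rest ` ?E = D" using D(1) by (auto simp: good_def shrunk_def)
  have inj: "inj_on rest ?E" using D(1) rest_inj_good by (intro inj_onI) blast
  have len: "residual_len ?E = (\<Sum>b\<in>D. real (length b))"
    unfolding residual_len_def using sum.reindex[OF inj, of "\<lambda>b. real (length b)"] img by simp
  have "residual_vars ?E = \<Union> (clause_vars ` rest ` ?E)" unfolding residual_vars_def by (simp only: image_image)
  then have vars: "residual_vars ?E = \<Union> (clause_vars ` D)" by (simp only: img)
  show ?thesis unfolding len[symmetric] vars[symmetric]
    using D by (intro not_crowded) (auto simp: len good_def)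
qed

text \<open>Off the junk variables every residual clause containing \<open>x\<close> is good, so
  \<open>rest\<close> is injective on the clauses concerned. This links the weights of the residual
  formula to the sums estimated for the random formula.\<close>

lemma sum_var_clauses_good:
  assumes Y: "Y \<subseteq> U - junk_vars \<Phi>"
  shows "(\<Sum>x\<in>Y. \<Sum>b\<in>var_clauses (good \<Phi>) x. f x b)
    = (\<Sum>C\<in>\<Phi>. lift (\<lambda>b. \<Sum>x\<in>Y. if tidy b \<and> x \<in> clause_vars b then f x b else 0) C)"
proof -
  have "(\<Sum>C\<in>\<Phi>. lift (\<lambda>b. \<Sum>x\<in>Y. if tidy b \<and> x \<in> clause_vars b then f x b else 0) C)
      = (\<Sum>x\<in>Y. \<Sum>C\<in>\<Phi>. lift (\<lambda>b. if tidy b \<and> x \<in> clause_vars b then f x b else 0) C)"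
    unfolding lift_sum by (rule sum.swap)
  also have "\<dots> = (\<Sum>x\<in>Y. \<Sum>b\<in>var_clauses (good \<Phi>) x. f x b)"
  proof (rule sum.cong[OF refl])
    fix x assume "x \<in> Y"
    then have x: "x \<notin> junk_vars \<Phi>" using Y by auto
    let ?E = "{C \<in> \<Phi>. alive C \<and> tidy (rest C) \<and> x \<in> clause_vars (rest C)}"
    have good: "rest C \<in> good \<Phi>" if "C \<in> ?E" for C
      using that x by (auto simp: junk_vars_def shrunk_def)
    have "inj_on rest ?E" using good rest_inj_good by (intro inj_onI) blast
    moreover have "rest ` ?E = var_clauses (good \<Phi>) x"
      using good by (auto simp: var_clauses_def good_def shrunk_def)
    ultimately have "(\<Sum>b\<in>var_clauses (good \<Phi>) x. f x b) = (\<Sum>C\<in>?E. f x (rest C))"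
      using sum.reindex[of rest ?E "f x"] by simp
    also have "\<dots> = (\<Sum>C\<in>\<Phi>. lift (\<lambda>b. if tidy b \<and> x \<in> clause_vars b then f x b else 0) C)"
      using finite_\<Phi> by (simp add: sum.inter_filter) (auto simp: lift_def intro!: sum.cong)
    finally show "(\<Sum>C\<in>\<Phi>. lift (\<lambda>b. if tidy b \<and> x \<in> clause_vars b then f x b else 0) C)
        = (\<Sum>b\<in>var_clauses (good \<Phi>) x. f x b)" by simp
  qed
  finally show ?thesis by simp
qed

lemma few_heavy_good:
  "real (card {x \<in> U. occ_weight (good \<Phi>) x > 1 / \<delta> ^ 3}) \<le> \<delta> * N / 500" (is "real (card ?H) \<le> _")
proof -
  let ?G = "good \<Phi>" and ?w = "\<lambda>b. (1 + 2 * real (length b)) / 2 ^ length b"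
  have d: "0 < \<delta>" by (rule delta_eps)
  have finG: "finite ?G" using finite_shrunk by (simp add: good_def)
  have "real (card ?H) * (1 / \<delta> ^ 3) = (\<Sum>x\<in>?H. 1 / \<delta> ^ 3)" by simp
  also have "\<dots> \<le> (\<Sum>x\<in>?H. occ_weight ?G x)" by (intro sum_mono) auto
  also have "\<dots> \<le> (\<Sum>x\<in>U. occ_weight ?G x)"
    using finite_U by (intro sum_mono2) (auto simp: occ_weight_def intro!: sum_nonneg)
  also have "\<dots> = (\<Sum>x\<in>U. \<Sum>b\<in>{b \<in> ?G. x \<in> clause_vars b}. ?w b)"
    by (simp add: occ_weight_def var_clauses_def)
  also have "\<dots> = (\<Sum>b\<in>?G. \<Sum>x\<in>{x \<in> U. x \<in> clause_vars b}. ?w b)"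
    by (rule sum.swap_restrict[OF finite_U finG])
  also have "\<dots> = (\<Sum>b\<in>?G. weight_cap b)"
  proof (rule sum.cong[OF refl])
    fix b assume b: "b \<in> ?G"
    then have "{x \<in> U. x \<in> clause_vars b} = clause_vars b"
      using shrunk_vars[of b] by (auto simp: good_def)
    moreover have "card (clause_vars b) = length b"
      using b by (intro card_clause_vars) (simp add: good_def tidy_def)
    ultimately show "(\<Sum>x\<in>{x \<in> U. x \<in> clause_vars b}. ?w b) = weight_cap b"
      using b by (simp add: good_def weight_cap_def)
  qed
  also have "\<dots> \<le> (\<Sum>b\<in>{b \<in> shrunk \<Phi>. True}. weight_cap b)"
    using finite_shrunk weight_cap_nonneg by (intro sum_mono2) (auto simp: good_def)
  also have "\<dots> \<le> (\<Sum>C\<in>\<Phi>. lift (\<lambda>b. if True then weight_cap b else 0) C)"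
    by (rule sum_shrunk_le[OF weight_cap_nonneg])
  also have "\<dots> = (\<Sum>C\<in>\<Phi>. lift weight_cap C)" by simp
  also have "\<dots> \<le> N / (1000 * \<delta>\<^sup>2)" using not_bad by (auto simp: bad_def not_le)
  finally have "real (card ?H) \<le> N / (1000 * \<delta>\<^sup>2) * \<delta> ^ 3" using d by (simp add: pos_divide_le_eq)
  also have "\<dots> = \<delta> * N / 1000" using d by (simp add: power2_eq_square power3_eq_cube)
  also have "\<dots> \<le> \<delta> * N / 500" using deltaN by linarith
  finally show ?thesis .
qed

lemma card_exceeding_le:
  assumes "finite Y" "\<And>x. x \<in> Y \<Longrightarrow> f x > \<delta> / 100" "(\<Sum>x\<in>Y. f x) \<le> \<delta>\<^sup>2 * N / 10 ^ 5"
  shows "real (card Y) \<le> \<delta> * N / 1000"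
proof -
  have "real (card Y) * (\<delta> / 100) = (\<Sum>x\<in>Y. \<delta> / 100)" by simp
  also have "\<dots> \<le> (\<Sum>x\<in>Y. f x)" using assms(2) by (intro sum_mono) (auto intro: less_imp_le)
  also have "\<dots> \<le> \<delta>\<^sup>2 * N / 10 ^ 5" by (rule assms)
  also have "\<dots> = (\<delta> * N / 1000) * (\<delta> / 100)" by (simp add: power2_eq_square)
  finally show ?thesis using delta_eps(3) by (simp only: mult_le_cancel_right_pos divide_pos_pos)
qed

lemma card_abs_exceeding_le:
  assumes "\<And>e. \<bar>e\<bar> = 1 \<Longrightarrow> real (card {x \<in> U - junk_vars \<Phi>. e * f x > \<delta> / 100}) \<le> \<delta> * N / 1000"
  shows "real (card {x \<in> U - junk_vars \<Phi>. \<bar>f x\<bar> > \<delta> / 100}) \<le> \<delta> * N / 500"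
proof -
  let ?A = "\<lambda>e. {x \<in> U - junk_vars \<Phi>. e * f x > \<delta> / 100}"
  have "{x \<in> U - junk_vars \<Phi>. \<bar>f x\<bar> > \<delta> / 100} \<subseteq> ?A 1 \<union> ?A (-1)" by auto
  then have "card {x \<in> U - junk_vars \<Phi>. \<bar>f x\<bar> > \<delta> / 100} \<le> card (?A 1 \<union> ?A (-1))"
    using finite_U by (intro card_mono) auto
  also have "\<dots> \<le> card (?A 1) + card (?A (-1))" by (rule card_Un_le)
  finally show ?thesis using assms[of 1] assms[of "-1"] by linarith
qed

lemma few_signed_good:
  "real (card {x \<in> U - junk_vars \<Phi>. \<bar>signed_weight (good \<Phi>) x\<bar> > \<delta> / 100}) \<le> \<delta> * N / 500"
proof (rule card_abs_exceeding_le)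
  fix e :: real assume e: "\<bar>e\<bar> = 1"
  let ?Y = "{x \<in> U - junk_vars \<Phi>. e * signed_weight (good \<Phi>) x > \<delta> / 100}"
  have YU: "?Y \<subseteq> U" by auto
  have "(\<Sum>x\<in>?Y. signed_weight (good \<Phi>) x)
      = (\<Sum>C\<in>\<Phi>. lift (signed_sum ?Y) C)"
    unfolding signed_weight_def signed_sum_def[abs_def] by (rule sum_var_clauses_good) auto
  then have "(\<Sum>x\<in>?Y. e * signed_weight (good \<Phi>) x) = (\<Sum>C\<in>\<Phi>. lift (\<lambda>b. e * signed_sum ?Y b) C)"
    by (simp only: sum_distrib_left[symmetric]) (simp add: sum_distrib_left lift_def if_distrib cong: if_cong)
  also have "\<dots> \<le> \<delta>\<^sup>2 * N / 10 ^ 5" by (rule less_imp_le[OF signed_sum_less[OF e YU]])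
  finally show "real (card ?Y) \<le> \<delta> * N / 1000"
    using finite_U by (intro card_exceeding_le) auto
qed

text \<open>For fixed \<open>Y\<close> the sum is linear in \<Gamma> with coefficients
  \<open>c y\<close>, hence at most half of the sum of their absolute values. That sum splits into
  the sets where \<open>c\<close> is nonnegative and negative, and there
  \<open>pair_sum_less\<close> applies with sign 1 and - 1. So bounds for sets \<open>Z\<close>
  cover all \<Gamma>.\<close>

lemma few_pair_good:
  assumes \<Gamma>: "\<And>y. \<bar>\<Gamma> y\<bar> \<le> 1 / 2"
  shows "real (card {x \<in> U - junk_vars \<Phi>. \<bar>pair_weight (good \<Phi>) \<Gamma> x\<bar> > \<delta> / 100}) \<le> \<delta> * N / 500"
proof (rule card_abs_exceeding_le)
  fix e :: real assume e: "\<bar>e\<bar> = 1"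
  let ?Y = "{x \<in> U - junk_vars \<Phi>. e * pair_weight (good \<Phi>) \<Gamma> x > \<delta> / 100}"
  let ?h = "\<delta>\<^sup>2 * N / 10 ^ 5"
  have YU: "?Y \<subseteq> U" and finY: "finite ?Y" using finite_U by auto
  define c where "c y = (\<Sum>C\<in>\<Phi>. lift (pair_sum ?Y {y}) C)" for y
  have cZ: "(\<Sum>y\<in>Z. c y) = (\<Sum>C\<in>\<Phi>. lift (pair_sum ?Y Z) C)" for Z
  proof -
    have "pair_sum ?Y Z = (\<lambda>b. \<Sum>y\<in>Z. pair_sum ?Y {y} b)"
      unfolding pair_sum_def by (rule ext) (simp add: sum.swap[of _ Z])
    then show ?thesis unfolding c_def by (simp only: lift_sum) (rule sum.swap)
  qed
  have bound: "s * (\<Sum>y\<in>Z. c y) \<le> ?h" if "Z \<subseteq> U" "\<bar>s\<bar> = 1" for Z s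
  proof -
    have "(\<Sum>C\<in>\<Phi>. lift (\<lambda>b. s * pair_sum ?Y Z b) C) \<le> ?h"
      by (rule less_imp_le[OF pair_sum_less[OF that(2) YU that(1)]])
    moreover have "s * (\<Sum>y\<in>Z. c y) = (\<Sum>C\<in>\<Phi>. lift (\<lambda>b. s * pair_sum ?Y Z b) C)"
      unfolding cZ sum_distrib_left by (intro sum.cong) (auto simp: lift_def)
    ultimately show ?thesis by simp
  qed
  have "(\<Sum>x\<in>?Y. pair_weight (good \<Phi>) \<Gamma> x) = (\<Sum>C\<in>\<Phi>. lift (\<lambda>b. \<Sum>x\<in>?Y.
     if tidy b \<and> x \<in> clause_vars b then \<Sum>y\<in>clause_vars b - {x}.
       of_int (occ_sign x b) * of_int (occ_sign y b) * \<Gamma> y / 2 ^ length b else 0) C)"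
    unfolding pair_weight_def by (rule sum_var_clauses_good) auto
  also have "\<dots> = (\<Sum>C\<in>\<Phi>. \<Sum>y\<in>U. \<Gamma> y * lift (pair_sum ?Y {y}) C)"
  proof (rule sum.cong[OF refl])
    fix C assume C: "C \<in> \<Phi>"
    show "lift (\<lambda>b. \<Sum>x\<in>?Y. if tidy b \<and> x \<in> clause_vars b then \<Sum>y\<in>clause_vars b - {x}.
       of_int (occ_sign x b) * of_int (occ_sign y b) * \<Gamma> y / 2 ^ length b else 0) C
      = (\<Sum>y\<in>U. \<Gamma> y * lift (pair_sum ?Y {y}) C)"
    proof (cases "alive C")
      case True
      let ?b = "rest C"
      let ?t = "\<lambda>x y. of_int (occ_sign x ?b) * of_int (occ_sign y ?b) / 2 ^ length ?b :: real"
      have sub: "clause_vars ?b \<subseteq> U" using shrunk_vars[of ?b] C True by (auto simp: shrunk_def)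
      have "(\<Sum>x\<in>?Y. if tidy ?b \<and> x \<in> clause_vars ?b then \<Sum>y\<in>clause_vars ?b - {x}.
         of_int (occ_sign x ?b) * of_int (occ_sign y ?b) * \<Gamma> y / 2 ^ length ?b else 0)
        = (\<Sum>x\<in>?Y. \<Sum>y\<in>U. \<Gamma> y * (if tidy ?b \<and> x \<in> clause_vars ?b \<and> y \<in> clause_vars ?b - {x} then ?t x y else 0))"
      proof (rule sum.cong[OF refl])
        fix x
        have "(\<Sum>y\<in>clause_vars ?b - {x}. of_int (occ_sign x ?b) * of_int (occ_sign y ?b) * \<Gamma> y / 2 ^ length ?b)
          = (\<Sum>y\<in>U \<inter> (clause_vars ?b - {x}). \<Gamma> y * ?t x y)"
          using sub by (intro sum.cong) auto
        also have "\<dots> = (\<Sum>y\<in>U. if y \<in> clause_vars ?b - {x} then \<Gamma> y * ?t x y else 0)"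
          by (rule sum.inter_restrict[OF finite_U])
        finally have eq: "(\<Sum>y\<in>clause_vars ?b - {x}. of_int (occ_sign x ?b) * of_int (occ_sign y ?b) * \<Gamma> y / 2 ^ length ?b)
          = (\<Sum>y\<in>U. if y \<in> clause_vars ?b - {x} then \<Gamma> y * ?t x y else 0)" .
        show "(if tidy ?b \<and> x \<in> clause_vars ?b then \<Sum>y\<in>clause_vars ?b - {x}.
            of_int (occ_sign x ?b) * of_int (occ_sign y ?b) * \<Gamma> y / 2 ^ length ?b else 0)
          = (\<Sum>y\<in>U. \<Gamma> y * (if tidy ?b \<and> x \<in> clause_vars ?b \<and> y \<in> clause_vars ?b - {x} then ?t x y else 0))"
          unfolding eq by (auto intro!: sum.cong sum.neutral)
      qed
      also have "\<dots> = (\<Sum>y\<in>U. \<Gamma> y * pair_sum ?Y {y} ?b)"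
        unfolding pair_sum_def by (subst sum.swap) (simp add: sum_distrib_left)
      finally show ?thesis using True by (simp add: lift_def)
    qed (simp add: lift_def)
  qed
  also have "\<dots> = (\<Sum>y\<in>U. \<Gamma> y * c y)"
    unfolding c_def sum_distrib_left by (rule sum.swap)
  finally have eq: "(\<Sum>x\<in>?Y. pair_weight (good \<Phi>) \<Gamma> x) = (\<Sum>y\<in>U. \<Gamma> y * c y)" .
  have "(\<Sum>x\<in>?Y. e * pair_weight (good \<Phi>) \<Gamma> x) = (\<Sum>y\<in>U. e * \<Gamma> y * c y)"
    by (simp only: sum_distrib_left[symmetric] eq mult.assoc)
  also have "\<dots> \<le> (\<Sum>y\<in>U. 1 / 2 * \<bar>c y\<bar>)"
  proof (rule sum_mono)
    fix y
    have "e * \<Gamma> y * c y \<le> \<bar>e\<bar> * \<bar>\<Gamma> y\<bar> * \<bar>c y\<bar>" by (metis abs_ge_self abs_mult)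
    also have "\<dots> \<le> 1 / 2 * \<bar>c y\<bar>" using e \<Gamma>[of y] by (intro mult_right_mono) auto
    finally show "e * \<Gamma> y * c y \<le> 1 / 2 * \<bar>c y\<bar>" .
  qed
  also have "\<dots> = 1 / 2 * (\<Sum>y\<in>U. \<bar>c y\<bar>)" by (simp only: sum_distrib_left)
  also have "(\<Sum>y\<in>U. \<bar>c y\<bar>) = (\<Sum>y\<in>U. if c y \<ge> 0 then c y else - c y)" by (intro sum.cong) auto
  also have "\<dots> = 1 * (\<Sum>y\<in>{y \<in> U. c y \<ge> 0}. c y) + (-1) * (\<Sum>y\<in>{y \<in> U. \<not> c y \<ge> 0}. c y)"
    using finite_U by (simp add: sum.If_cases Int_def sum_negf)
  also have "1 / 2 * \<dots> \<le> 1 / 2 * (?h + ?h)" by (intro mult_left_mono add_mono bound) auto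
  finally have "(\<Sum>x\<in>?Y. e * pair_weight (good \<Phi>) \<Gamma> x) \<le> ?h" by (simp add: mult.commute)
  then show "real (card ?Y) \<le> \<delta> * N / 1000"
    using finY by (intro card_exceeding_le) auto
qed

lemma few_excess_good:
  assumes T: "T \<subseteq> U" "real (card T) \<le> \<delta> * N"
  shows "real (card {x \<in> U - junk_vars \<Phi>. excess_weight (good \<Phi>) \<delta> T x > \<delta> / 100}) \<le> \<delta> * N / 500"
    (is "real (card ?X) \<le> _")
proof (rule ccontr)
  assume "\<not> ?thesis"
  then have big: "real (card ?X) > \<delta> * N / 500" by simp
  \<comment> \<open>The tail bound for the excess covers only sets of size at most \<delta> N / 500,
    so a subset of size just above \<delta> N / 1000 is selected; \<delta> N \<ge> 1000 leaves room
    for an integer.\<close>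
  define q where "q = nat (\<lfloor>\<delta> * N / 1000\<rfloor> + 1)"
  have q: "real q > \<delta> * N / 1000" "real q \<le> \<delta> * N / 500" using deltaN unfolding q_def by linarith+
  then have "q \<le> card ?X" using big by linarith
  then obtain Y where Y: "Y \<subseteq> ?X" "card Y = q" by (rule obtain_subset_with_card_n)
  have YU: "Y \<subseteq> U" using Y(1) by auto
  then have finY: "finite Y" using finite_U finite_subset by blast
  have "(\<Sum>x\<in>Y. excess_weight (good \<Phi>) \<delta> T x) = (\<Sum>C\<in>\<Phi>. lift (\<lambda>b. \<Sum>x\<in>Y. if tidy b \<and> x \<in> clause_vars b
     then (if 2 * card (clause_vars b \<inter> T) < length b
       then excess (\<lambda>y. of_bool (y \<in> T) + 2 * \<delta>) (clause_vars b - {x}) / 2 ^ length b else 0) else 0) C)"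
    unfolding excess_weight_def using Y by (intro sum_var_clauses_good) auto
  also have "\<dots> = (\<Sum>C\<in>\<Phi>. lift (excess_sum Y T) C)"
    unfolding excess_sum_def[abs_def]
    by (intro sum.cong refl arg_cong[where f = "\<lambda>w. lift w C" for C] ext) auto
  also have "\<dots> \<le> \<delta>\<^sup>2 * N / 10 ^ 5"
  proof -
    have "real (card Y) \<le> \<delta> * N / 500" using Y q by simp
    then show ?thesis using less_imp_le[OF excess_sum_less[OF YU T(1) _ T(2)]] by blast
  qed
  finally have "real (card Y) \<le> \<delta> * N / 1000"
    using Y finY by (intro card_exceeding_le) auto
  then show False using Y q by simp
qed

lemma quasirandom_shrunk: "quasirandom (shrunk \<Phi>) (good \<Phi>) U (junk_vars \<Phi>) \<delta> N"
proof
  have "\<delta> \<le> 1 / 1000" using delta_small(1) by (rule order_trans) simp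
  then show "0 < \<delta>" "\<delta> \<le> 1 / 1000" using delta_eps by auto
  show "(1 + 2 * real (length b)) / 2 ^ length b \<le> \<delta> ^ 8" if "b \<in> good \<Phi>" for b
  proof -
    have t: "tidy b" using that by (simp add: good_def)
    have "1 * ((1 + 2 * real (length b)) / 2 ^ length b) \<le> real (length b) * ((1 + 2 * real (length b)) / 2 ^ length b)"
      using tidy_length(1)[OF t] by (intro mult_right_mono) auto
    also have "\<dots> = weight_cap b" using t by (simp add: weight_cap_def)
    finally show ?thesis using weight_cap_small[of b] by simp
  qed
  show "real (length b) \<le> \<delta> * N / 10" if "b \<in> good \<Phi>" for b
  proof -
    have "real (length b) \<le> real k" using that shrunk_length by (simp add: good_def)
    then show ?thesis using k_small deltaN by linarith
  qed
qed (use finite_shrunk finite_U shrunk_vars tidy_long N_nonneg junk_vars_subset card_junk_vars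
      good_expansion few_heavy_good few_signed_good few_pair_good few_excess_good
      in \<open>auto simp: good_def tidy_def junk_vars_def\<close>)

end

theorem prb_few_biased:
  "prb {\<Phi>. real (card {x \<in> U. \<bar>BP_marginal (shrunk \<Phi>) w x - 1 / 2\<bar> > \<delta>}) \<le> \<delta> * N}
     \<ge> 1 - 12 * exp (- \<delta> * N / 2000)"
proof -
  let ?S = "{D. D \<subseteq> clauses k n \<and> card D = m}"
  let ?good = "{\<Phi>. real (card {x \<in> U. \<bar>BP_marginal (shrunk \<Phi>) w x - 1 / 2\<bar> > \<delta>}) \<le> \<delta> * N}"
  have "m \<le> 2 * m\<^sup>2" by (cases m) (auto simp: power2_eq_square)
  then have mM: "m \<le> card (clauses k n)" using m_small by linarith
  then obtain D where "D \<subseteq> clauses k n" "card D = m" by (rule obtain_subset_with_card_n)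
  then have set: "set_pmf (random_cnf k n m) = ?S"
    unfolding random_cnf_def using finite_clauses by (intro set_pmf_of_set) auto
  have "\<Phi> \<in> ?good" if "\<Phi> \<in> ?S - bad" for \<Phi>
    using quasirandom.few_biased_marginals[OF quasirandom_shrunk] that by auto
  then have "prb (?S - bad) \<le> prb ?good" by (intro measure_pmf.finite_measure_mono) auto
  moreover have "prb (?S - bad) \<ge> prb ?S - prb bad"
    by (simp add: measure_pmf.finite_measure_Diff' measure_pmf.finite_measure_mono)
  moreover have "prb ?S = 1" using set by (metis measure_pmf.prob_eq_1 AE_measure_pmf sets_measure_pmf UNIV_I)
  ultimately show ?thesis using prb_bad by linarith
qed

end

section \<open>From residual formulas to the theorem\<close>

lemma residual_eq:
  "residual \<Phi> \<pi> \<sigma> t = (\<lambda>C. filter (\<lambda>l. fst l \<notin> \<pi> ` {1..t}) C)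
     ` {C \<in> \<Phi>. \<forall>l\<in>set C. fst l \<in> \<pi> ` {1..t} \<longrightarrow> snd l \<noteq> \<sigma> (fst l)}"
proof (induction t)
  case (Suc t)
  let ?S = "\<pi> ` {1..t}" and ?x = "\<pi> (Suc t)"
  let ?alive = "\<lambda>S C. \<forall>l\<in>set C. fst l \<in> S \<longrightarrow> snd l \<noteq> \<sigma> (fst l)"
  let ?f = "\<lambda>S C. filter (\<lambda>l. fst l \<notin> S) C"
  have S: "\<pi> ` {1..Suc t} = insert ?x ?S" by (simp add: atLeastAtMostSuc_conv)
  have twice: "filter (\<lambda>l. fst l \<noteq> ?x) (?f ?S C) = ?f (insert ?x ?S) C" for C :: clause
    by (simp add: conj_commute)
  \<comment> \<open>Whether a further substitution deletes a clause can be read off its residue, so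
    merging equal residues at each stage gives the same as merging once at the end.\<close>
  have alive: "?alive ?S C \<and> (?x, \<sigma> ?x) \<notin> set (?f ?S C) \<longleftrightarrow> ?alive (insert ?x ?S) C" for C :: clause
  proof
    assume A: "?alive ?S C \<and> (?x, \<sigma> ?x) \<notin> set (?f ?S C)"
    show "?alive (insert ?x ?S) C"
    proof (intro ballI impI notI)
      fix l assume l: "l \<in> set C" "fst l \<in> insert ?x ?S" "snd l = \<sigma> (fst l)"
      then have "fst l \<notin> ?S" using A by blast
      moreover from this have "l = (?x, \<sigma> ?x)" using l by (cases l) simp
      ultimately show False using A l(1) by simp
    qed
  next
    assume A: "?alive (insert ?x ?S) C"
    then have "(?x, \<sigma> ?x) \<notin> set C" by force
    then show "?alive ?S C \<and> (?x, \<sigma> ?x) \<notin> set (?f ?S C)" using A by simp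
  qed
  have "residual \<Phi> \<pi> \<sigma> (Suc t) = filter (\<lambda>l. fst l \<noteq> ?x) ` {D \<in> ?f ?S ` {C \<in> \<Phi>. ?alive ?S C}. (?x, \<sigma> ?x) \<notin> set D}"
    using Suc by (simp add: substitute_def)
  also have "{D \<in> ?f ?S ` {C \<in> \<Phi>. ?alive ?S C}. (?x, \<sigma> ?x) \<notin> set D}
      = ?f ?S ` {C \<in> \<Phi>. ?alive ?S C \<and> (?x, \<sigma> ?x) \<notin> set (?f ?S C)}" by blast
  also have "\<dots> = ?f ?S ` {C \<in> \<Phi>. ?alive (insert ?x ?S) C}" by (simp only: alive)
  also have "filter (\<lambda>l. fst l \<noteq> ?x) ` \<dots> = ?f (insert ?x ?S) ` {C \<in> \<Phi>. ?alive (insert ?x ?S) C}"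
    unfolding image_image by (simp only: twice)
  finally show ?case by (simp only: S)
qed simp

text \<open>The terms grow geometrically with ratio exp x for x = c k / n, so the sum is at most the
  last term times 1 / (1 - exp (- x)) \<le> 1 + 1 / x.\<close>

lemma sum_bias_bound_le:
  assumes "c > 0" "n > 0" "k > 0"
  shows "(\<Sum>s = 1..t. bias_bound c k n s) \<le> bias_bound c k n t * (1 + real n / (c * real k))"
proof (induction t)
  case 0
  then show ?case using assms by (simp add: bias_bound_def)
next
  case (Suc t)
  define x where "x = c * real k / real n"
  have x: "x > 0" using assms by (simp add: x_def)
  have inv: "real n / (c * real k) = 1 / x" by (simp add: x_def)
  have shift: "bias_bound c k n t = bias_bound c k n (Suc t) * exp (- x)"
    unfolding bias_bound_def x_def exp_add[symmetric] using assms by (simp add: field_simps)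
  have "exp (- x) * (1 + 1 / x) \<le> 1 / x"
  proof -
    have "(1 + x) / x \<le> exp x / x" using x exp_ge_add_one_self[of x] by (intro divide_right_mono) auto
    then have "exp (- x) * ((1 + x) / x) \<le> exp (- x) * (exp x / x)" by (intro mult_left_mono) auto
    then show ?thesis using x by (simp add: add_divide_distrib exp_minus add.commute)
  qed
  then have "bias_bound c k n (Suc t) * (exp (- x) * (1 + 1 / x)) \<le> bias_bound c k n (Suc t) * (1 / x)"
    by (intro mult_left_mono) (simp_all add: bias_bound_def)
  moreover have "(\<Sum>s = 1..Suc t. bias_bound c k n s) \<le> bias_bound c k n t * (1 + 1 / x) + bias_bound c k n (Suc t)"
    using Suc by (simp add: inv)
  ultimately show ?case unfolding inv shift by (simp add: distrib_left mult.assoc)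
qed

text \<open>The second requirement on n makes \<delta> N large for all admissible t at once, as
  \<delta> \<ge> exp (- k / 500) and N \<ge> 10^8 n / k.\<close>

lemma prob_balanced:
  fixes k n t :: nat and r :: real
  assumes k: "k \<ge> 3" and r: "2 ^ k * 10 ^ 8 / real k \<le> r"
    and n_large: "real n \<ge> (r + 1)\<^sup>2" "10 ^ 8 * exp (- real k / 500) / real k * real n
        \<ge> 10 ^ 5 + 1000 * real k + 2000 * (r + 1) * exp (real k) * real k ^ 2"
    and \<pi>: "\<pi> permutes {1..n}" and t: "real t \<le> (1 - r / 2 ^ k) * real n"
  shows "measure_pmf.prob (random_cnf k n (nat \<lceil>r * real n\<rceil>))
           {\<Phi>. balanced n w \<Phi> \<pi> \<sigma> (bias_bound (1 / 500) k n t) t}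
         \<ge> 1 - exp (- 2 * (exp (- real k / 500) / real k) * real n - 10 * (\<Sum>s = 1..t. bias_bound (1 / 500) k n s))"
proof -
  let ?m = "nat \<lceil>r * real n\<rceil>"
  define S where "S = \<pi> ` {1..t}"
  have kr: "real k \<ge> 3" using k by simp
  have "real k \<le> 2 ^ k" using of_nat_less_two_power[of k, where ?'a = real] by simp
  then have "10 ^ 8 * (real k / real k) \<le> 10 ^ 8 * (2 ^ k / real k)"
    by (intro mult_left_mono divide_right_mono) auto
  then have r1: "r \<ge> 10 ^ 8" using r kr by (simp add: mult.commute)
  have "(r + 1)\<^sup>2 \<ge> 1" using r1 by (simp add: power2_eq_square mult_ge1_I)
  then have n1: "real n \<ge> 1" using n_large(1) by linarith
  then have n0: "n > 0" "real n > 0" by auto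
  have rn: "0 \<le> r / 2 ^ k * real n" using r1 by simp
  have tn: "real t \<le> real n" using t rn by (simp add: left_diff_distrib)
  have S: "S \<subseteq> {1..n}" unfolding S_def
  proof (rule image_subsetI)
    fix s assume "s \<in> {1..t}"
    then show "\<pi> s \<in> {1..n}" unfolding permutes_in_image[OF \<pi>] using tn by simp
  qed
  interpret partial_assignment n k S \<sigma> using S n0 by unfold_locales
  have "card S = t" unfolding S_def by (simp add: card_image[OF permutes_inj_on[OF \<pi>]])
  then have "card ({1..n} - S) = n - t" using card_Diff_subset[OF finite_subset[OF S] S] by simp
  then have N: "N = real n - real t"
    unfolding N_def U_def using tn by simp
  then have N_lower: "N \<ge> r / 2 ^ k * real n" using t by (simp add: left_diff_distrib)
  have "10 ^ 8 / real k \<le> r / 2 ^ k" using r by (simp add: field_simps)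
  then have "10 ^ 8 / real k * real n \<le> r / 2 ^ k * real n" using n0 by (intro mult_right_mono) auto
  then have N_k: "10 ^ 8 / real k * real n \<le> N" using N_lower by linarith
  have kappa: "\<kappa> \<ge> 10 ^ 8"
    using N_k kr n0 by (simp add: \<kappa>_def field_simps)
  have m: "real ?m \<le> r * real n + 1" "real ?m \<le> (r + 1) * real n"
  proof -
    show 1: "real ?m \<le> r * real n + 1" using r1 n0 by (simp add: of_nat_nat ceiling_le_iff)
    show "real ?m \<le> (r + 1) * real n" using 1 n1 by (simp add: distrib_right)
  qed
  interpret random_partial_assignment n k S \<sigma> ?m
  proof
    have "real (2 * ?m\<^sup>2) = 2 * (real ?m)\<^sup>2" by simp
    also have "\<dots> \<le> 2 * ((r + 1) * real n)\<^sup>2" using m by (intro mult_left_mono power_mono) auto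
    also have "\<dots> = 2 * real n ^ 2 * (r + 1)\<^sup>2" by (simp add: power_mult_distrib)
    \<comment> \<open>With (r + 1)^2 \<le> n, 2 m^2 is of order n^3, and k \<ge> 3 makes the number
      of clauses at least (2 n)^3.\<close>
    also have "\<dots> \<le> 2 * real n ^ 2 * real n" using n_large(1) by (intro mult_left_mono) auto
    also have "\<dots> \<le> (2 * real n) ^ 3" using n0 by (simp add: power2_eq_square power3_eq_cube)
    also have "\<dots> \<le> (2 * real n) ^ k" using k n1 by (intro power_increasing) auto
    also have "\<dots> = real (card (clauses k n))" by (simp add: card_clauses)
    finally show "2 * ?m\<^sup>2 \<le> card (clauses k n)" by (simp only: of_nat_le_iff)
    have "r * real n + 1 \<le> 2 * (r * real n)"
    proof -
      have "1 * 1 \<le> r * real n" using r1 n1 by (intro mult_mono) auto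
      then show ?thesis by simp
    qed
    also have "r * real n \<le> N * 2 ^ k" using N_lower by (simp add: field_simps)
    finally show "real ?m \<le> 2 * N * 2 ^ k" using m by simp
  qed
  have N_n: "N \<le> real n" by (rule N_le)
  have delta_lower: "exp (- real k / 500) \<le> \<delta>"
  proof -
    have "\<kappa> \<le> real k" using N_n n0 by (simp add: \<kappa>_def divide_le_eq mult_left_mono)
    then show ?thesis by (simp add: \<delta>_def)
  qed
  have dN: "10 ^ 8 * exp (- real k / 500) / real k * real n \<le> \<delta> * N"
  proof -
    have "exp (- real k / 500) * (10 ^ 8 / real k * real n) \<le> \<delta> * N"
      using delta_lower N_k by (intro mult_mono) (auto simp: \<delta>_def)
    then show ?thesis by (simp add: mult_ac)
  qed
  define X where "X = 2000 * (r + 1) * exp (real k) * real k ^ 2"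
  have "0 \<le> X" using r1 by (simp add: X_def)
  moreover have "10 ^ 5 + 1000 * real k + X \<le> \<delta> * N"
    unfolding X_def by (rule order_trans[OF n_large(2) dN])
  ultimately have big: "X \<le> \<delta> * N" "1000 * real k \<le> \<delta> * N" "10 ^ 5 \<le> \<delta> * N"
    using kr by simp_all
  interpret long_clause_regime n k S \<sigma> ?m
  proof
    show "\<kappa> \<ge> 10 ^ 8" by (rule kappa)
    show "real k \<le> \<delta> * N / 1000" using big(2) by simp
    have "real ?m * (exp (real k) * real k ^ 2 / real n) \<le> ((r + 1) * real n) * (exp (real k) * real k ^ 2 / real n)"
      using m by (intro mult_right_mono) auto
    also have "\<dots> = (r + 1) * exp (real k) * real k ^ 2" using n0 by simp
    also have "\<dots> = X / 2000" by (simp add: X_def)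
    also have "\<dots> \<le> \<delta> * N / 2000" using big(1) by simp
    finally show "real ?m * (exp (real k) * real k ^ 2 / real n) \<le> \<delta> * N / 2000" .
  qed
  have delta: "bias_bound (1 / 500) k n t = \<delta>"
    using n0 by (simp add: bias_bound_def \<delta>_def \<kappa>_def N field_simps)
  have "shrunk \<Phi> = residual \<Phi> \<pi> \<sigma> t" for \<Phi>
    unfolding shrunk_def alive_def rest_def unfolding residual_eq S_def ..
  then have sub: "{\<Phi>. real (card {x \<in> U. \<bar>BP_marginal (shrunk \<Phi>) w x - 1 / 2\<bar> > \<delta>}) \<le> \<delta> * N}
      \<subseteq> {\<Phi>. balanced n w \<Phi> \<pi> \<sigma> (bias_bound (1 / 500) k n t) t}"
  proof (intro subsetI CollectI)
    fix \<Phi> assume shrunk: "\<And>\<Phi>. shrunk \<Phi> = residual \<Phi> \<pi> \<sigma> t"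
      and \<Phi>: "\<Phi> \<in> {\<Phi>. real (card {x \<in> U. \<bar>BP_marginal (shrunk \<Phi>) w x - 1 / 2\<bar> > \<delta>}) \<le> \<delta> * N}"
    have "card {l \<in> {t<..n}. biased w \<Phi> \<pi> \<sigma> \<delta> t (\<pi> l)}
       \<le> card {x \<in> U. \<bar>BP_marginal (shrunk \<Phi>) w x - 1 / 2\<bar> > \<delta>}"
    proof (rule card_inj_on_le[where f = \<pi>])
      show "inj_on \<pi> {l \<in> {t<..n}. biased w \<Phi> \<pi> \<sigma> \<delta> t (\<pi> l)}" by (rule permutes_inj_on[OF \<pi>])
      show "\<pi> ` {l \<in> {t<..n}. biased w \<Phi> \<pi> \<sigma> \<delta> t (\<pi> l)}
          \<subseteq> {x \<in> U. \<bar>BP_marginal (shrunk \<Phi>) w x - 1 / 2\<bar> > \<delta>}"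
      proof (rule image_subsetI)
        fix l assume l: "l \<in> {l \<in> {t<..n}. biased w \<Phi> \<pi> \<sigma> \<delta> t (\<pi> l)}"
        have "\<pi> l \<noteq> \<pi> s" if "s \<in> {1..t}" for s
        proof
          assume "\<pi> l = \<pi> s"
          then have "l = s" by (rule injD[OF permutes_inj[OF \<pi>]])
          then show False using l that by simp
        qed
        then have "\<pi> l \<notin> S" unfolding S_def by blast
        moreover have "\<pi> l \<in> {1..n}" unfolding permutes_in_image[OF \<pi>] using l by simp
        ultimately show "\<pi> l \<in> {x \<in> U. \<bar>BP_marginal (shrunk \<Phi>) w x - 1 / 2\<bar> > \<delta>}"
          using l by (simp add: U_def biased_def shrunk)
      qed
    qed (simp add: finite_U)
    then show "balanced n w \<Phi> \<pi> \<sigma> (bias_bound (1 / 500) k n t) t"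
      using \<Phi> unfolding balanced_def delta N[symmetric] by simp
  qed
  \<comment> \<open>The budget is \<delta> N / 2000. The bias sum takes at most 10 + 5000 / 10^8 *
    \<delta> N, the \<xi> term 2 / 10^8 * \<delta> N, and the factor 12 \<le> exp 4 takes 4; the
    constants are covered by \<delta> N \<ge> 10^5.\<close>
  have exponent: "12 * exp (- \<delta> * N / 2000)
    \<le> exp (- 2 * (exp (- real k / 500) / real k) * real n - 10 * (\<Sum>s = 1..t. bias_bound (1 / 500) k n s))"
  proof -
    have d: "0 < \<delta>" "\<delta> \<le> 1" using delta_eps delta_small by (auto intro: order_trans)
    have "(\<Sum>s = 1..t. bias_bound (1 / 500) k n s) \<le> \<delta> * (1 + real n / (1 / 500 * real k))"
      unfolding delta[symmetric] using n0 k by (intro sum_bias_bound_le) auto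
    also have "\<dots> = \<delta> + 500 * (\<delta> * (real n / real k))" by (simp add: algebra_simps)
    also have "\<delta> * (real n / real k) \<le> \<delta> * (N / 10 ^ 8)"
    proof -
      have "real n / real k \<le> N / 10 ^ 8" using N_k kr by (simp add: field_simps)
      then show ?thesis using d by (intro mult_left_mono) auto
    qed
    finally have A: "10 * (\<Sum>s = 1..t. bias_bound (1 / 500) k n s) \<le> 10 + 5000 / 10 ^ 8 * (\<delta> * N)"
      using d by (simp add: field_simps)
    have B: "2 * (exp (- real k / 500) / real k) * real n \<le> 2 / 10 ^ 8 * (\<delta> * N)"
      using dN by (simp add: field_simps)
    have "(12::real) \<le> exp 1 ^ 4"
    proof -
      have "(2::real) ^ 4 \<le> exp 1 ^ 4" using exp_ge_add_one_self[of 1] by (intro power_mono) auto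
      then show ?thesis by simp
    qed
    also have "\<dots> = exp (4::real)" by (simp add: exp_of_nat_mult[symmetric])
    finally have "12 * exp (- \<delta> * N / 2000) \<le> exp 4 * exp (- \<delta> * N / 2000)" by (intro mult_right_mono) auto
    also have "\<dots> = exp (4 - \<delta> * N / 2000)" by (simp add: exp_add[symmetric])
    also have "4 - \<delta> * N / 2000
      \<le> - (2 * (exp (- real k / 500) / real k) * real n) - 10 * (\<Sum>s = 1..t. bias_bound (1 / 500) k n s)"
    proof -
      have "4 - x / 2000 \<le> - b - a" if "a \<le> 10 + 5000 / 10 ^ 8 * x" "b \<le> 2 / 10 ^ 8 * x" "10 ^ 5 \<le> x"
        for a b x :: real using that by simp
      from this[OF A B big(3)] show ?thesis .
    qed
    finally show ?thesis by simp
  qed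
  have "1 - 12 * exp (- \<delta> * N / 2000)
      \<le> prb {\<Phi>. real (card {x \<in> U. \<bar>BP_marginal (shrunk \<Phi>) w x - 1 / 2\<bar> > \<delta>}) \<le> \<delta> * N}"
    by (rule prb_few_biased)
  also have "\<dots> \<le> prb {\<Phi>. balanced n w \<Phi> \<pi> \<sigma> (bias_bound (1 / 500) k n t) t}"
    using sub by (intro measure_pmf.finite_measure_mono) auto
  finally show ?thesis using exponent by linarith
qed

theorem theorem2:
  "\<exists>c \<rho>\<^sub>0 :: real. c > 0 \<and> \<rho>\<^sub>0 > 0 \<and>
     (\<forall>(k::nat) (r::real). k \<ge> 3 \<longrightarrow> 2 ^ k * \<rho>\<^sub>0 / real k \<le> r \<longrightarrow> r \<le> 2 ^ k * ln 2 \<longrightarrow>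
       (\<exists>\<xi>::real. \<xi> > 0 \<and>
         (\<exists>n\<^sub>0::nat. \<forall>n \<ge> n\<^sub>0. \<forall>\<omega> :: nat \<Rightarrow> nat. (\<forall>i. \<omega> i \<ge> 1) \<longrightarrow>
           (\<forall>\<pi> (\<sigma> :: nat \<Rightarrow> bool) (t::nat).
              \<pi> permutes {1..n} \<longrightarrow> real t \<le> (1 - r / 2 ^ k) * real n \<longrightarrow>
              measure_pmf.prob (random_cnf k n (nat \<lceil>r * real n\<rceil>))
                {\<Phi>. balanced n (\<omega> n) \<Phi> \<pi> \<sigma> (bias_bound c k n t) t}
              \<ge> 1 - exp (- 2 * \<xi> * real n - 10 * (\<Sum>s = 1..t. bias_bound c k n s))))))"
proof (rule exI[of _ "1 / 500"], rule exI[of _ "10 ^ 8"], intro conjI allI impI)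
  fix k :: nat and r :: real
  assume k: "k \<ge> 3" and r: "2 ^ k * 10 ^ 8 / real k \<le> r"
  let ?a = "10 ^ 8 * exp (- real k / 500) / real k"
  let ?b = "10 ^ 5 + 1000 * real k + 2000 * (r + 1) * exp (real k) * real k ^ 2"
  let ?n0 = "nat \<lceil>max ((r + 1)\<^sup>2) (?b / ?a)\<rceil>"
  have a: "?a > 0" using k by simp
  have large: "real n \<ge> (r + 1)\<^sup>2" "?a * real n \<ge> ?b" if "n \<ge> ?n0" for n
  proof -
    have "real n \<ge> max ((r + 1)\<^sup>2) (?b / ?a)" using that by linarith
    then show "real n \<ge> (r + 1)\<^sup>2" "?a * real n \<ge> ?b"
      using a by (simp_all only: max.bounded_iff pos_divide_le_eq mult.commute[of ?a])
  qed
  show "\<exists>\<xi>>0. \<exists>n\<^sub>0. \<forall>n\<ge>n\<^sub>0. \<forall>\<omega> :: nat \<Rightarrow> nat. (\<forall>i. \<omega> i \<ge> 1) \<longrightarrow>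
     (\<forall>\<pi> (\<sigma> :: nat \<Rightarrow> bool) (t::nat).
        \<pi> permutes {1..n} \<longrightarrow> real t \<le> (1 - r / 2 ^ k) * real n \<longrightarrow>
        measure_pmf.prob (random_cnf k n (nat \<lceil>r * real n\<rceil>))
          {\<Phi>. balanced n (\<omega> n) \<Phi> \<pi> \<sigma> (bias_bound (1 / 500) k n t) t}
        \<ge> 1 - exp (- 2 * \<xi> * real n - 10 * (\<Sum>s = 1..t. bias_bound (1 / 500) k n s)))"
  \<comment> \<open>This \<xi> satisfies 10^8 \<xi> n \<le> \<delta> N for every admissible t, so 2
    \<xi> n is negligible against \<delta> N / 2000.\<close>
  proof (rule exI[of _ "exp (- real k / 500) / real k"], intro conjI exI[of _ ?n0] allI impI)
    show "0 < exp (- real k / 500) / real k" using k by simp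
  qed (rule prob_balanced[OF k r large])
qed simp_all

end
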